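(* Let $0<s<1$, $q>1$, $b>0$, and consider the external field $Q(x)=-q\,|x-bi|^{-s}=-q\,(x^2+b^2)^{-s/2}$ on $\mathbb{R}$. Let $\mu_Q$ be the Riesz $s$-equilibrium measure on $\mathbb{R}$ in the external field $Q$ (the minimizer of $\iint|x-y|^{-s}d\nu(x)d\nu(y)+2\int Q\,d\nu$ over Borel probability measures $\nu$ on $\mathbb{R}$). For $a>0$ and $|x|<a$ (and $x=a$) define $$I_a(x)=\int_0^{\infty}\frac{u^{\frac{1-s}{2}}}{(u+a^2+b^2)^{1-\frac{s}{2}}}\,\frac{du}{u+a^2-x^2},$$ so that $I_a(a)=\dfrac{\mathcal{B}\left(\frac12,\frac{1-s}{2}\right)}{\sqrt{a^2+b^2}}$. Define, for $a>0$, $$\mathcal{F}_s(a)=\frac{\Gamma(1+s)}{2^s\,\Gamma\left(\frac{1+s}{2}\right)}\,a^{-s}\left(\Gamma\left(\tfrac{1-s}{2}\right)-q\,\frac{\sqrt{\pi}}{\Gamma\left(1+\frac{s}{2}\right)}\left(\frac{a}{\sqrt{a^2+b^2}}\right)^{s}{}_2F_1\left(\tfrac{s}{2},\tfrac{1+s}{2};1+\tfrac{s}{2};\tfrac{a^2}{a^2+b^2}\right)\right).$$ Then the equation $\mathcal{F}_s'(a)=0$ has a unique solution $\widetilde{a}=\widetilde{a}(s,q,b)\in(0,+\infty)$, the support of $\mu_Q$ is $S_Q=[-\widetilde{a},\widetilde{a}]$, and $\mu_Q$ is absolutely continuous with density $$\mu_Q'(x)=\frac{q\,b^{1-s}}{\mathcal{B}\left(\frac12,\frac{1-s}{2}\right)\mathcal{B}\left(\frac{1+s}{2},\frac{1-s}{2}\right)}\left(\frac{\mathcal{B}\left(\frac{1+s}{2},\frac{1-s}{2}\right)}{(x^2+b^2)^{1-\frac{s}{2}}}-\frac{I_{\widetilde{a}}(\widetilde{a})-I_{\widetilde{a}}(x)}{(\widetilde{a}^2-x^2)^{\frac{1-s}{2}}}\right),\qquad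 |x|<\widetilde{a}.$$
   Context: $\mathcal{B}(\alpha,\beta)$ denotes the Euler Beta function, $\Gamma$ the Gamma function, and ${}_2F_1(\alpha,\beta;\gamma;z)$ the Gauss hypergeometric function. The paper also gives $I_a$ via an equivalent integral over $|t|>a$; only the integral over $u\in(0,\infty)$ is used here. *)

theory Defs
  imports "HOL-Probability.Probability"
begin

definition hyp2F1 :: "real \<Rightarrow> real \<Rightarrow> real \<Rightarrow> real \<Rightarrow> real" where
  "hyp2F1 a b c z =
     (\<Sum>n. pochhammer a n * pochhammer b n / (pochhammer c n * fact n) * z ^ n)"

definition extQ :: "real \<Rightarrow> real \<Rightarrow> real \<Rightarrow> real \<Rightarrow> real" where
  "extQ s q b x = - q * (x\<^sup>2 + b\<^sup>2) powr (- s / 2)"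

definition riesz_kernel :: "real \<Rightarrow> real \<Rightarrow> real \<Rightarrow> ennreal" where
  "riesz_kernel s x y = (if x = y then \<infinity> else ennreal (\<bar>x - y\<bar> powr (- s)))"

definition weighted_energy :: "real \<Rightarrow> (real \<Rightarrow> real) \<Rightarrow> real measure \<Rightarrow> ereal" where
  "weighted_energy s Q \<nu> =
     enn2ereal (\<integral>\<^sup>+ x. (\<integral>\<^sup>+ y. riesz_kernel s x y \<partial>\<nu>) \<partial>\<nu>)
     + ereal (2 * (\<integral> x. Q x \<partial>\<nu>))"

definition borel_prob :: "real measure \<Rightarrow> bool" where
  "borel_prob \<nu> \<longleftrightarrow> prob_space \<nu> \<and> sets \<nu> = sets borel"

definition is_equilibrium_measure :: "real \<Rightarrow> (real \<Rightarrow> real) \<Rightarrow> real measure \<Rightarrow> bool" where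
  "is_equilibrium_measure s Q \<mu> \<longleftrightarrow>
     borel_prob \<mu> \<and> (\<forall>\<nu>. borel_prob \<nu> \<longrightarrow> weighted_energy s Q \<mu> \<le> weighted_energy s Q \<nu>)"

definition measure_support :: "real measure \<Rightarrow> real set" where
  "measure_support \<mu> = {x. \<forall>e>0. emeasure \<mu> {x - e <..< x + e} > 0}"

definition I_int :: "real \<Rightarrow> real \<Rightarrow> real \<Rightarrow> real \<Rightarrow> real" where
  "I_int s b a x = (LINT u:{0<..}|lborel.
      u powr ((1 - s) / 2) / (u + a\<^sup>2 + b\<^sup>2) powr (1 - s / 2) / (u + a\<^sup>2 - x\<^sup>2))"

definition F_s :: "real \<Rightarrow> real \<Rightarrow> real \<Rightarrow> real \<Rightarrow> real" where
  "F_s s q b a =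
     Gamma (1 + s) / (2 powr s * Gamma ((1 + s) / 2)) * a powr (- s) *
     (Gamma ((1 - s) / 2)
      - q * (sqrt pi / Gamma (1 + s / 2)) * (a / sqrt (a\<^sup>2 + b\<^sup>2)) powr s
          * hyp2F1 (s / 2) ((1 + s) / 2) (1 + s / 2) (a\<^sup>2 / (a\<^sup>2 + b\<^sup>2)))"

definition eq_density :: "real \<Rightarrow> real \<Rightarrow> real \<Rightarrow> real \<Rightarrow> real \<Rightarrow> real" where
  "eq_density s q b a x =
     q * b powr (1 - s) / (Beta (1/2) ((1 - s) / 2) * Beta ((1 + s) / 2) ((1 - s) / 2)) *
     (Beta ((1 + s) / 2) ((1 - s) / 2) / (x\<^sup>2 + b\<^sup>2) powr (1 - s / 2)
      - (I_int s b a a - I_int s b a x) / (a\<^sup>2 - x\<^sup>2) powr ((1 - s) / 2))"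

end

theory Submission
  imports Defs
begin

text \<open>Proof idea. Let \<open>\<omega>\<^sub>t\<close> be the Riesz equilibrium measure of \<open>[-t, t]\<close>, with density proportional to
  \<open>(t\<^sup>2 - x\<^sup>2)\<close> to the power \<open>(s - 1) / 2\<close>. A Moebius involution of the interval shows that its potential is
  constant on \<open>[-t, t]\<close>, and by monotonicity it is no larger elsewhere. The field \<open>Q\<close> is minus the potential
  of the balayage of a point mass at \<open>bi\<close>, and an Abel integral writes that balayage as
  \<open>\<integral> m'(t) \<omega>\<^sub>t dt\<close> over \<open>t > 0\<close> with \<open>m'(t)\<close> proportional to \<open>t\<close> to the power \<open>1 + s\<close> over \<open>t\<^sup>2 + b\<^sup>2\<close> to the power
  \<open>3/2\<close>. Cutting the integral at \<open>t = a\<close> leaves a measure whose potential differs from \<open>-Q\<close> by the potential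
  of the tail, which is constant on \<open>[-a, a]\<close> and maximal there: these are the Frostman conditions. The mass
  \<open>m(a)\<close> is \<open>1\<close> exactly when \<open>F_s' (a) = 0\<close>, and Fubini turns the tail density into the difference
  \<open>I_a(a) - I_a(x)\<close>. Uniqueness of the minimizer follows from strict positive definiteness of the Riesz kernel,
  which is visible once the kernel is sliced into products of indicators of intervals.\<close>

section \<open>Change of variables and Beta integrals\<close>

text \<open>The measure \<mu> is given as a minimizer, so minimality is applied once, against the
  explicit candidate. Nothing is known beforehand about the energy of \<mu>, and potentials may be
  infinite on the way; hence almost all integrals live in \<open>ennreal\<close>, where Tonelli asks
  for no integrability. Subtraction is unsafe there, so the comparison of potentials is stated as a
  sum: potential of the candidate plus potential of the tail equals minus the field.

  The constant \<open>rate_const\<close> gives the untruncated mixture total mass \<open>q\<close>.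
  This is where \<open>q > 1\<close> enters: the mass inside radius \<open>a\<close> grows
  continuously and strictly from 0 towards \<open>q\<close> and meets 1 exactly once. The link with
  \<open>F_s\<close> is the product rule: apart from a nonzero factor, the derivative of
  \<open>a powr (-s) * (G - k * g a)\<close> is \<open>G - k * (g a - a * g' a / s)\<close>, and the
  last bracket is a primitive of a multiple of the mass rate. The power \<open>3/2\<close> is the
  sum of \<open>(1+s)/2\<close>, the exponent of the Abel kernel, and \<open>1-s/2\<close>, the
  decay exponent of the balayage density.\<close>

lemma nn_integral_lborel_eq_ennreal_iff:
  fixes f :: "real \<Rightarrow> real"
  assumes [measurable]: "f \<in> borel_measurable borel" and "\<And>x. 0 \<le> f x" "0 \<le> r"
  shows "(\<integral>\<^sup>+x. ennreal (f x) \<partial>lborel) = ennreal r \<longleftrightarrow> (f has_integral r) UNIV"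
  using nn_integral_has_integral[of f r] nn_integral_has_integral_lborel[of f r] assms by auto

text \<open>For nonnegative \<open>f\<close>, substitution for absolutely integrable functions says
  that one side has integral \<open>r\<close> iff the other does, which settles finite values.
  Finiteness of either side supplies such an \<open>r\<close>, so both sides are also infinite
  together. The absolute value of \<open>g'\<close> covers decreasing maps as well.\<close>

lemma nn_integral_change_of_variables:
  fixes f g g' :: "real \<Rightarrow> real"
  assumes [measurable]: "S \<in> sets borel" "T \<in> sets borel" and img: "g ` S = T"
    and der: "\<And>x. x \<in> S \<Longrightarrow> (g has_field_derivative g' x) (at x within S)"
    and inj: "inj_on g S"
    and [measurable]: "f \<in> borel_measurable borel" "g \<in> borel_measurable borel" "g' \<in> borel_measurable borel"
    and nonneg: "\<And>x. x \<in> T \<Longrightarrow> 0 \<le> f x"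
  shows "(\<integral>\<^sup>+x\<in>T. ennreal (f x) \<partial>lborel) = (\<integral>\<^sup>+x\<in>S. ennreal (\<bar>g' x\<bar> * f (g x)) \<partial>lborel)"
proof -
  define A where "A = (\<integral>\<^sup>+x. ennreal (indicator T x * f x) \<partial>lborel)"
  define B where "B = (\<integral>\<^sup>+x. ennreal (indicator S x * (\<bar>g' x\<bar> * f (g x))) \<partial>lborel)"
  have nn: "0 \<le> f (g x)" if "x \<in> S" for x using that img nonneg by auto
  have A: "A = ennreal r \<longleftrightarrow> (f has_integral r) T" if "0 \<le> r" for r
  proof -
    have "A = ennreal r \<longleftrightarrow> ((\<lambda>x. indicator T x * f x) has_integral r) UNIV"
      unfolding A_def using that nonneg
      by (intro nn_integral_lborel_eq_ennreal_iff) (auto simp: indicator_def)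
    also have "\<dots> \<longleftrightarrow> (f has_integral r) T"
      by (subst has_integral_restrict_UNIV[symmetric])
         (intro arg_cong[where f="\<lambda>h. (h has_integral r) UNIV"], auto simp: fun_eq_iff indicator_def)
    finally show ?thesis .
  qed
  have B: "B = ennreal r \<longleftrightarrow> ((\<lambda>x. \<bar>g' x\<bar> * f (g x)) has_integral r) S" if "0 \<le> r" for r
  proof -
    have "B = ennreal r \<longleftrightarrow> ((\<lambda>x. indicator S x * (\<bar>g' x\<bar> * f (g x))) has_integral r) UNIV"
      unfolding B_def using that nn
      by (intro nn_integral_lborel_eq_ennreal_iff) (auto simp: indicator_def)
    also have "\<dots> \<longleftrightarrow> ((\<lambda>x. \<bar>g' x\<bar> * f (g x)) has_integral r) S"
      by (subst has_integral_restrict_UNIV[symmetric])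
         (intro arg_cong[where f="\<lambda>h. (h has_integral r) UNIV"], auto simp: fun_eq_iff indicator_def)
    finally show ?thesis .
  qed
  have iff: "(f has_integral r) T \<longleftrightarrow> ((\<lambda>x. \<bar>g' x\<bar> * f (g x)) has_integral r) S" for r
  proof -
    have "f absolutely_integrable_on T \<longleftrightarrow> f integrable_on T"
      by (rule absolutely_integrable_on_iff_nonneg) (use nonneg in auto)
    moreover have "(\<lambda>x. \<bar>g' x\<bar> * f (g x)) absolutely_integrable_on S \<longleftrightarrow> (\<lambda>x. \<bar>g' x\<bar> * f (g x)) integrable_on S"
      by (rule absolutely_integrable_on_iff_nonneg) (use nn in auto)
    ultimately show ?thesis
      using has_absolute_integral_change_of_variables_1'[of S g g' f r] der inj img
      by (auto simp: has_integral_iff)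
  qed
  have "A = B"
  proof (cases "A = \<infinity>")
    case False
    then obtain r where "0 \<le> r" "A = ennreal r" by (cases A) auto
    then show ?thesis using A B iff by metis
  next
    case True
    show ?thesis
    proof (cases "B = \<infinity>")
      case False
      then obtain r where "0 \<le> r" "B = ennreal r" by (cases B) auto
      then show ?thesis using A B iff by metis
    qed (use True in simp)
  qed
  moreover have "A = (\<integral>\<^sup>+x\<in>T. ennreal (f x) \<partial>lborel)"
    unfolding A_def by (intro nn_integral_cong) (auto simp: indicator_def)
  moreover have "B = (\<integral>\<^sup>+x\<in>S. ennreal (\<bar>g' x\<bar> * f (g x)) \<partial>lborel)"
    unfolding B_def by (intro nn_integral_cong) (auto simp: indicator_def)
  ultimately show ?thesis by simp
qed

lemma power2_powr_half: "(t\<^sup>2) powr (c / 2) = \<bar>t\<bar> powr c" for t c :: real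
proof (cases "t = 0")
  case False
  then have "t\<^sup>2 = \<bar>t\<bar> powr 2" by simp
  then show ?thesis by (simp only: powr_powr) simp
qed simp

text \<open>A projective map of the unit interval fixing both endpoints pulls Euler's integrand back
  to the weighted one, because the denominator collects the exponent
  \<open>2 + (p-1) + (q-1) = p+q\<close>. With the weights \<open>A\<close> and \<open>C\<close>
  kept free, the later Beta evaluations on (0,1) and on the half-line are specializations.\<close>

lemma nn_integral_Beta_homography:
  fixes p q A C :: real
  assumes "p > 0" "q > 0" "A > 0" "C > 0"
  shows "(\<integral>\<^sup>+r\<in>{0<..<1}. ennreal (r powr (p-1) * (1-r) powr (q-1) * (A * (1-r) + C * r) powr (-(p+q))) \<partial>lborel)
         = ennreal (A powr (-q) * C powr (-p) * Beta p q)"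
proof -
  have pos: "A * (1-r) + C * r > 0" if "r \<in> {0<..<1}" for r
    using that assms by (intro add_pos_pos mult_pos_pos) auto
  define g where "g r = C * r / (A * (1-r) + C * r)" for r
  define g' where "g' r = A * C / (A * (1-r) + C * r)^2" for r
  have inj: "inj_on g {0<..<1}"
  proof (rule inj_onI)
    fix x y assume "x \<in> {0<..<1}" "y \<in> {0<..<1}" "g x = g y"
    then have "C * x * (A * (1-y) + C * y) = C * y * (A * (1-x) + C * x)"
      using pos[of x] pos[of y] by (simp add: g_def field_simps)
    then have "A * C * (x - y) = 0" by (simp add: algebra_simps)
    then show "x = y" using assms by simp
  qed
  have img: "g ` {0<..<1} = {0<..<1}"
  proof (intro set_eqI iffI)
    fix y assume "y \<in> g ` {0<..<1}"
    then obtain r where r: "r \<in> {0<..<1}" "y = g r" by auto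
    have "A * (1-r) > 0" "C * r > 0" using r assms by auto
    then show "y \<in> {0<..<1}" unfolding r g_def by (auto simp: field_simps)
  next
    fix y :: real assume y: "y \<in> {0<..<1}"
    \<comment> \<open>The inverse of a projective map of this kind arises by exchanging the weights
      \<open>A\<close> and \<open>C\<close>.\<close>
    define r where "r = A * y / (C * (1-y) + A * y)"
    have p1: "C * (1-y) > 0" "A * y > 0" using y assms by auto
    then have r: "r \<in> {0<..<1}" unfolding r_def by (auto simp: field_simps)
    have e: "1 - r = C * (1-y) / (C * (1-y) + A * y)" using p1 unfolding r_def by (simp add: field_simps)
    have "A * (1-r) + C * r = A * C / (C * (1-y) + A * y)"
      unfolding e unfolding r_def using p1 by (simp add: divide_simps) (simp add: algebra_simps)
    moreover have "C * r = A * C * y / (C * (1-y) + A * y)" unfolding r_def by simp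
    ultimately have "g r = y" unfolding g_def using p1 assms by simp
    then show "y \<in> g ` {0<..<1}" using r by auto
  qed
  have "ennreal (Beta p q) = (\<integral>\<^sup>+r\<in>{0<..<1}. ennreal (r powr (p-1) * (1-r) powr (q-1)) \<partial>lborel)"
  proof -
    have "((\<lambda>t. t powr (p-1) * (1-t) powr (q-1)) has_integral Beta p q) {0<..<1}"
      using has_integral_Beta_real[of p q] assms by (simp add: has_integral_Icc_iff_Ioo)
    from nn_integral_has_integral_lebesgue[OF _ this]
    have "ennreal (Beta p q) = (\<integral>\<^sup>+t. ennreal (indicator {0<..<1} t * (t powr (p-1) * (1-t) powr (q-1))) \<partial>lborel)"
      by simp
    also have "\<dots> = (\<integral>\<^sup>+r\<in>{0<..<1}. ennreal (r powr (p-1) * (1-r) powr (q-1)) \<partial>lborel)"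
      by (intro nn_integral_cong) (auto simp: indicator_def)
    finally show ?thesis .
  qed
  also have "\<dots> = (\<integral>\<^sup>+r\<in>{0<..<1}. ennreal (\<bar>g' r\<bar> * (g r powr (p-1) * (1-g r) powr (q-1))) \<partial>lborel)"
  proof (rule nn_integral_change_of_variables[OF _ _ img _ inj])
    fix r :: real assume "r \<in> {0<..<1}"
    from pos[OF this] show "(g has_field_derivative g' r) (at r within {0<..<1})"
      unfolding g_def[abs_def] g'_def
      by (auto intro!: derivative_eq_intros simp: power2_eq_square) (simp add: field_simps)
  qed (auto simp: g_def[abs_def] g'_def[abs_def])
  also have "\<dots> = (\<integral>\<^sup>+r. ennreal (A powr q * C powr p) * (ennreal (r powr (p-1) * (1-r) powr (q-1) * (A * (1-r) + C * r) powr (-(p+q))) * indicator {0<..<1} r) \<partial>lborel)"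
  proof (intro nn_integral_cong)
    fix r :: real
    show "ennreal (\<bar>g' r\<bar> * (g r powr (p-1) * (1-g r) powr (q-1))) * indicator {0<..<1} r =
       ennreal (A powr q * C powr p) * (ennreal (r powr (p-1) * (1-r) powr (q-1) * (A * (1-r) + C * r) powr (-(p+q))) * indicator {0<..<1} r)"
    proof (cases "r \<in> {0<..<1}")
      case True
      define M where "M = A * (1-r) + C * r"
      have M: "M > 0" using pos[OF True] by (simp add: M_def)
      have g: "g r = C * r / M" "1 - g r = A * (1-r) / M" "g' r = A * C / M^2"
        using M unfolding g_def g'_def M_def by (auto simp: field_simps)
      have "\<bar>g' r\<bar> * (g r powr (p-1) * (1-g r) powr (q-1)) =
         A * C / M^2 * ((C powr (p-1) * r powr (p-1) / M powr (p-1)) * (A powr (q-1) * (1-r) powr (q-1) / M powr (q-1)))"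
        unfolding g(2,3) unfolding g(1) using True M assms by (simp add: powr_divide powr_mult)
      also have "\<dots> = (A * A powr (q-1)) * (C * C powr (p-1)) * (r powr (p-1) * (1-r) powr (q-1)) / (M^2 * M powr (p-1) * M powr (q-1))"
        by (simp add: field_simps)
      also have "A * A powr (q-1) = A powr q" using assms by (simp add: powr_mult_base)
      also have "C * C powr (p-1) = C powr p" using assms by (simp add: powr_mult_base)
      also have "M^2 * M powr (p-1) * M powr (q-1) = M powr (p+q)"
        using M by (simp flip: powr_numeral powr_add)
      finally have "\<bar>g' r\<bar> * (g r powr (p-1) * (1-g r) powr (q-1)) =
          A powr q * C powr p * (r powr (p-1) * (1-r) powr (q-1) * M powr (-(p+q)))"
        unfolding powr_minus[of M "p+q"] by (simp only: divide_inverse mult.assoc)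
      then show ?thesis using True by (simp add: M_def flip: ennreal_mult)
    qed simp
  qed
  also have "\<dots> = ennreal (A powr q * C powr p) * (\<integral>\<^sup>+r\<in>{0<..<1}. ennreal (r powr (p-1) * (1-r) powr (q-1) * (A * (1-r) + C * r) powr (-(p+q))) \<partial>lborel)"
    by (rule nn_integral_cmult) auto
  finally have eq: "ennreal (Beta p q) = ennreal (A powr q * C powr p) * (\<integral>\<^sup>+r\<in>{0<..<1}. ennreal (r powr (p-1) * (1-r) powr (q-1) * (A * (1-r) + C * r) powr (-(p+q))) \<partial>lborel)" (is "_ = _ * ?X") .
  have "ennreal (A powr (-q) * C powr (-p) * Beta p q) = ennreal (A powr (-q) * C powr (-p)) * ennreal (Beta p q)"
    by (simp add: ennreal_mult')
  also have "\<dots> = ennreal (A powr (-q) * C powr (-p) * (A powr q * C powr p)) * ?X"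
    unfolding eq by (simp add: ennreal_mult' mult.assoc)
  also have "A powr (-q) * C powr (-p) * (A powr q * C powr p) = 1"
    using assms by (simp add: powr_minus field_simps)
  finally show ?thesis by simp
qed

lemma nn_integral_Beta_halfline:
  fixes p q A C :: real
  assumes "p > 0" "q > 0" "A > 0" "C > 0"
  shows "(\<integral>\<^sup>+v\<in>{0<..}. ennreal (v powr (p-1) * (A + C * v) powr (-(p+q))) \<partial>lborel)
         = ennreal (A powr (-q) * C powr (-p) * Beta p q)"
proof -
  define g where "g r = r / (1-r)" for r :: real
  define g' where "g' r = 1 / (1-r)^2" for r :: real
  have img: "g ` {0<..<1} = {0<..}"
  proof (intro set_eqI iffI)
    fix v :: real assume v: "v \<in> {0<..}"
    then have "g (v / (1+v)) = v" "v / (1+v) \<in> {0<..<1}" by (auto simp: g_def field_simps)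
    then show "v \<in> g ` {0<..<1}" by (metis imageI)
  qed (auto simp: g_def)
  have "(\<integral>\<^sup>+v\<in>{0<..}. ennreal (v powr (p-1) * (A + C * v) powr (-(p+q))) \<partial>lborel)
    = (\<integral>\<^sup>+r\<in>{0<..<1}. ennreal (\<bar>g' r\<bar> * (g r powr (p-1) * (A + C * g r) powr (-(p+q)))) \<partial>lborel)"
  proof (rule nn_integral_change_of_variables[OF _ _ img])
    fix r :: real assume "r \<in> {0<..<1}"
    then show "(g has_field_derivative g' r) (at r within {0<..<1})"
      unfolding g_def[abs_def] g'_def
      by (auto intro!: derivative_eq_intros simp: power2_eq_square)
  next
    show "inj_on g {0<..<1}" by (rule inj_onI) (auto simp: g_def field_simps)
  qed (auto simp: g_def[abs_def] g'_def[abs_def])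
  also have "\<dots> = (\<integral>\<^sup>+r\<in>{0<..<1}. ennreal (r powr (p-1) * (1-r) powr (q-1) * (A * (1-r) + C * r) powr (-(p+q))) \<partial>lborel)"
  proof (intro nn_integral_cong)
    fix r :: real
    show "ennreal (\<bar>g' r\<bar> * (g r powr (p-1) * (A + C * g r) powr (-(p+q)))) * indicator {0<..<1} r =
       ennreal (r powr (p-1) * (1-r) powr (q-1) * (A * (1-r) + C * r) powr (-(p+q))) * indicator {0<..<1} r"
    proof (cases "r \<in> {0<..<1}")
      case True
      have pos: "A * (1-r) + C * r > 0" using True assms by (intro add_pos_pos mult_pos_pos) auto
      have "A + C * g r = (A * (1-r) + C * r) / (1-r)" using True by (simp add: g_def field_simps)
      then have "\<bar>g' r\<bar> * (g r powr (p-1) * (A + C * g r) powr (-(p+q))) =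
        r powr (p-1) * (A * (1-r) + C * r) powr (-(p+q)) / ((1-r)^2 * (1-r) powr (p-1) * (1-r) powr (-(p+q)))"
        using True pos by (simp add: g_def g'_def powr_divide)
      also have "(1-r)^2 * (1-r) powr (p-1) * (1-r) powr (-(p+q)) = (1-r) powr (-(q-1))"
        using True by (simp flip: powr_numeral powr_add)
      finally show ?thesis using True unfolding powr_minus[of "1-r" "q-1"] by (simp add: field_simps)
    qed simp
  qed
  finally show ?thesis using nn_integral_Beta_homography[OF assms] by simp
qed

lemma nn_integral_square_halfline:
  fixes f :: "real \<Rightarrow> real"
  assumes [measurable]: "f \<in> borel_measurable borel" and "\<And>v. 0 < v \<Longrightarrow> 0 \<le> f v"
  shows "(\<integral>\<^sup>+t\<in>{0<..}. ennreal (2 * t * f (t^2)) \<partial>lborel) = (\<integral>\<^sup>+v\<in>{0<..}. ennreal (f v) \<partial>lborel)"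
proof -
  have img: "(\<lambda>t::real. t^2) ` {0<..} = {0<..}"
  proof (intro set_eqI iffI)
    fix v :: real assume "v \<in> {0<..}"
    then have "v = (sqrt v)^2" "sqrt v \<in> {0<..}" by auto
    then show "v \<in> (\<lambda>t::real. t^2) ` {0<..}" by (metis imageI)
  qed auto
  have "(\<integral>\<^sup>+v\<in>{0<..}. ennreal (f v) \<partial>lborel) = (\<integral>\<^sup>+t\<in>{0<..}. ennreal (\<bar>2 * t\<bar> * f (t^2)) \<partial>lborel)"
  proof (rule nn_integral_change_of_variables[OF _ _ img])
    show "inj_on (\<lambda>t::real. t^2) {0<..}" by (rule inj_onI) (auto simp: power2_eq_iff)
  qed (use assms in \<open>auto intro!: derivative_eq_intros\<close>)
  also have "\<dots> = (\<integral>\<^sup>+t\<in>{0<..}. ennreal (2 * t * f (t^2)) \<partial>lborel)"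
    by (intro nn_integral_cong) (auto simp: indicator_def)
  finally show ?thesis by simp
qed

lemma nn_integral_even:
  fixes f :: "real \<Rightarrow> ennreal"
  assumes [measurable]: "f \<in> borel_measurable borel" and "\<And>x. f (-x) = f x"
  shows "(\<integral>\<^sup>+x. f x \<partial>lborel) = 2 * (\<integral>\<^sup>+x\<in>{0<..}. f x \<partial>lborel)"
proof -
  have "(\<integral>\<^sup>+x. f x \<partial>lborel) = (\<integral>\<^sup>+x. f x * indicator {0<..} x + f x * indicator {..<0} x \<partial>lborel)"
    by (rule nn_integral_cong_AE, rule AE_mp[OF AE_lborel_singleton[of 0]]) (auto simp: indicator_def)
  also have "\<dots> = (\<integral>\<^sup>+x\<in>{0<..}. f x \<partial>lborel) + (\<integral>\<^sup>+x\<in>{..<0}. f x \<partial>lborel)"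
    by (rule nn_integral_add) auto
  also have "(\<integral>\<^sup>+x\<in>{..<0}. f x \<partial>lborel) = (\<integral>\<^sup>+x\<in>{0<..}. f x \<partial>lborel)"
    by (subst nn_integral_real_affine[of _ "-1" 0])
       (auto simp: assms indicator_def intro!: nn_integral_cong)
  finally show ?thesis by (simp add: mult_2)
qed

lemma nn_integral_square_real:
  fixes f :: "real \<Rightarrow> real"
  assumes [measurable]: "f \<in> borel_measurable borel" and nn: "\<And>v. 0 < v \<Longrightarrow> 0 \<le> f v"
  shows "(\<integral>\<^sup>+x. ennreal (f (x^2)) \<partial>lborel) = (\<integral>\<^sup>+v\<in>{0<..}. ennreal (v powr (-1/2) * f v) \<partial>lborel)"
proof -
  have "(\<integral>\<^sup>+x. ennreal (f (x^2)) \<partial>lborel) = (\<integral>\<^sup>+x. 2 * (ennreal (f (x^2)) * indicator {0<..} x) \<partial>lborel)"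
    by (subst nn_integral_even) (auto simp: nn_integral_cmult)
  also have "\<dots> = (\<integral>\<^sup>+t\<in>{0<..}. ennreal (2 * t * ((t^2) powr (-1/2) * f (t^2))) \<partial>lborel)"
  proof (intro nn_integral_cong)
    fix t :: real
    have "t * (t^2) powr (-1/2) = 1" if "t > 0"
    proof -
      have "(t^2) powr (-1/2) = t powr (-1)"
        using that by (simp only: power2_powr_half abs_of_pos abs_numeral)
      then show ?thesis using that by (simp add: powr_minus)
    qed
    then have "2 * t * ((t^2) powr (-1/2) * f (t^2)) = 2 * f (t^2)" if "t > 0"
      using that by (metis (no_types, opaque_lifting) mult.assoc mult.right_neutral)
    moreover have "ennreal (2 * f (t^2)) = 2 * ennreal (f (t^2))"
      by (simp add: ennreal_mult')
    ultimately have "0 < t \<Longrightarrow> ennreal (2 * t * ((t^2) powr (-1/2) * f (t^2))) = 2 * ennreal (f (t^2))"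
      by (simp only:)
    then show "2 * (ennreal (f (t^2)) * indicator {0<..} t) =
        ennreal (2 * t * ((t^2) powr (-1/2) * f (t^2))) * indicator {0<..} t"
      unfolding indicator_def by simp
  qed
  also have "\<dots> = (\<integral>\<^sup>+v\<in>{0<..}. ennreal (v powr (-1/2) * f v) \<partial>lborel)"
    by (rule nn_integral_square_halfline) (auto simp: nn)
  finally show ?thesis .
qed

lemma nn_integral_inversion:
  fixes f :: "real \<Rightarrow> real"
  assumes [measurable]: "f \<in> borel_measurable borel" and nn: "\<And>v. 0 \<le> f v"
  shows "(\<integral>\<^sup>+w. ennreal (f w) \<partial>lborel) = (\<integral>\<^sup>+v. ennreal (f (1/v) / v^2) \<partial>lborel)"
proof -
  have img: "(\<lambda>v::real. 1/v) ` (-{0}) = -{0}"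
  proof (intro set_eqI iffI)
    fix v :: real assume "v \<in> -{0}"
    then have "v = 1/(1/v)" "1/v \<in> -{0}" by auto
    then show "v \<in> (\<lambda>v::real. 1/v) ` (-{0})" by (metis imageI)
  qed auto
  have "(\<integral>\<^sup>+w. ennreal (f w) \<partial>lborel) = (\<integral>\<^sup>+w\<in>-{0}. ennreal (f w) \<partial>lborel)"
    by (rule nn_integral_cong_AE, rule AE_mp[OF AE_lborel_singleton[of 0]]) (auto simp: indicator_def)
  also have "\<dots> = (\<integral>\<^sup>+v\<in>-{0}. ennreal (\<bar>- 1 / v^2\<bar> * f (1/v)) \<partial>lborel)"
  proof (rule nn_integral_change_of_variables[OF _ _ img])
    show "inj_on (\<lambda>v::real. 1/v) (-{0})" by (rule inj_onI) auto
  qed (use assms in \<open>auto intro!: derivative_eq_intros simp: power2_eq_square\<close>)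
  also have "\<dots> = (\<integral>\<^sup>+v. ennreal (f (1/v) / v^2) \<partial>lborel)"
    by (rule nn_integral_cong_AE, rule AE_mp[OF AE_lborel_singleton[of 0]]) (auto simp: indicator_def)
  finally show ?thesis .
qed

section \<open>Potentials of the interval equilibrium measures\<close>

text \<open>The involution \<open>g\<close> exchanges 0 and \<open>x\<close>, so it moves the
  singularity of the kernel to 0. There only the factor \<open>1 / (1 - x * z)\<close> is not even
  in \<open>z\<close>; symmetrizing it and putting \<open>v = z^2\<close> gives a weighted Beta
  integral. Its power of \<open>k = 1 - x^2\<close> cancels the one produced by the substitution,
  which is why the value does not depend on \<open>x\<close>.\<close>

lemma nn_integral_unit_potential:
  fixes s x :: real
  assumes s: "0 < s" "s < 1" and x: "\<bar>x\<bar> < 1"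
  shows "(\<integral>\<^sup>+y\<in>{-1<..<1}. ennreal (\<bar>x - y\<bar> powr (-s) * (1 - y^2) powr ((s-1)/2)) \<partial>lborel)
     = ennreal (Beta ((1-s)/2) ((1+s)/2))"
proof -
  define k where "k = 1 - x^2"
  have k: "k > 0" using x unfolding k_def by (simp add: abs_square_less_1)
  have D: "1 - x * z > 0" if "z \<in> {-1<..<1}" for z
  proof -
    have "\<bar>x * z\<bar> < 1" using abs_mult_less[OF x, of z 1] that by (auto simp: abs_mult)
    then show ?thesis by (simp add: abs_less_iff)
  qed
  define g where "g z = (x - z) / (1 - x * z)" for z
  define g' where "g' z = - k / (1 - x * z)^2" for z
  have m: "1 - z^2 > 0" if "z \<in> {-1<..<1}" for z :: real
    using that by (simp add: abs_square_less_1 abs_less_iff)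
  have g2: "1 - (g z)^2 = k * (1 - z^2) / (1 - x * z)^2" if "z \<in> {-1<..<1}" for z
    using D[OF that] unfolding g_def k_def
    by (simp add: divide_simps power_divide) (simp add: power2_eq_square algebra_simps)
  have g_in: "g z \<in> {-1<..<1}" if "z \<in> {-1<..<1}" for z
  proof -
    have "1 - (g z)^2 > 0" unfolding g2[OF that] using D[OF that] k m[OF that] by simp
    then have "\<bar>g z\<bar> < 1" by (simp add: abs_square_less_1)
    then show ?thesis by (auto simp: abs_less_iff)
  qed
  have x_g: "x - g z = z * k / (1 - x * z)" if "z \<in> {-1<..<1}" for z
    using D[OF that] unfolding g_def k_def
    by (simp add: divide_simps) (simp add: power2_eq_square algebra_simps)
  have gg: "g (g z) = z" if "z \<in> {-1<..<1}" for z
  proof -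
    have "1 - x * g z = k / (1 - x * z)"
      using D[OF that] unfolding g_def k_def
      by (simp add: divide_simps) (simp add: power2_eq_square algebra_simps)
    then show ?thesis unfolding g_def[of "g z"] x_g[OF that] using D[OF that] k by simp
  qed
  have img: "g ` {-1<..<1} = {-1<..<1}"
    using g_in gg by (auto simp: image_iff) (metis g_in gg greaterThanLessThan_iff)
  have inj: "inj_on g {-1<..<1}"
    by (rule inj_on_inverseI[of _ g]) (rule gg)
  \<comment> \<open>\<open>H\<close> is the integrand after the substitution, without its power of
    \<open>k\<close>, and \<open>h (z^2)\<close> is the even part of \<open>H\<close>, by
    \<open>1/(1-x*z) + 1/(1+x*z) = 2/(1-x^2*z^2)\<close>.\<close>
  define H where "H z = (if \<bar>z\<bar> < 1 then \<bar>z\<bar> powr (-s) * (1 - z^2) powr ((s-1)/2) / (1 - x * z) else 0)" for z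
  define h where "h v = (if v < 1 then v powr (-s/2) * (1 - v) powr ((s-1)/2) / (1 - x^2 * v) else 0)" for v
  have [measurable]: "H \<in> borel_measurable borel" "h \<in> borel_measurable borel"
    unfolding H_def h_def by measurable
  have "(\<integral>\<^sup>+y\<in>{-1<..<1}. ennreal (\<bar>x - y\<bar> powr (-s) * (1 - y^2) powr ((s-1)/2)) \<partial>lborel) =
     (\<integral>\<^sup>+z\<in>{-1<..<1}. ennreal (\<bar>g' z\<bar> * (\<bar>x - g z\<bar> powr (-s) * (1 - (g z)^2) powr ((s-1)/2))) \<partial>lborel)"
  proof (rule nn_integral_change_of_variables[OF _ _ img _ inj])
    fix z :: real assume "z \<in> {-1<..<1}"
    from D[OF this] show "(g has_field_derivative g' z) (at z within {-1<..<1})"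
      unfolding g_def[abs_def] g'_def k_def
      by (auto intro!: derivative_eq_intros simp: divide_simps) (simp add: power2_eq_square algebra_simps)
  qed (auto simp: g_def[abs_def] g'_def[abs_def])
  also have "\<dots> = (\<integral>\<^sup>+z. ennreal (k powr ((1-s)/2)) * ennreal (H z) \<partial>lborel)"
  proof (intro nn_integral_cong)
    fix z :: real
    show "ennreal (\<bar>g' z\<bar> * (\<bar>x - g z\<bar> powr (-s) * (1 - (g z)^2) powr ((s-1)/2))) * indicator {-1<..<1} z
       = ennreal (k powr ((1-s)/2)) * ennreal (H z)"
    proof (cases "z \<in> {-1<..<1}")
      case True
      define d where "d = 1 - x * z"
      have d: "d > 0" using D[OF True] by (simp add: d_def)
      have d2: "(d^2) powr ((s-1)/2) = d powr (s-1)"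
        using d by (simp only: power2_powr_half abs_of_pos abs_numeral)
      have "\<bar>g' z\<bar> * (\<bar>x - g z\<bar> powr (-s) * (1 - (g z)^2) powr ((s-1)/2)) =
        k / d^2 * ((\<bar>z\<bar> powr (-s) * k powr (-s) / d powr (-s)) * (k powr ((s-1)/2) * (1-z^2) powr ((s-1)/2) / d powr (s-1)))"
        unfolding g2[OF True] x_g[OF True] g'_def d_def[symmetric]
        using d k m[OF True] by (simp add: abs_mult powr_mult powr_divide d2)
      also have "\<dots> = (k * k powr (-s) * k powr ((s-1)/2)) * (\<bar>z\<bar> powr (-s) * (1-z^2) powr ((s-1)/2)) / (d^2 * d powr (-s) * d powr (s-1))"
        by (simp add: mult_ac)
      also have "k * k powr (-s) * k powr ((s-1)/2) = k powr ((1-s)/2)"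
      proof -
        have "k * k powr (-s) * k powr ((s-1)/2) = k powr (1 + (-s) + (s-1)/2)"
          using k by (simp only: powr_add powr_one)
        also have "1 + (-s) + (s-1)/2 = (1-s)/2" by (simp add: field_simps)
        finally show ?thesis .
      qed
      also have "d^2 * d powr (-s) * d powr (s-1) = d"
        using d by (simp flip: powr_numeral powr_add)
      finally show ?thesis using True
        by (simp add: H_def d_def abs_less_iff flip: ennreal_mult')
    next
      case False
      then have "H z = 0" by (auto simp: H_def)
      then show ?thesis using False by simp
    qed
  qed
  also have "\<dots> = ennreal (k powr ((1-s)/2)) * (\<integral>\<^sup>+z. ennreal (H z) \<partial>lborel)"
    by (rule nn_integral_cmult) auto
  also have "(\<integral>\<^sup>+z. ennreal (H z) \<partial>lborel) = (\<integral>\<^sup>+z. ennreal (h (z^2)) \<partial>lborel)"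
  proof -
    have "(\<integral>\<^sup>+z. ennreal (H z) \<partial>lborel) = (\<integral>\<^sup>+z. ennreal (H (-z)) \<partial>lborel)"
      by (subst nn_integral_real_affine[of _ "-1" 0]) auto
    then have "2 * (\<integral>\<^sup>+z. ennreal (H z) \<partial>lborel) = (\<integral>\<^sup>+z. ennreal (H z) \<partial>lborel) + (\<integral>\<^sup>+z. ennreal (H (-z)) \<partial>lborel)"
      by (simp add: mult_2)
    also have "\<dots> = (\<integral>\<^sup>+z. ennreal (H z) + ennreal (H (-z)) \<partial>lborel)"
      by (rule nn_integral_add[symmetric]) auto
    also have "\<dots> = (\<integral>\<^sup>+z. 2 * ennreal (h (z^2)) \<partial>lborel)"
    proof (intro nn_integral_cong)
      fix z :: real
      show "ennreal (H z) + ennreal (H (-z)) = 2 * ennreal (h (z^2))"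
      proof (cases "\<bar>z\<bar> < 1")
        case True
        then have z: "z \<in> {-1<..<1}" "-z \<in> {-1<..<1}" by auto
        have z2: "z^2 < 1" using m[OF z(1)] by simp
        have ss: "\<bar>z\<bar> powr (-s) = (z^2) powr (-s/2)" by (simp only: power2_powr_half)
        define N where "N = \<bar>z\<bar> powr (-s) * (1-z^2) powr ((s-1)/2)"
        have N: "N \<ge> 0" by (simp add: N_def)
        have DD: "1 - x * z > 0" "1 + x * z > 0" using D[OF z(1)] D[OF z(2)] by auto
        have HH: "H z = N / (1 - x * z)" "H (-z) = N / (1 + x * z)"
          using True by (simp_all add: H_def N_def)
        have "ennreal (H z) + ennreal (H (-z)) = ennreal (H z + H (-z))"
          unfolding HH using N DD by simp
        also have "H z + H (-z) = 2 * (N / ((1 - x * z) * (1 + x * z)))"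
          unfolding HH using DD by (simp add: divide_simps) (simp add: algebra_simps)
        also have "(1 - x * z) * (1 + x * z) = 1 - x^2 * z^2" by (simp add: power2_eq_square algebra_simps)
        also have "N / (1 - x^2 * z^2) = h (z^2)" using z2 by (simp add: h_def N_def ss)
        also have "ennreal (2 * h (z^2)) = 2 * ennreal (h (z^2))" by (simp add: ennreal_mult')
        finally show ?thesis .
      next
        case False
        then have "\<not> z^2 < 1" by (simp add: abs_square_less_1)
        with False show ?thesis by (simp add: H_def h_def)
      qed
    qed
    also have "\<dots> = 2 * (\<integral>\<^sup>+z. ennreal (h (z^2)) \<partial>lborel)" by (rule nn_integral_cmult) auto
    finally show ?thesis by (simp add: ennreal_mult_cancel_left)
  qed
  also have "(\<integral>\<^sup>+z. ennreal (h (z^2)) \<partial>lborel) = (\<integral>\<^sup>+v\<in>{0<..}. ennreal (v powr (-1/2) * h v) \<partial>lborel)"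
  proof (rule nn_integral_square_real)
    fix v :: real assume v: "0 < v"
    show "0 \<le> h v"
    proof (cases "v < 1")
      case True
      have "x^2 * v \<le> 1 * 1" using v True k by (intro mult_mono) (auto simp: k_def)
      then show ?thesis by (simp add: h_def)
    qed (simp add: h_def)
  qed simp
  \<comment> \<open>Since \<open>1 - x^2 * v = 1 * (1-v) + k * v\<close>, the weights are 1 and
    \<open>k\<close>; the exponents \<open>(1-s)/2\<close> and \<open>(1+s)/2\<close> add up to
    1.\<close>
  also have "\<dots> = (\<integral>\<^sup>+r\<in>{0<..<1}. ennreal (r powr ((1-s)/2-1) * (1-r) powr ((1+s)/2-1) * (1 * (1-r) + k * r) powr (-((1-s)/2 + (1+s)/2))) \<partial>lborel)"
  proof (intro nn_integral_cong)
    fix v :: real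
    show "ennreal (v powr (-1/2) * h v) * indicator {0<..} v =
      ennreal (v powr ((1-s)/2-1) * (1-v) powr ((1+s)/2-1) * (1 * (1-v) + k * v) powr (-((1-s)/2 + (1+s)/2))) * indicator {0<..<1} v"
    proof (cases "v \<in> {0<..<1}")
      case True
      have pos: "1 * (1-v) + k * v > 0" using True k by (intro add_pos_pos) auto
      have e: "1 - x^2 * v = 1 * (1-v) + k * v" by (simp add: k_def algebra_simps)
      have e1: "-((1-s)/2 + (1+s)/2) = -1" by (simp add: field_simps)
      have e2: "v powr (-1/2) * v powr (-s/2) = v powr ((1-s)/2-1)"
        unfolding powr_add[symmetric] by (rule arg_cong[where f="\<lambda>a. v powr a"]) (simp add: field_simps)
      have e3: "(s-1)/2 = (1+s)/2-1" by (simp add: field_simps)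
      have "v powr (-1/2) * h v = (v powr (-1/2) * v powr (-s/2)) * (1-v) powr ((s-1)/2) / (1 - x^2 * v)"
        using True by (simp add: h_def)
      also have "\<dots> = v powr ((1-s)/2-1) * (1-v) powr ((1+s)/2-1) * (1 * (1-v) + k * v) powr (-((1-s)/2 + (1+s)/2))"
        unfolding e e1 e2 e3 using pos by (simp only: powr_minus_divide powr_one times_divide_eq_right mult_1_right)
      finally have "v powr (-1/2) * h v = v powr ((1-s)/2-1) * (1-v) powr ((1+s)/2-1) * (1 * (1-v) + k * v) powr (-((1-s)/2 + (1+s)/2))" .
      then show ?thesis using True by simp
    next
      case False
      then have "h v = 0 \<or> v \<notin> {0<..}" by (auto simp: h_def)
      then show ?thesis using False by auto
    qed
  qed
  also have "\<dots> = ennreal (1 powr (-((1+s)/2)) * k powr (-((1-s)/2)) * Beta ((1-s)/2) ((1+s)/2))"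
    by (rule nn_integral_Beta_homography) (use s k in auto)
  also have "ennreal (k powr ((1-s)/2)) * \<dots> = ennreal (k powr ((1-s)/2) * (k powr (-((1-s)/2)) * Beta ((1-s)/2) ((1+s)/2)))"
    by (simp add: ennreal_mult')
  also have "k powr ((1-s)/2) * (k powr (-((1-s)/2)) * Beta ((1-s)/2) ((1+s)/2)) = Beta ((1-s)/2) ((1+s)/2)"
    using k by (simp add: powr_minus)
  finally show ?thesis .
qed

text \<open>The involution degenerates at \<open>x = 1\<close>, so the endpoint is computed directly
  by \<open>y = 1 - 2*r\<close>. Its value then bounds the potential outside the interval.\<close>

lemma nn_integral_unit_potential_endpoint:
  fixes s :: real
  assumes s: "0 < s" "s < 1"
  shows "(\<integral>\<^sup>+y\<in>{-1<..<1}. ennreal (\<bar>1 - y\<bar> powr (-s) * (1 - y^2) powr ((s-1)/2)) \<partial>lborel)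
     = ennreal (Beta ((1-s)/2) ((1+s)/2))"
proof -
  have "(\<integral>\<^sup>+y\<in>{-1<..<1}. ennreal (\<bar>1 - y\<bar> powr (-s) * (1 - y^2) powr ((s-1)/2)) \<partial>lborel)
    = (\<integral>\<^sup>+r. 2 * (ennreal (\<bar>1 - (1 + (-2) * r)\<bar> powr (-s) * (1 - (1 + (-2) * r)^2) powr ((s-1)/2)) * indicator {-1<..<1} (1 + (-2) * r)) \<partial>lborel)"
    by (subst nn_integral_real_affine[of _ "-2" 1]) (auto simp: nn_integral_cmult)
  also have "\<dots> = (\<integral>\<^sup>+r\<in>{0<..<1}. ennreal (r powr ((1-s)/2-1) * (1-r) powr ((1+s)/2-1) * (1 * (1-r) + 1 * r) powr (-((1-s)/2 + (1+s)/2))) \<partial>lborel)"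
  proof (intro nn_integral_cong)
    fix r :: real
    show "2 * (ennreal (\<bar>1 - (1 + (-2) * r)\<bar> powr (-s) * (1 - (1 + (-2) * r)^2) powr ((s-1)/2)) * indicator {-1<..<1} (1 + (-2) * r)) =
      ennreal (r powr ((1-s)/2-1) * (1-r) powr ((1+s)/2-1) * (1 * (1-r) + 1 * r) powr (-((1-s)/2 + (1+s)/2))) * indicator {0<..<1} r"
    proof (cases "r \<in> {0<..<1}")
      case True
      have e: "1 - (1 + (-2) * r)^2 = 2^2 * (r * (1-r))" by (simp add: power2_eq_square algebra_simps)
      have "2 * (\<bar>1 - (1 + (-2) * r)\<bar> powr (-s) * (1 - (1 + (-2) * r)^2) powr ((s-1)/2)) =
         2 * ((2 powr (-s) * r powr (-s)) * ((2^2) powr ((s-1)/2) * (r powr ((s-1)/2) * (1-r) powr ((s-1)/2))))"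
        unfolding e using True by (simp only: powr_mult) (simp add: powr_mult)
      also have "(2^2) powr ((s-1)/2) = (2::real) powr (s-1)"
        by (simp only: power2_powr_half abs_of_pos abs_numeral)
      also have "2 * ((2 powr (-s) * r powr (-s)) * (2 powr (s-1) * (r powr ((s-1)/2) * (1-r) powr ((s-1)/2)))) =
        (2 * 2 powr (-s) * 2 powr (s-1)) * (r powr (-s) * r powr ((s-1)/2)) * (1-r) powr ((s-1)/2)"
        by simp
      also have "2 * 2 powr (-s) * 2 powr (s-1) = (1::real)"
        by (simp add: powr_diff powr_minus)
      also have "r powr (-s) * r powr ((s-1)/2) = r powr ((1-s)/2-1)"
        unfolding powr_add[symmetric] by (rule arg_cong[where f="\<lambda>a. r powr a"]) (simp add: field_simps)
      also have "(s-1)/2 = (1+s)/2-1" by (simp add: field_simps)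
      finally have "2 * (\<bar>1 - (1 + (-2) * r)\<bar> powr (-s) * (1 - (1 + (-2) * r)^2) powr ((s-1)/2)) =
         r powr ((1-s)/2-1) * (1-r) powr ((1+s)/2-1)" by simp
      then have "2 * ennreal (\<bar>1 - (1 + (-2) * r)\<bar> powr (-s) * (1 - (1 + (-2) * r)^2) powr ((s-1)/2)) =
         ennreal (r powr ((1-s)/2-1) * (1-r) powr ((1+s)/2-1))"
        by (metis ennreal_mult' ennreal_numeral zero_le_numeral)
      then show ?thesis using True by (simp add: indicator_def)
    next
      case False
      then show ?thesis by (auto simp: indicator_def)
    qed
  qed
  also have "\<dots> = ennreal (1 powr (-((1+s)/2)) * 1 powr (-((1-s)/2)) * Beta ((1-s)/2) ((1+s)/2))"
    by (rule nn_integral_Beta_homography) (use s in auto)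
  finally show ?thesis by simp
qed

text \<open>For \<open>x >= 1\<close> every \<open>y\<close> in the interval is at least as far from
  \<open>x\<close> as from 1, so the kernel is at most its value at the endpoint; reflection handles
  \<open>x <= -1\<close>.\<close>

lemma nn_integral_unit_potential_le:
  fixes s x :: real
  assumes s: "0 < s" "s < 1"
  shows "(\<integral>\<^sup>+y\<in>{-1<..<1}. ennreal (\<bar>x - y\<bar> powr (-s) * (1 - y^2) powr ((s-1)/2)) \<partial>lborel)
     \<le> ennreal (Beta ((1-s)/2) ((1+s)/2))"
proof -
  have out: "(\<integral>\<^sup>+y\<in>{-1<..<1}. ennreal (\<bar>x - y\<bar> powr (-s) * (1 - y^2) powr ((s-1)/2)) \<partial>lborel)
     \<le> ennreal (Beta ((1-s)/2) ((1+s)/2))" if "x \<ge> 1" for x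
  proof -
    have "(\<integral>\<^sup>+y\<in>{-1<..<1}. ennreal (\<bar>x - y\<bar> powr (-s) * (1 - y^2) powr ((s-1)/2)) \<partial>lborel)
      \<le> (\<integral>\<^sup>+y\<in>{-1<..<1}. ennreal (\<bar>1 - y\<bar> powr (-s) * (1 - y^2) powr ((s-1)/2)) \<partial>lborel)"
    proof (intro nn_integral_mono)
      fix y :: real
      have "\<bar>x - y\<bar> powr (-s) \<le> \<bar>1 - y\<bar> powr (-s)" if "y \<in> {-1<..<1}"
        using that \<open>x \<ge> 1\<close> s by (intro powr_mono2') auto
      then show "ennreal (\<bar>x - y\<bar> powr (-s) * (1 - y^2) powr ((s-1)/2)) * indicator {-1<..<1} y
        \<le> ennreal (\<bar>1 - y\<bar> powr (-s) * (1 - y^2) powr ((s-1)/2)) * indicator {-1<..<1} y"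
        by (auto simp: indicator_def intro!: ennreal_leI mult_right_mono)
    qed
    then show ?thesis using nn_integral_unit_potential_endpoint[OF s] by simp
  qed
  consider "\<bar>x\<bar> < 1" | "x \<ge> 1" | "-x \<ge> 1" by linarith
  then show ?thesis
  proof cases
    case 1 then show ?thesis using nn_integral_unit_potential[OF s] by simp
  next
    case 2 then show ?thesis by (rule out)
  next
    case 3
    have "(\<integral>\<^sup>+y\<in>{-1<..<1}. ennreal (\<bar>x - y\<bar> powr (-s) * (1 - y^2) powr ((s-1)/2)) \<partial>lborel)
       = (\<integral>\<^sup>+y\<in>{-1<..<1}. ennreal (\<bar>-x - y\<bar> powr (-s) * (1 - y^2) powr ((s-1)/2)) \<partial>lborel)"
      by (subst nn_integral_real_affine[of _ "-1" 0])
         (auto intro!: nn_integral_cong simp: indicator_def abs_minus_commute[of "-x"] add.commute)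
    then show ?thesis using out[OF 3] by simp
  qed
qed

text \<open>A multiple of the equilibrium density of [-t, t]; at \<open>s = 0\<close> it would have
  the shape of the arcsine law. The factor \<open>t powr (-s)\<close> makes the total mass
  independent of \<open>t\<close>, so a weight in \<open>t\<close> is, up to one constant, the mass
  assigned to radius \<open>t\<close>.\<close>

definition riesz_arcsine :: "real \<Rightarrow> real \<Rightarrow> real \<Rightarrow> real" where
  "riesz_arcsine s t y = (if \<bar>y\<bar> < t then t powr (-s) * (t\<^sup>2 - y\<^sup>2) powr ((s-1)/2) else 0)"

lemma riesz_arcsine_nonneg [simp]: "0 \<le> riesz_arcsine s t y"
  by (simp add: riesz_arcsine_def)

lemma riesz_arcsine_measurable [measurable]:
  assumes [measurable]: "f \<in> borel_measurable M" "g \<in> borel_measurable M"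
  shows "(\<lambda>z. riesz_arcsine s (f z) (g z)) \<in> borel_measurable M"
  unfolding riesz_arcsine_def by measurable

lemma riesz_arcsine_scale:
  assumes "t > 0"
  shows "t * riesz_arcsine s t (t * z) = riesz_arcsine s 1 z"
proof (cases "\<bar>z\<bar> < 1")
  case True
  then have z: "1 - z\<^sup>2 > 0" by (simp add: abs_square_less_1)
  have "\<bar>t * z\<bar> < t" using True assms by (simp add: abs_mult)
  moreover have "t\<^sup>2 - (t * z)\<^sup>2 = t\<^sup>2 * (1 - z\<^sup>2)" by (simp add: power2_eq_square algebra_simps)
  ultimately have "t * riesz_arcsine s t (t * z) = t * t powr (-s) * (t\<^sup>2) powr ((s-1)/2) * (1 - z\<^sup>2) powr ((s-1)/2)"
    using z assms by (simp add: riesz_arcsine_def powr_mult)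
  also have "t * t powr (-s) * (t\<^sup>2) powr ((s-1)/2) = 1"
    using assms by (simp add: power2_powr_half powr_diff powr_minus)
  finally show ?thesis using True by (simp add: riesz_arcsine_def)
next
  case False
  then show ?thesis using assms by (simp add: riesz_arcsine_def abs_mult)
qed

lemma nn_integral_riesz_arcsine_potential:
  fixes s t x :: real
  assumes t: "0 < t"
  shows "(\<integral>\<^sup>+y. ennreal (\<bar>x - y\<bar> powr (-s) * riesz_arcsine s t y) \<partial>lborel)
    = ennreal (t powr (-s)) * (\<integral>\<^sup>+y\<in>{-1<..<1}. ennreal (\<bar>x / t - y\<bar> powr (-s) * (1 - y\<^sup>2) powr ((s-1)/2)) \<partial>lborel)"
proof -
  have "(\<integral>\<^sup>+y. ennreal (\<bar>x - y\<bar> powr (-s) * riesz_arcsine s t y) \<partial>lborel)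
    = (\<integral>\<^sup>+z. ennreal t * ennreal (\<bar>x - t * z\<bar> powr (-s) * riesz_arcsine s t (t * z)) \<partial>lborel)"
    using t by (subst nn_integral_real_affine[of _ t 0]) (auto simp: nn_integral_cmult)
  also have "\<dots> = (\<integral>\<^sup>+y. ennreal (t powr (-s)) * (ennreal (\<bar>x / t - y\<bar> powr (-s) * (1 - y\<^sup>2) powr ((s-1)/2)) * indicator {-1<..<1} y) \<partial>lborel)"
  proof (intro nn_integral_cong)
    fix z :: real
    have "\<bar>x - t * z\<bar> = t * \<bar>x / t - z\<bar>"
    proof -
      have "x - t * z = t * (x / t - z)" using t by (simp add: field_simps)
      then show ?thesis using t by (simp only: abs_mult abs_of_pos)
    qed
    then have "t * (\<bar>x - t * z\<bar> powr (-s) * riesz_arcsine s t (t * z)) = t powr (-s) * (\<bar>x / t - z\<bar> powr (-s) * riesz_arcsine s 1 z)"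
      unfolding riesz_arcsine_scale[OF t, symmetric] using t by (simp add: powr_mult)
    then have "ennreal t * ennreal (\<bar>x - t * z\<bar> powr (-s) * riesz_arcsine s t (t * z)) =
      ennreal (t powr (-s)) * ennreal (\<bar>x / t - z\<bar> powr (-s) * riesz_arcsine s 1 z)"
      using t by (simp flip: ennreal_mult)
    then show "ennreal t * ennreal (\<bar>x - t * z\<bar> powr (-s) * riesz_arcsine s t (t * z)) =
      ennreal (t powr (-s)) * (ennreal (\<bar>x / t - z\<bar> powr (-s) * (1 - z\<^sup>2) powr ((s-1)/2)) * indicator {-1<..<1} z)"
      by (auto simp: riesz_arcsine_def indicator_def abs_less_iff)
  qed
  also have "\<dots> = ennreal (t powr (-s)) * (\<integral>\<^sup>+y\<in>{-1<..<1}. ennreal (\<bar>x / t - y\<bar> powr (-s) * (1 - y\<^sup>2) powr ((s-1)/2)) \<partial>lborel)"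
    by (rule nn_integral_cmult) auto
  finally show ?thesis .
qed

lemma riesz_arcsine_potential:
  fixes s t x :: real
  assumes s: "0 < s" "s < 1" and t: "0 < t" and x: "\<bar>x\<bar> < t"
  shows "(\<integral>\<^sup>+y. ennreal (\<bar>x - y\<bar> powr (-s) * riesz_arcsine s t y) \<partial>lborel)
    = ennreal (t powr (-s) * Beta ((1-s)/2) ((1+s)/2))"
proof -
  have "\<bar>x / t\<bar> < 1" using x t by simp
  from nn_integral_unit_potential[OF s this] show ?thesis
    unfolding nn_integral_riesz_arcsine_potential[OF t] by (simp add: ennreal_mult')
qed

lemma riesz_arcsine_potential_le:
  fixes s t x :: real
  assumes s: "0 < s" "s < 1" and t: "0 < t"
  shows "(\<integral>\<^sup>+y. ennreal (\<bar>x - y\<bar> powr (-s) * riesz_arcsine s t y) \<partial>lborel)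
    \<le> ennreal (t powr (-s) * Beta ((1-s)/2) ((1+s)/2))"
  unfolding nn_integral_riesz_arcsine_potential[OF t] 
  using nn_integral_unit_potential_le[OF s, of "x / t"]
  by (simp add: ennreal_mult' mult_left_mono)

lemma riesz_arcsine_mass:
  fixes s t :: real
  assumes s: "0 < s" "s < 1" and t: "0 < t"
  shows "(\<integral>\<^sup>+y. ennreal (riesz_arcsine s t y) \<partial>lborel) = ennreal (Beta (1/2) ((1+s)/2))"
proof -
  define h where "h v = (if v < 1 then (1 - v) powr ((s-1)/2) else 0)" for v :: real
  have [measurable]: "h \<in> borel_measurable borel" unfolding h_def by measurable
  have "(\<integral>\<^sup>+y. ennreal (riesz_arcsine s t y) \<partial>lborel) = (\<integral>\<^sup>+z. ennreal t * ennreal (riesz_arcsine s t (t * z)) \<partial>lborel)"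
    using t by (subst nn_integral_real_affine[of _ t 0]) (auto simp: nn_integral_cmult)
  also have "\<dots> = (\<integral>\<^sup>+z. ennreal (h (z\<^sup>2)) \<partial>lborel)"
  proof (intro nn_integral_cong)
    fix z
    have "ennreal t * ennreal (riesz_arcsine s t (t * z)) = ennreal (riesz_arcsine s 1 z)"
      unfolding riesz_arcsine_scale[OF t, symmetric] using t by (simp add: ennreal_mult)
    then show "ennreal t * ennreal (riesz_arcsine s t (t * z)) = ennreal (h (z\<^sup>2))"
      by (simp add: riesz_arcsine_def h_def abs_square_less_1)
  qed
  also have "\<dots> = (\<integral>\<^sup>+v\<in>{0<..}. ennreal (v powr (-1/2) * h v) \<partial>lborel)"
    by (rule nn_integral_square_real) (auto simp: h_def)
  also have "\<dots> = (\<integral>\<^sup>+r\<in>{0<..<1}. ennreal (r powr (1/2-1) * (1-r) powr ((1+s)/2-1) * (1 * (1-r) + 1 * r) powr (-(1/2 + (1+s)/2))) \<partial>lborel)"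
  proof (intro nn_integral_cong)
    fix v :: real
    have "(1+s)/2-1 = (s-1)/2" by (simp add: field_simps)
    then show "ennreal (v powr (-1/2) * h v) * indicator {0<..} v =
      ennreal (v powr (1/2-1) * (1-v) powr ((1+s)/2-1) * (1 * (1-v) + 1 * v) powr (-(1/2 + (1+s)/2))) * indicator {0<..<1} v"
      by (simp add: h_def indicator_def)
  qed
  also have "\<dots> = ennreal (1 powr (-((1+s)/2)) * 1 powr (-(1/2)) * Beta (1/2) ((1+s)/2))"
    by (rule nn_integral_Beta_homography) (use s in auto)
  finally show ?thesis by simp
qed

lemma nn_integral_inverse_quadratic_powr:
  fixes s :: real
  assumes s: "0 < s" "s < 1"
  shows "(\<integral>\<^sup>+r. ennreal ((1 + r\<^sup>2) powr (s/2-1)) \<partial>lborel) = ennreal (Beta (1/2) ((1-s)/2))"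
proof -
  have "(\<integral>\<^sup>+r. ennreal ((1 + r\<^sup>2) powr (s/2-1)) \<partial>lborel)
     = (\<integral>\<^sup>+v\<in>{0<..}. ennreal (v powr (-1/2) * (1 + v) powr (s/2-1)) \<partial>lborel)"
    by (rule nn_integral_square_real[where f="\<lambda>v. (1 + v) powr (s/2-1)"]) auto
  also have "\<dots> = (\<integral>\<^sup>+v\<in>{0<..}. ennreal (v powr (1/2-1) * (1 + 1 * v) powr (-(1/2+(1-s)/2))) \<partial>lborel)"
  proof -
    have "-(1/2+(1-s)/2) = s/2-1" by (simp add: field_simps)
    then show ?thesis by simp
  qed
  also have "\<dots> = ennreal (1 powr (-((1-s)/2)) * 1 powr (-(1/2)) * Beta (1/2) ((1-s)/2))"
    by (rule nn_integral_Beta_halfline) (use s in auto)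
  finally show ?thesis by simp
qed

text \<open>Translation by \<open>x\<close> followed by inversion (a Kelvin transform) absorbs the
  kernel: the exponents \<open>s\<close>, \<open>-2\<close> and \<open>2-s\<close> of the modulus of
  \<open>v\<close> cancel, and a power of a quadratic in \<open>v\<close> remains, which rescaling
  reduces to a Beta integral. The outcome is a multiple of the distance power to \<open>b*i\<close>,
  so the density is a multiple of the balayage of the point mass there.\<close>

lemma balayage_potential:
  fixes s b x :: real
  assumes s: "0 < s" "s < 1" and b: "0 < b"
  shows "(\<integral>\<^sup>+y. ennreal (\<bar>x - y\<bar> powr (-s) * (y\<^sup>2 + b\<^sup>2) powr (s/2-1)) \<partial>lborel)
    = ennreal (b powr (s-1) * (x\<^sup>2 + b\<^sup>2) powr (-s/2) * Beta (1/2) ((1-s)/2))"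
proof -
  define A where "A = x\<^sup>2 + b\<^sup>2"
  have A: "A > 0" using b by (simp add: A_def add_nonneg_pos)
  have "(\<integral>\<^sup>+y. ennreal (\<bar>x - y\<bar> powr (-s) * (y\<^sup>2 + b\<^sup>2) powr (s/2-1)) \<partial>lborel)
    = (\<integral>\<^sup>+w. ennreal (\<bar>w\<bar> powr (-s) * ((x + w)\<^sup>2 + b\<^sup>2) powr (s/2-1)) \<partial>lborel)"
    by (subst nn_integral_real_affine[of _ 1 x]) auto
  also have "\<dots> = (\<integral>\<^sup>+v. ennreal (\<bar>1/v\<bar> powr (-s) * ((x + 1/v)\<^sup>2 + b\<^sup>2) powr (s/2-1) / v\<^sup>2) \<partial>lborel)"
    by (rule nn_integral_inversion) auto
  \<comment> \<open>Completing the square: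
    \<open>v^2 * ((x + 1/v)^2 + b^2) = A * v^2 + 2 * x * v + 1\<close>, and
    \<open>1 - x^2 / A = b^2 / A\<close>. The point \<open>v = 0\<close> is null.\<close>
  also have "\<dots> = (\<integral>\<^sup>+v. ennreal ((A * (v + x / A)\<^sup>2 + b\<^sup>2 / A) powr (s/2-1)) \<partial>lborel)"
  proof (rule nn_integral_cong_AE, rule AE_mp[OF AE_lborel_singleton[of 0]], rule AE_I2, rule impI)
    fix v :: real assume v: "v \<noteq> 0"
    define N where "N = A * (v + x / A)\<^sup>2 + b\<^sup>2 / A"
    have N: "N > 0" using A b by (simp add: N_def add_nonneg_pos)
    have "N = (A * v + x)\<^sup>2 / A + b\<^sup>2 / A"
    proof -
      have "A * (v + x / A)\<^sup>2 = (A * v + x)\<^sup>2 / A"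
        using A by (simp add: power2_eq_square field_simps)
      then show ?thesis by (simp add: N_def)
    qed
    also have "\<dots> = (x * v + 1)\<^sup>2 + b\<^sup>2 * v\<^sup>2"
    proof -
      have "(A * v + x)\<^sup>2 + b\<^sup>2 = A * ((x * v + 1)\<^sup>2 + b\<^sup>2 * v\<^sup>2)"
        unfolding A_def by (simp add: power2_eq_square algebra_simps)
      then show ?thesis using A by (simp add: field_simps)
    qed
    finally have e1: "(x + 1/v)\<^sup>2 + b\<^sup>2 = N / v\<^sup>2"
      using v by (simp add: field_simps power2_eq_square)
    have e2: "(v\<^sup>2) powr (s/2-1) = \<bar>v\<bar> powr (s-2)"
      using power2_powr_half[of v "s-2"] by (simp add: diff_divide_distrib)
    have e3: "\<bar>1/v\<bar> powr (-s) = \<bar>v\<bar> powr s"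
      using v by (simp add: powr_divide powr_minus abs_divide)
    have e4: "\<bar>v\<bar> powr s / (\<bar>v\<bar> powr (s-2) * v\<^sup>2) = 1"
    proof -
      have "\<bar>v\<bar> powr (s-2) * v\<^sup>2 = \<bar>v\<bar> powr (s-2) * \<bar>v\<bar> powr 2" using v by simp
      also have "\<dots> = \<bar>v\<bar> powr s" by (simp only: powr_add[symmetric]) simp
      finally show ?thesis using v by simp
    qed
    have "\<bar>1/v\<bar> powr (-s) * ((x + 1/v)\<^sup>2 + b\<^sup>2) powr (s/2-1) / v\<^sup>2
       = \<bar>v\<bar> powr s * (N powr (s/2-1) / \<bar>v\<bar> powr (s-2)) / v\<^sup>2"
      unfolding e1 e3 using N by (simp add: powr_divide e2)
    also have "\<dots> = N powr (s/2-1) * (\<bar>v\<bar> powr s / (\<bar>v\<bar> powr (s-2) * v\<^sup>2))"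
      by simp
    also note e4
    finally show "ennreal (\<bar>1/v\<bar> powr (-s) * ((x + 1/v)\<^sup>2 + b\<^sup>2) powr (s/2-1) / v\<^sup>2) = ennreal ((A * (v + x / A)\<^sup>2 + b\<^sup>2 / A) powr (s/2-1))"
      by (simp add: N_def)
  qed
  also have "\<dots> = (\<integral>\<^sup>+r. ennreal (b / A) * ennreal ((A * ((-x / A + b / A * r) + x / A)\<^sup>2 + b\<^sup>2 / A) powr (s/2-1)) \<partial>lborel)"
    using A b by (subst nn_integral_real_affine[of _ "b / A" "-x / A"]) (auto simp: nn_integral_cmult)
  also have "\<dots> = (\<integral>\<^sup>+r. ennreal (b powr (s-1) * A powr (-s/2)) * ennreal ((1 + r\<^sup>2) powr (s/2-1)) \<partial>lborel)"
  proof (intro nn_integral_cong)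
    fix r :: real
    have "A * ((-x / A + b / A * r) + x / A)\<^sup>2 + b\<^sup>2 / A = b\<^sup>2 / A * (1 + r\<^sup>2)"
      using A by (simp add: power2_eq_square field_simps)
    moreover have "(b\<^sup>2 / A * (1 + r\<^sup>2)) powr (s/2-1) = (b\<^sup>2) powr (s/2-1) / A powr (s/2-1) * (1 + r\<^sup>2) powr (s/2-1)"
      using A by (simp add: powr_mult powr_divide)
    moreover have "(b\<^sup>2) powr (s/2-1) = b powr (s-2)"
      using power2_powr_half[of b "s-2"] b by (simp add: diff_divide_distrib)
    moreover have "b / A * (b powr (s-2) / A powr (s/2-1)) = b powr (s-1) * A powr (-s/2)"
    proof -
      have "b * b powr (s-2) = b powr (s-1)" using b by (simp add: powr_mult_base)
      moreover have "A * A powr (s/2-1) = A powr (s/2)" using A by (simp add: powr_mult_base)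
      ultimately show ?thesis by (simp add: powr_minus_divide)
    qed
    ultimately have "b / A * (A * ((-x / A + b / A * r) + x / A)\<^sup>2 + b\<^sup>2 / A) powr (s/2-1) = b powr (s-1) * A powr (-s/2) * (1 + r\<^sup>2) powr (s/2-1)"
      by (metis (no_types, lifting) mult.assoc)
    then show "ennreal (b / A) * ennreal ((A * ((-x / A + b / A * r) + x / A)\<^sup>2 + b\<^sup>2 / A) powr (s/2-1)) =
       ennreal (b powr (s-1) * A powr (-s/2)) * ennreal ((1 + r\<^sup>2) powr (s/2-1))"
      using A b by (simp flip: ennreal_mult)
  qed
  also have "\<dots> = ennreal (b powr (s-1) * A powr (-s/2)) * ennreal (Beta (1/2) ((1-s)/2))"
    by (subst nn_integral_cmult) (auto simp: nn_integral_inverse_quadratic_powr[OF s])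
  also have "\<dots> = ennreal (b powr (s-1) * (x\<^sup>2 + b\<^sup>2) powr (-s/2) * Beta (1/2) ((1-s)/2))"
    by (simp add: A_def ennreal_mult')
  finally show ?thesis .
qed

text \<open>Abel's fractional integral sends a power of \<open>v + E\<close> to another power;
  translating by \<open>y\<close> leaves a half-line Beta integral whose exponents
  \<open>(1+s)/2\<close> and \<open>1-s/2\<close> sum to \<open>3/2\<close>.\<close>

lemma nn_integral_abel:
  fixes s y E :: real
  assumes s: "0 < s" "s < 1" and E: "y + E > 0"
  shows "(\<integral>\<^sup>+v. ennreal (if y < v then (v - y) powr ((s-1)/2) * (v + E) powr (-3/2) else 0) \<partial>lborel)
    = ennreal (Beta ((1+s)/2) (1-s/2) * (y + E) powr (s/2-1))"
proof -
  have "(\<integral>\<^sup>+v. ennreal (if y < v then (v - y) powr ((s-1)/2) * (v + E) powr (-3/2) else 0) \<partial>lborel)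
    = (\<integral>\<^sup>+w. ennreal (if y < y + w then (y + w - y) powr ((s-1)/2) * (y + w + E) powr (-3/2) else 0) \<partial>lborel)"
    by (subst nn_integral_real_affine[of _ 1 y]) (simp_all cong: if_cong)
  also have "\<dots> = (\<integral>\<^sup>+w\<in>{0<..}. ennreal (w powr ((1+s)/2-1) * ((y + E) + 1 * w) powr (-((1+s)/2 + (1-s/2)))) \<partial>lborel)"
  proof (intro nn_integral_cong)
    fix w :: real
    have "(1+s)/2-1 = (s-1)/2" "-((1+s)/2 + (1-s/2)) = -3/2" by (simp_all add: field_simps)
    then show "ennreal (if y < y + w then (y + w - y) powr ((s-1)/2) * (y + w + E) powr (-3/2) else 0) =
       ennreal (w powr ((1+s)/2-1) * ((y + E) + 1 * w) powr (-((1+s)/2 + (1-s/2)))) * indicator {0<..} w"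
      by (simp add: indicator_def add_ac)
  qed
  also have "\<dots> = ennreal ((y + E) powr (-(1-s/2)) * 1 powr (-((1+s)/2)) * Beta ((1+s)/2) (1-s/2))"
    by (rule nn_integral_Beta_halfline) (use s E in auto)
  finally show ?thesis by (simp add: mult.commute)
qed

section \<open>The balayage as a mixture of interval equilibrium measures\<close>

text \<open>The Abel inverse of the balayage density. In the variable \<open>v = t^2\<close> the
  factor \<open>t powr (1+s)\<close> cancels the \<open>t powr (-s)\<close> of
  \<open>riesz_arcsine\<close> and provides the Jacobian, leaving the pure Abel kernel against
  \<open>(v + b^2) powr (-3/2)\<close>.\<close>

definition mass_rate :: "real \<Rightarrow> real \<Rightarrow> real \<Rightarrow> real" where
  "mass_rate s b t = t powr (1+s) * (t\<^sup>2 + b\<^sup>2) powr (-3/2)"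

lemma mass_rate_nonneg [simp]: "0 \<le> mass_rate s b t"
  by (simp add: mass_rate_def)

lemma mass_rate_measurable [measurable]: "mass_rate s b \<in> borel_measurable borel"
  unfolding mass_rate_def[abs_def] by measurable

text \<open>Used with two cuts: \<tau> equal to the modulus of \<open>x\<close> gives the whole
  mixture at \<open>x\<close>, since smaller intervals miss \<open>x\<close>, and \<tau> equal to
  \<open>a\<close> gives the part removed by truncation. The lower bound on \<tau> places
  \<open>x\<close> inside every interval that is counted.\<close>

lemma nn_integral_arcsine_mixture_tail:
  fixes s b x \<tau> :: real
  assumes s: "0 < s" "s < 1" and x: "\<bar>x\<bar> \<le> \<tau>"
  shows "(\<integral>\<^sup>+t\<in>{\<tau><..}. ennreal (riesz_arcsine s t x * mass_rate s b t) \<partial>lborel)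
    = (\<integral>\<^sup>+v. ennreal (if \<tau>\<^sup>2 < v then (v - x\<^sup>2) powr ((s-1)/2) * (v + b\<^sup>2) powr (-3/2) / 2 else 0) \<partial>lborel)"
proof -
  define f where "f v = (if \<tau>\<^sup>2 < v then (v - x\<^sup>2) powr ((s-1)/2) * (v + b\<^sup>2) powr (-3/2) / 2 else 0)" for v
  have [measurable]: "f \<in> borel_measurable borel" unfolding f_def by measurable
  have \<tau>: "0 \<le> \<tau>" using x by linarith
  have "(\<integral>\<^sup>+t\<in>{\<tau><..}. ennreal (riesz_arcsine s t x * mass_rate s b t) \<partial>lborel)
     = (\<integral>\<^sup>+t\<in>{0<..}. ennreal (2 * t * f (t\<^sup>2)) \<partial>lborel)"
  proof (intro nn_integral_cong)
    fix t :: real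
    show "ennreal (riesz_arcsine s t x * mass_rate s b t) * indicator {\<tau><..} t = ennreal (2 * t * f (t\<^sup>2)) * indicator {0<..} t"
    proof (cases "t > 0")
      case t: True
      show ?thesis
      proof (cases "\<tau> < t")
        case True
        then have "\<tau>\<^sup>2 < t\<^sup>2" using \<tau> by (simp add: power_strict_mono)
        moreover have "t powr (-s) * t powr (1+s) = t" using t by (simp flip: powr_add)
        ultimately have "riesz_arcsine s t x * mass_rate s b t = 2 * t * f (t\<^sup>2)"
          using True x unfolding riesz_arcsine_def mass_rate_def f_def
          by (simp add: field_simps)
        then show ?thesis using True t by simp
      next
        case False
        then have "\<not> \<tau>\<^sup>2 < t\<^sup>2" using t by (simp add: power_mono not_less)
        then show ?thesis using False by (simp add: f_def)
      qed
    next
      case False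
      then show ?thesis using \<tau> by (auto simp: indicator_def)
    qed
  qed
  also have "\<dots> = (\<integral>\<^sup>+v\<in>{0<..}. ennreal (f v) \<partial>lborel)"
    by (rule nn_integral_square_halfline) (auto simp: f_def)
  also have "\<dots> = (\<integral>\<^sup>+v. ennreal (f v) \<partial>lborel)"
  proof (intro nn_integral_cong)
    fix v
    have "f v = 0" if "\<not> 0 < v" 
    proof -
      have "\<not> \<tau>\<^sup>2 < v" using that zero_le_power2[of \<tau>] by linarith
      then show ?thesis by (simp add: f_def)
    qed
    then show "ennreal (f v) * indicator {0<..} v = ennreal (f v)" by (cases "0 < v") auto
  qed
  finally show ?thesis by (simp add: f_def)
qed

lemma nn_integral_arcsine_mixture:
  fixes s b x :: real
  assumes s: "0 < s" "s < 1" and b: "0 < b"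
  shows "(\<integral>\<^sup>+t\<in>{0<..}. ennreal (riesz_arcsine s t x * mass_rate s b t) \<partial>lborel)
    = ennreal (Beta ((1+s)/2) (1-s/2) * (x\<^sup>2 + b\<^sup>2) powr (s/2-1) / 2)"
proof -
  have "(\<integral>\<^sup>+t\<in>{0<..}. ennreal (riesz_arcsine s t x * mass_rate s b t) \<partial>lborel)
     = (\<integral>\<^sup>+t\<in>{\<bar>x\<bar><..}. ennreal (riesz_arcsine s t x * mass_rate s b t) \<partial>lborel)"
    by (intro nn_integral_cong) (auto simp: indicator_def riesz_arcsine_def)
  also have "\<dots> = (\<integral>\<^sup>+v. ennreal (1/2) * ennreal (if x\<^sup>2 < v then (v - x\<^sup>2) powr ((s-1)/2) * (v + b\<^sup>2) powr (-3/2) else 0) \<partial>lborel)"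
    unfolding nn_integral_arcsine_mixture_tail[OF s order_refl]
    by (intro nn_integral_cong, subst ennreal_mult'[symmetric]) auto
  also have "\<dots> = ennreal (1/2) * (\<integral>\<^sup>+v. ennreal (if x\<^sup>2 < v then (v - x\<^sup>2) powr ((s-1)/2) * (v + b\<^sup>2) powr (-3/2) else 0) \<partial>lborel)"
    by (rule nn_integral_cmult) auto
  also have "(\<integral>\<^sup>+v. ennreal (if x\<^sup>2 < v then (v - x\<^sup>2) powr ((s-1)/2) * (v + b\<^sup>2) powr (-3/2) else 0) \<partial>lborel)
     = ennreal (Beta ((1+s)/2) (1-s/2) * (x\<^sup>2 + b\<^sup>2) powr (s/2-1))"
    by (rule nn_integral_abel) (use s b in \<open>auto intro: add_nonneg_pos\<close>)
  also have "ennreal (1/2) * \<dots> = ennreal (1/2 * (Beta ((1+s)/2) (1-s/2) * (x\<^sup>2 + b\<^sup>2) powr (s/2-1)))"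
    by (rule ennreal_mult'[symmetric]) simp
  finally show ?thesis by simp
qed

section \<open>The tail of the mixture as a difference of \<open>I_int\<close> values\<close>

text \<open>Scaling \<open>u = w * r\<close> frees the limits from \<open>w\<close> and turns
  \<open>u + D\<close> into \<open>D * (1-r) + (w + D) * r\<close>; the exponents sum to 1, so the
  weighted Beta integral applies. This is the inner integral over \<open>u\<close> in the exchange
  below.\<close>

lemma nn_integral_incomplete_kernel:
  fixes s D w :: real
  assumes s: "0 < s" "s < 1" and D: "0 < D" and w: "0 < w"
  shows "(\<integral>\<^sup>+u. ennreal (if 0 < u \<and> u < w then u powr (-(1+s)/2) * (w - u) powr ((s-1)/2) / (u + D) else 0) \<partial>lborel)
    = ennreal (D powr (-(1+s)/2) * (w + D) powr ((s-1)/2) * Beta ((1-s)/2) ((1+s)/2))"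
proof -
  have "(\<integral>\<^sup>+u. ennreal (if 0 < u \<and> u < w then u powr (-(1+s)/2) * (w - u) powr ((s-1)/2) / (u + D) else 0) \<partial>lborel)
    = (\<integral>\<^sup>+r. ennreal w * ennreal (if 0 < w * r \<and> w * r < w then (w * r) powr (-(1+s)/2) * (w - w * r) powr ((s-1)/2) / (w * r + D) else 0) \<partial>lborel)"
    using w by (subst nn_integral_real_affine[of _ w 0]) (simp_all add: nn_integral_cmult cong: if_cong)
  also have "\<dots> = (\<integral>\<^sup>+r\<in>{0<..<1}. ennreal (r powr ((1-s)/2-1) * (1-r) powr ((1+s)/2-1) * (D * (1-r) + (w + D) * r) powr (-((1-s)/2 + (1+s)/2))) \<partial>lborel)"
  proof (intro nn_integral_cong)
    fix r :: real
    show "ennreal w * ennreal (if 0 < w * r \<and> w * r < w then (w * r) powr (-(1+s)/2) * (w - w * r) powr ((s-1)/2) / (w * r + D) else 0)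
      = ennreal (r powr ((1-s)/2-1) * (1-r) powr ((1+s)/2-1) * (D * (1-r) + (w + D) * r) powr (-((1-s)/2 + (1+s)/2))) * indicator {0<..<1} r"
    proof (cases "r \<in> {0<..<1}")
      case True
      have e1: "-((1-s)/2 + (1+s)/2) = -1" "(1-s)/2-1 = -(1+s)/2" "(1+s)/2-1 = (s-1)/2" by (simp_all add: field_simps)
      have e2: "D * (1-r) + (w + D) * r = w * r + D" by (simp add: algebra_simps)
      have pos: "w * r + D > 0" using True w D by (simp add: add_pos_pos)
      have e3: "w - w * r = w * (1-r)" by (simp add: algebra_simps)
      have e4: "w * (w powr (-(1+s)/2) * w powr ((s-1)/2)) = 1"
      proof -
        have "-(1+s)/2 + (s-1)/2 = -1" by (simp add: field_simps)
        then show ?thesis using w by (simp only: powr_add[symmetric]) (simp add: powr_minus)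
      qed
      have "w * ((w * r) powr (-(1+s)/2) * (w - w * r) powr ((s-1)/2) / (w * r + D))
        = w * ((w powr (-(1+s)/2) * r powr (-(1+s)/2)) * (w powr ((s-1)/2) * (1-r) powr ((s-1)/2))) / (w * r + D)"
        unfolding e3 using True w by (simp only: powr_mult)  simp
      also have "\<dots> = w * (w powr (-(1+s)/2) * w powr ((s-1)/2)) * (r powr (-(1+s)/2) * (1-r) powr ((s-1)/2)) / (w * r + D)"
        by (simp only: mult_ac)
      also have "\<dots> = r powr ((1-s)/2-1) * (1-r) powr ((1+s)/2-1) * (D * (1-r) + (w + D) * r) powr (-((1-s)/2 + (1+s)/2))"
        unfolding e1 e2 e4 using pos by (simp only: powr_minus_divide powr_one times_divide_eq_right mult_1_right mult_1_left)
      finally have "w * ((w * r) powr (-(1+s)/2) * (w - w * r) powr ((s-1)/2) / (w * r + D))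
        = r powr ((1-s)/2-1) * (1-r) powr ((1+s)/2-1) * (D * (1-r) + (w + D) * r) powr (-((1-s)/2 + (1+s)/2))" .
      then show ?thesis using True w by (simp flip: ennreal_mult')
    next
      case False
      then show ?thesis using w by (auto simp: zero_less_mult_iff)
    qed
  qed
  also have "\<dots> = ennreal (D powr (-((1+s)/2)) * (w + D) powr (-((1-s)/2)) * Beta ((1-s)/2) ((1+s)/2))"
    by (rule nn_integral_Beta_homography) (use s D w in auto)
  also have "-((1+s)/2) = -(1+s)/2" by (simp add: field_simps)
  also have "-((1-s)/2) = (s-1)/2" by (simp add: field_simps)
  finally show ?thesis .
qed

text \<open>Fubini after writing \<open>(u + E) powr (s/2 - 1)\<close> as an Abel integral.\<close>

lemma nn_integral_kernel_exchange:
  fixes s D E :: real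
  assumes s: "0 < s" "s < 1" and D: "0 < D" and E: "0 < E"
  shows "ennreal (Beta ((1+s)/2) (1-s/2)) *
      (\<integral>\<^sup>+u\<in>{0<..}. ennreal (u powr (-(1+s)/2) * (u + E) powr (s/2-1) / (u + D)) \<partial>lborel)
    = ennreal (D powr (-(1+s)/2) * Beta ((1-s)/2) ((1+s)/2)) *
      (\<integral>\<^sup>+w\<in>{0<..}. ennreal ((w + D) powr ((s-1)/2) * (w + E) powr (-3/2)) \<partial>lborel)"
proof -
  let ?B1 = "Beta ((1+s)/2) (1-s/2)" and ?B2 = "Beta ((1-s)/2) ((1+s)/2)"
  \<comment> \<open>The joint integrand on the triangle \<open>0 < u < w\<close>, without
    \<open>(w + E) powr (-3/2)\<close>. Integrated over \<open>w\<close> against that factor it is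
    an Abel integral; integrated over \<open>u\<close> it is the incomplete kernel.\<close>
  define \<phi> where "\<phi> u w = (if 0 < u \<and> u < w then u powr (-(1+s)/2) * (w - u) powr ((s-1)/2) / (u + D) else 0)" for u w
  have \<phi>: "0 \<le> \<phi> u w" for u w using D by (simp add: \<phi>_def)
  have [measurable]: "(\<lambda>(u, w). \<phi> u w) \<in> borel_measurable (borel \<Otimes>\<^sub>M borel)"
    unfolding \<phi>_def by measurable
  have "ennreal ?B1 * (\<integral>\<^sup>+u\<in>{0<..}. ennreal (u powr (-(1+s)/2) * (u + E) powr (s/2-1) / (u + D)) \<partial>lborel)
    = (\<integral>\<^sup>+u. ennreal ?B1 * (ennreal (u powr (-(1+s)/2) * (u + E) powr (s/2-1) / (u + D)) * indicator {0<..} u) \<partial>lborel)"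
    by (rule nn_integral_cmult[symmetric]) auto
  also have "\<dots> = (\<integral>\<^sup>+u. (\<integral>\<^sup>+w. ennreal (\<phi> u w * (w + E) powr (-3/2)) \<partial>lborel) \<partial>lborel)"
  proof (intro nn_integral_cong)
    fix u :: real
    show "ennreal ?B1 * (ennreal (u powr (-(1+s)/2) * (u + E) powr (s/2-1) / (u + D)) * indicator {0<..} u)
      = (\<integral>\<^sup>+w. ennreal (\<phi> u w * (w + E) powr (-3/2)) \<partial>lborel)"
    proof (cases "0 < u")
      case True
      have "(\<integral>\<^sup>+w. ennreal (\<phi> u w * (w + E) powr (-3/2)) \<partial>lborel) =
         (\<integral>\<^sup>+w. ennreal (u powr (-(1+s)/2) / (u + D)) * ennreal (if u < w then (w - u) powr ((s-1)/2) * (w + E) powr (-3/2) else 0) \<partial>lborel)"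
        using True D by (intro nn_integral_cong) (simp add: \<phi>_def flip: ennreal_mult)
      also have "\<dots> = ennreal (u powr (-(1+s)/2) / (u + D)) * (\<integral>\<^sup>+w. ennreal (if u < w then (w - u) powr ((s-1)/2) * (w + E) powr (-3/2) else 0) \<partial>lborel)"
        by (rule nn_integral_cmult) auto
      also have "\<dots> = ennreal (u powr (-(1+s)/2) / (u + D)) * ennreal (?B1 * (u + E) powr (s/2-1))"
        using True E s by (subst nn_integral_abel) auto
      also have "\<dots> = ennreal (u powr (-(1+s)/2) / (u + D) * (?B1 * (u + E) powr (s/2-1)))"
        using True D by (intro ennreal_mult'[symmetric]) simp
      also have "\<dots> = ennreal ((u powr (-(1+s)/2) * (u + E) powr (s/2-1) / (u + D)) * ?B1)"
        by (simp add: mult_ac)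
      also have "\<dots> = ennreal (u powr (-(1+s)/2) * (u + E) powr (s/2-1) / (u + D)) * ennreal ?B1"
        using True D by (intro ennreal_mult') simp
      finally show ?thesis using True by (simp add: mult.commute)
    qed (simp add: \<phi>_def)
  qed
  also have "\<dots> = (\<integral>\<^sup>+w. (\<integral>\<^sup>+u. ennreal (\<phi> u w * (w + E) powr (-3/2)) \<partial>lborel) \<partial>lborel)"
    by (rule lborel_pair.Fubini'[symmetric]) measurable
  also have "\<dots> = (\<integral>\<^sup>+w. ennreal (D powr (-(1+s)/2) * ?B2) * (ennreal ((w + D) powr ((s-1)/2) * (w + E) powr (-3/2)) * indicator {0<..} w) \<partial>lborel)"
  proof (intro nn_integral_cong)
    fix w :: real
    show "(\<integral>\<^sup>+u. ennreal (\<phi> u w * (w + E) powr (-3/2)) \<partial>lborel) =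
       ennreal (D powr (-(1+s)/2) * ?B2) * (ennreal ((w + D) powr ((s-1)/2) * (w + E) powr (-3/2)) * indicator {0<..} w)"
    proof (cases "0 < w")
      case True
      have "(\<integral>\<^sup>+u. ennreal (\<phi> u w * (w + E) powr (-3/2)) \<partial>lborel) = (\<integral>\<^sup>+u. ennreal (\<phi> u w) * ennreal ((w + E) powr (-3/2)) \<partial>lborel)"
        by (intro nn_integral_cong ennreal_mult \<phi>) simp
      also have "\<dots> = (\<integral>\<^sup>+u. ennreal (\<phi> u w) \<partial>lborel) * ennreal ((w + E) powr (-3/2))"
        by (rule nn_integral_multc) measurable
      also have "(\<integral>\<^sup>+u. ennreal (\<phi> u w) \<partial>lborel) = ennreal (D powr (-(1+s)/2) * (w + D) powr ((s-1)/2) * ?B2)"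
        unfolding \<phi>_def by (rule nn_integral_incomplete_kernel[OF s D True])
      also have "\<dots> * ennreal ((w + E) powr (-3/2)) = ennreal (((w + D) powr ((s-1)/2) * (w + E) powr (-3/2)) * (D powr (-(1+s)/2) * ?B2))"
        by (subst ennreal_mult''[symmetric]) (simp_all add: mult_ac)
      also have "\<dots> = ennreal ((w + D) powr ((s-1)/2) * (w + E) powr (-3/2)) * ennreal (D powr (-(1+s)/2) * ?B2)"
        by (intro ennreal_mult') simp
      finally show ?thesis using True by (simp add: mult.commute)
    next
      case False
      then have "\<phi> u w = 0" for u by (simp add: \<phi>_def)
      then show ?thesis using False by simp
    qed
  qed
  also have "\<dots> = ennreal (D powr (-(1+s)/2) * ?B2) *
      (\<integral>\<^sup>+w\<in>{0<..}. ennreal ((w + D) powr ((s-1)/2) * (w + E) powr (-3/2)) \<partial>lborel)"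
    by (rule nn_integral_cmult) auto
  finally show ?thesis .
qed

text \<open>Up to a common factor both sides are the total mass of the full mixture: on the left the
  balayage density integrated over the line, on the right the masses of the interval measures summed
  over all radii. The proof is cancellation of Gamma values.\<close>

lemma Beta_normalization:
  fixes s :: real
  assumes s: "0 < s" "s < 1"
  shows "Beta ((1+s)/2) (1-s/2) * Beta (1/2) ((1-s)/2) = Beta (1/2) ((1+s)/2) * Beta (1+s/2) ((1-s)/2)"
proof -
  have nz: "Gamma (1+s/2) > 0" "Gamma (3/2::real) > 0" "Gamma (1-s/2) > 0" using s by (auto intro!: Gamma_real_pos)
  have e: "1/2 + (1+s)/2 = 1+s/2" "1+s/2 + (1-s)/2 = 3/2" "(1+s)/2 + (1-s/2) = 3/2" "1/2+(1-s)/2 = 1-s/2"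
    by (simp_all add: field_simps)
  show ?thesis unfolding Beta_def e using nz by (simp add: field_simps)
qed

lemma Beta_real_pos: "0 < a \<Longrightarrow> 0 < b \<Longrightarrow> 0 < Beta a (b::real)"
  by (simp add: Beta_def Gamma_real_pos)

text \<open>Chosen so that the mixture over all \<open>t > 0\<close> has total mass
  \<open>q\<close>. Through the next lemma the same constant makes its potential equal to minus the
  field.\<close>

definition rate_const :: "real \<Rightarrow> real \<Rightarrow> real \<Rightarrow> real" where
  "rate_const s q b = 2 * q * b powr (1-s) / (Beta (1/2) ((1+s)/2) * Beta (1+s/2) ((1-s)/2))"

lemma rate_const_Beta:
  assumes s: "0 < s" "s < 1"
  shows "rate_const s q b * (Beta ((1+s)/2) (1-s/2) / 2) = q * b powr (1-s) / Beta (1/2) ((1-s)/2)"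
proof -
  have pos: "Beta (1/2) ((1-s)/2) > 0" "Beta (1/2) ((1+s)/2) > 0" "Beta (1+s/2) ((1-s)/2) > 0"
    using s by (auto intro!: Beta_real_pos)
  have "rate_const s q b * (Beta ((1+s)/2) (1-s/2) / 2) = q * b powr (1-s) * (Beta ((1+s)/2) (1-s/2) * Beta (1/2) ((1-s)/2))
      / (Beta (1/2) ((1-s)/2) * (Beta (1/2) ((1+s)/2) * Beta (1+s/2) ((1-s)/2)))"
    using pos by (simp add: rate_const_def)
  also have "\<dots> = q * b powr (1-s) / Beta (1/2) ((1-s)/2)"
    unfolding Beta_normalization[OF s] using pos by simp
  finally show ?thesis .
qed

text \<open>The identity is \<open>1/u - 1/(u+D) = D / (u * (u+D))\<close>. As \<open>I_int\<close>
  is a Bochner integral, integrability must precede the subtraction: \<open>I_int s b a a\<close> is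
  a convergent Beta integral, and its integrand dominates the other two.\<close>

lemma I_int_difference:
  fixes s b a x :: real
  assumes s: "0 < s" "s < 1" and b: "0 < b" and x: "\<bar>x\<bar> < a"
  defines "D \<equiv> a\<^sup>2 - x\<^sup>2" and "E \<equiv> a\<^sup>2 + b\<^sup>2"
  shows "0 \<le> I_int s b a a - I_int s b a x"
    and "ennreal (I_int s b a a - I_int s b a x) = ennreal D *
      (\<integral>\<^sup>+u\<in>{0<..}. ennreal (u powr (-(1+s)/2) * (u + E) powr (s/2-1) / (u + D)) \<partial>lborel)"
proof -
  have D: "D > 0" using x unfolding D_def by (simp add: abs_square_less_1 flip: abs_le_square_iff not_le)
  have E: "E > 0" using b unfolding E_def by (simp add: add_nonneg_pos)
  define fx where "fx u = indicator {0<..} u * (u powr ((1 - s) / 2) / (u + E) powr (1 - s / 2) / (u + D))" for u :: real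
  define fa where "fa u = indicator {0<..} u * (u powr ((1 - s) / 2) / (u + E) powr (1 - s / 2) / u)" for u :: real
  define k where "k u = indicator {0<..} u * (u powr (-(1+s)/2) * (u + E) powr (s/2-1) / (u + D))" for u :: real
  have [measurable]: "fx \<in> borel_measurable borel" "fa \<in> borel_measurable borel" "k \<in> borel_measurable borel"
    unfolding fx_def fa_def k_def by measurable
  have nn: "0 \<le> fx u" "0 \<le> fa u" "0 \<le> k u" for u
    using D by (auto simp: fx_def fa_def k_def indicator_def)
  have split: "fa u = fx u + D * k u" for u
  proof (cases "u > 0")
    case True
    have p1: "(u + E) powr (s/2-1) = 1 / (u + E) powr (1 - s/2)"
      using powr_minus_divide[of "u + E" "1 - s/2"] by simp
    have p2: "u powr (-(1+s)/2) = u powr ((1-s)/2) / u"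
    proof -
      have "-(1+s)/2 = (1-s)/2 - 1" by (simp add: field_simps)
      then show ?thesis using True by (simp only: powr_diff powr_one)
    qed
    define N where "N = u powr ((1-s)/2) / (u + E) powr (1 - s/2)"
    have e: "fa u = N / u" "fx u = N / (u + D)" "k u = N / u / (u + D)"
      using True unfolding fa_def fx_def k_def p1 p2 N_def by simp_all
    have "u + D > 0" using True D by simp
    then show ?thesis unfolding e using True by (simp add: divide_simps) (simp add: algebra_simps)
  qed (simp add: fa_def fx_def k_def)
  have "(\<integral>\<^sup>+u. ennreal (fa u) \<partial>lborel) = (\<integral>\<^sup>+v\<in>{0<..}. ennreal (v powr ((1-s)/2-1) * (E + 1 * v) powr (-((1-s)/2 + 1/2))) \<partial>lborel)"
  proof (intro nn_integral_cong)
    fix u :: real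
    have "-((1-s)/2 + 1/2) = -(1 - s/2)" by (simp add: field_simps)
    then show "ennreal (fa u) = ennreal (u powr ((1-s)/2-1) * (E + 1 * u) powr (-((1-s)/2 + 1/2))) * indicator {0<..} u"
      by (cases "0 < u") (simp_all add: fa_def powr_diff powr_minus_divide add.commute)
  qed
  also have "\<dots> = ennreal (E powr (-(1/2)) * 1 powr (-((1-s)/2)) * Beta ((1-s)/2) (1/2))"
    by (rule nn_integral_Beta_halfline) (use s E in auto)
  finally have fin: "(\<integral>\<^sup>+u. ennreal (fa u) \<partial>lborel) < \<infinity>" by simp
  have int_a: "integrable lborel fa"
    by (rule integrableI_nonneg) (use nn fin in auto)
  have int_x: "integrable lborel fx"
    by (rule Bochner_Integration.integrable_bound[OF int_a]) (use nn split D in \<open>auto intro!: AE_I2\<close>)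
  have int_k: "integrable lborel (\<lambda>u. D * k u)"
    by (rule Bochner_Integration.integrable_bound[OF int_a]) (use nn split D in \<open>auto intro!: AE_I2\<close>)
  have Ia: "I_int s b a a = integral\<^sup>L lborel fa" and Ix: "I_int s b a x = integral\<^sup>L lborel fx"
    unfolding I_int_def set_lebesgue_integral_def fa_def fx_def D_def E_def
    by (simp_all add: add.assoc add_diff_eq)
  have diff: "I_int s b a a - I_int s b a x = (\<integral>u. D * k u \<partial>lborel)"
    unfolding Ia Ix using Bochner_Integration.integral_add[OF int_x int_k] by (simp flip: split)
  then show "0 \<le> I_int s b a a - I_int s b a x" using nn D by simp
  have "ennreal (\<integral>u. D * k u \<partial>lborel) = (\<integral>\<^sup>+u. ennreal (D * k u) \<partial>lborel)"
    by (rule nn_integral_eq_integral[symmetric, OF int_k]) (use nn D in auto)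
  also have "\<dots> = (\<integral>\<^sup>+u. ennreal D * (ennreal (u powr (-(1+s)/2) * (u + E) powr (s/2-1) / (u + D)) * indicator {0<..} u) \<partial>lborel)"
  proof (intro nn_integral_cong)
    fix u
    show "ennreal (D * k u) = ennreal D * (ennreal (u powr (-(1+s)/2) * (u + E) powr (s/2-1) / (u + D)) * indicator {0<..} u)"
      unfolding ennreal_mult'[OF less_imp_le[OF D]] by (cases "0 < u") (simp_all add: k_def)
  qed
  also have "\<dots> = ennreal D * (\<integral>\<^sup>+u\<in>{0<..}. ennreal (u powr (-(1+s)/2) * (u + E) powr (s/2-1) / (u + D)) \<partial>lborel)"
    by (rule nn_integral_cmult) auto
  finally show "ennreal (I_int s b a a - I_int s b a x) = ennreal D *
      (\<integral>\<^sup>+u\<in>{0<..}. ennreal (u powr (-(1+s)/2) * (u + E) powr (s/2-1) / (u + D)) \<partial>lborel)"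
    unfolding diff .
qed

text \<open>The tail is an integral in \<open>w = t^2 - a^2\<close>, the difference of
  \<open>I_int\<close> values one in the unrelated variable \<open>u\<close>; the exchange lemma
  equates them. Its power \<open>D powr (-(1+s)/2)\<close> and the factor \<open>D\<close> of the
  difference combine to the denominator \<open>D powr ((1-s)/2)\<close>.\<close>

lemma I_int_difference_eq_tail:
  fixes s b a x :: real
  assumes s: "0 < s" "s < 1" and b: "0 < b" and x: "\<bar>x\<bar> < a"
  shows "(\<integral>\<^sup>+t\<in>{a<..}. ennreal (riesz_arcsine s t x * mass_rate s b t) \<partial>lborel) =
    ennreal (Beta ((1+s)/2) (1-s/2) * (I_int s b a a - I_int s b a x) /
       (2 * Beta ((1-s)/2) ((1+s)/2) * (a\<^sup>2 - x\<^sup>2) powr ((1-s)/2)))"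
proof -
  let ?B1 = "Beta ((1+s)/2) (1-s/2)" and ?B2 = "Beta ((1-s)/2) ((1+s)/2)"
  define D where "D = a\<^sup>2 - x\<^sup>2"
  define E where "E = a\<^sup>2 + b\<^sup>2"
  have D: "D > 0" using x unfolding D_def by (simp add: abs_square_less_1 flip: abs_le_square_iff not_le)
  have E: "E > 0" using b unfolding E_def by (simp add: add_nonneg_pos)
  have B2: "?B2 > 0" using s by (auto intro!: Beta_real_pos)
  define P where "P = (\<integral>\<^sup>+w\<in>{0<..}. ennreal ((w + D) powr ((s-1)/2) * (w + E) powr (-3/2)) \<partial>lborel)"
  define K where "K = (\<integral>\<^sup>+u\<in>{0<..}. ennreal (u powr (-(1+s)/2) * (u + E) powr (s/2-1) / (u + D)) \<partial>lborel)"
  have KP: "ennreal ?B1 * K = ennreal (D powr (-(1+s)/2) * ?B2) * P"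
    unfolding K_def P_def by (rule nn_integral_kernel_exchange[OF s D E])
  have IK: "ennreal (I_int s b a a - I_int s b a x) = ennreal D * K" and I0: "0 \<le> I_int s b a a - I_int s b a x"
    unfolding K_def D_def E_def using I_int_difference[OF s b x] by auto
  have "(\<integral>\<^sup>+t\<in>{a<..}. ennreal (riesz_arcsine s t x * mass_rate s b t) \<partial>lborel)
     = (\<integral>\<^sup>+v. ennreal (if a\<^sup>2 < v then (v - x\<^sup>2) powr ((s-1)/2) * (v + b\<^sup>2) powr (-3/2) / 2 else 0) \<partial>lborel)"
    by (rule nn_integral_arcsine_mixture_tail[OF s]) (use x in simp)
  also have "\<dots> = (\<integral>\<^sup>+w. ennreal (if a\<^sup>2 < a\<^sup>2 + w then (a\<^sup>2 + w - x\<^sup>2) powr ((s-1)/2) * (a\<^sup>2 + w + b\<^sup>2) powr (-3/2) / 2 else 0) \<partial>lborel)"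
    by (subst nn_integral_real_affine[of _ 1 "a\<^sup>2"]) (simp_all cong: if_cong)
  also have "\<dots> = (\<integral>\<^sup>+w. ennreal (1/2) * (ennreal ((w + D) powr ((s-1)/2) * (w + E) powr (-3/2)) * indicator {0<..} w) \<partial>lborel)"
  proof (intro nn_integral_cong)
    fix w :: real
    have e: "a\<^sup>2 + w - x\<^sup>2 = w + D" "a\<^sup>2 + w + b\<^sup>2 = w + E" by (simp_all add: D_def E_def)
    have h: "ennreal ((w + D) powr ((s-1)/2) * (w + E) powr (-3/2) / 2) = ennreal (1/2) * ennreal ((w + D) powr ((s-1)/2) * (w + E) powr (-3/2))"
      by (subst ennreal_mult'[symmetric]) simp_all
    show "ennreal (if a\<^sup>2 < a\<^sup>2 + w then (a\<^sup>2 + w - x\<^sup>2) powr ((s-1)/2) * (a\<^sup>2 + w + b\<^sup>2) powr (-3/2) / 2 else 0) =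
      ennreal (1/2) * (ennreal ((w + D) powr ((s-1)/2) * (w + E) powr (-3/2)) * indicator {0<..} w)"
      unfolding e using h by (cases "0 < w") simp_all
  qed
  also have "\<dots> = ennreal (1/2) * P" unfolding P_def by (rule nn_integral_cmult) auto
  also have "\<dots> = ennreal (?B1 / (2 * ?B2 * D powr ((1-s)/2))) * (ennreal D * K)"
  proof -
    have e: "D * (?B1 / (2 * ?B2 * D powr ((1-s)/2))) = D powr ((1+s)/2) / (2 * ?B2) * ?B1"
    proof -
      have "D / D powr ((1-s)/2) = D powr (1 - (1-s)/2)" using D by (simp add: powr_diff)
      also have "1 - (1-s)/2 = (1+s)/2" by (simp add: field_simps)
      finally have f: "D / D powr ((1-s)/2) = D powr ((1+s)/2)" .
      show ?thesis unfolding f[symmetric] by simp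
    qed
    have "ennreal (?B1 / (2 * ?B2 * D powr ((1-s)/2))) * (ennreal D * K) = ennreal (D * (?B1 / (2 * ?B2 * D powr ((1-s)/2)))) * K"
      unfolding ennreal_mult'[OF less_imp_le[OF D]] by (simp only: mult_ac)
    also have "\<dots> = ennreal (D powr ((1+s)/2) / (2 * ?B2)) * (ennreal ?B1 * K)"
      unfolding e using B2 by (subst ennreal_mult') (auto simp: mult.assoc)
    also have "\<dots> = ennreal (D powr ((1+s)/2) / (2 * ?B2) * (D powr (-(1+s)/2) * ?B2)) * P"
      unfolding KP using B2 by (subst ennreal_mult') (auto simp: mult.assoc)
    also have "D powr ((1+s)/2) / (2 * ?B2) * (D powr (-(1+s)/2) * ?B2) = 1/2"
    proof -
      have "D powr ((1+s)/2) * D powr (-(1+s)/2) = 1"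
        using D powr_add[of D "(1+s)/2" "-(1+s)/2"] by (simp add: add_divide_distrib[symmetric])
      then show ?thesis using B2 by (simp add: field_simps)
    qed
    finally show ?thesis by simp
  qed
  also have "\<dots> = ennreal (?B1 / (2 * ?B2 * D powr ((1-s)/2)) * (I_int s b a a - I_int s b a x))"
    unfolding IK[symmetric] using I0 by (rule ennreal_mult''[symmetric])
  finally show ?thesis by (simp add: D_def mult_ac)
qed

text \<open>The first term of \<open>eq_density\<close> is the full mixture and the second its tail
  beyond \<open>a\<close>. What is left is the truncated mixture, from which nonnegativity can be
  read off.\<close>

lemma eq_density_eq_mixture:
  fixes s q b a x :: real
  assumes s: "0 < s" "s < 1" and q: "0 \<le> q" and b: "0 < b" and x: "\<bar>x\<bar> < a"
  shows "0 \<le> eq_density s q b a x"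
    and "ennreal (eq_density s q b a x) = ennreal (rate_const s q b) *
      (\<integral>\<^sup>+t\<in>{0<..a}. ennreal (riesz_arcsine s t x * mass_rate s b t) \<partial>lborel)"
proof -
  let ?B1 = "Beta ((1+s)/2) (1-s/2)" and ?B2 = "Beta ((1+s)/2) ((1-s)/2)" and ?B3 = "Beta (1/2) ((1-s)/2)"
  have pos: "?B1 > 0" "?B2 > 0" "?B3 > 0" using s by (auto intro!: Beta_real_pos)
  have B2': "Beta ((1-s)/2) ((1+s)/2) = ?B2" by (rule Beta_commute)
  define R where "R = rate_const s q b"
  have R: "R \<ge> 0" unfolding R_def rate_const_def using q s
    by (intro divide_nonneg_nonneg mult_nonneg_nonneg less_imp_le[OF Beta_real_pos]) auto
  have RB: "R * ?B1 / 2 = q * b powr (1-s) / ?B3"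
    using rate_const_Beta[OF s, of q b] by (simp add: R_def)
  define J where "J = I_int s b a a - I_int s b a x"
  have J: "J \<ge> 0" using I_int_difference[OF s b x] by (simp add: J_def)
  define Dp where "Dp = (a\<^sup>2 - x\<^sup>2) powr ((1-s)/2)"
  have Dp: "Dp \<ge> 0" by (simp add: Dp_def)
  define M where "M A = (\<integral>\<^sup>+t\<in>A. ennreal (riesz_arcsine s t x * mass_rate s b t) \<partial>lborel)" for A
  define X where "X = (x\<^sup>2 + b\<^sup>2) powr (s/2-1)"
  have full: "M {0<..} = ennreal (?B1 * X / 2)"
    unfolding M_def X_def by (rule nn_integral_arcsine_mixture[OF s b])
  have tail: "M {a<..} = ennreal (?B1 * J / (2 * ?B2 * Dp))"
    unfolding M_def J_def Dp_def I_int_difference_eq_tail[OF s b x] B2' ..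
  have split: "M {0<..} = M {0<..a} + M {a<..}"
    unfolding M_def using x
    by (subst nn_integral_add[symmetric]) (auto intro!: nn_integral_cong simp: indicator_def)
  \<comment> \<open>Finiteness of the truncated part allows the tail to be subtracted in the
    reals.\<close>
  have "M {0<..a} \<le> M {0<..}" unfolding split by simp
  then obtain m where m: "0 \<le> m" "M {0<..a} = ennreal m"
    unfolding full by (metis ennreal_cases ennreal_less_top linorder_not_le top_greatest top.extremum_uniqueI ennreal_neq_top)
  have T0: "0 \<le> ?B1 * J / (2 * ?B2 * Dp)" using pos J Dp by simp
  have "?B1 * X / 2 = m + ?B1 * J / (2 * ?B2 * Dp)"
    using split m T0 pos unfolding full tail by (simp flip: ennreal_plus add: X_def)
  then have m_eq: "m = ?B1 * X / 2 - ?B1 * J / (2 * ?B2 * Dp)" by (simp only: eq_diff_eq)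
  have "eq_density s q b a x = q * b powr (1-s) / (?B3 * ?B2) * (?B2 * X - J / Dp)"
    unfolding eq_density_def J_def Dp_def X_def
    using powr_minus_divide[of "x\<^sup>2 + b\<^sup>2" "1 - s/2"] by simp
  also have "\<dots> = (q * b powr (1-s) / ?B3) * (X - J / (?B2 * Dp))"
    using pos by (simp add: field_simps)
  also have "\<dots> = R * m" unfolding m_eq RB[symmetric] using pos by (simp add: field_simps)
  finally have eq: "eq_density s q b a x = R * m" .
  then show "0 \<le> eq_density s q b a x" using R m by simp
  show "ennreal (eq_density s q b a x) = ennreal (rate_const s q b) *
      (\<integral>\<^sup>+t\<in>{0<..a}. ennreal (riesz_arcsine s t x * mass_rate s b t) \<partial>lborel)"
    unfolding eq M_def[symmetric] m(2) R_def[symmetric] using R by (simp add: ennreal_mult')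
qed

section \<open>Positive definiteness of the Riesz kernel\<close>

lemma AE_lborel_ex_between:
  fixes a b :: real
  assumes "AE z in lborel. Q z" "a < b"
  shows "\<exists>z. a < z \<and> z < b \<and> Q z"
proof (rule ccontr)
  assume "\<not> ?thesis"
  then have "AE z in lborel. z \<notin> {a<..<b}"
    using assms(1) by (auto elim!: eventually_mono)
  then have "emeasure lborel {a<..<b} = 0"
    by (subst (asm) AE_iff_measurable[of "{a<..<b}"]) (auto simp del: emeasure_lborel_Ioo)
  then show False using assms(2) by simp
qed

text \<open>Taylor's formula at infinity: the second derivative of \<open>r powr (-s)\<close> is
  \<open>s * (1+s) * r powr (-s-2)\<close>, and integrating it against the positive part of
  \<open>r - d\<close> returns \<open>d powr (-s)\<close>. The positive part is supplied by
  \<open>ennreal\<close>, which sends negative numbers to 0.\<close>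

lemma nn_integral_window_weight:
  fixes s d :: real
  assumes s: "0 < s" and d: "0 < d"
  shows "(\<integral>\<^sup>+r\<in>{0<..}. ennreal (r powr (-s-2)) * ennreal (r - d) \<partial>lborel) = ennreal (d powr (-s) / (s * (1+s)))"
proof -
  define F where "F r = d * (r powr (-s-1)) / (1+s) - r powr (-s) / s" for r
  define f where "f r = r powr (-s-2) * (r - d)" for r
  have "(\<integral>\<^sup>+r\<in>{0<..}. ennreal (r powr (-s-2)) * ennreal (r - d) \<partial>lborel) = (\<integral>\<^sup>+r\<in>{d..}. ennreal (f r) \<partial>lborel)"
    using d by (intro nn_integral_cong) (auto simp: f_def indicator_def ennreal_mult' ennreal_neg)
  also have "\<dots> = ennreal (0 - F d)"
  proof (rule nn_integral_FTC_atLeast)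
    show "f \<in> borel_measurable borel" unfolding f_def[abs_def] by measurable
  next
    fix r assume r: "d \<le> r"
    then have r0: "r > 0" using d by simp
    have e: "r powr (-s-1) = r powr (-s-2) * r"
    proof -
      have "r powr (-s-2) * r = r powr (-s-2) * r powr 1" using r0 by simp
      also have "\<dots> = r powr (-s-1)" unfolding powr_add[symmetric] by (rule arg_cong[where f="(powr) r"]) simp
      finally show ?thesis by simp
    qed
    have "(F has_real_derivative d * ((-s-1) * r powr (-s-1-1)) / (1+s) - (-s) * r powr (-s-1) / s) (at r)"
      unfolding F_def[abs_def] using r0 s by (auto intro!: derivative_eq_intros)
    also have "d * ((-s-1) * r powr (-s-1-1)) / (1+s) - (-s) * r powr (-s-1) / s = f r"
    proof -
      have "d * ((-s-1) * r powr (-s-1-1)) / (1+s) = - d * r powr (-s-2)"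
        using s by (simp add: field_simps)
      then show ?thesis using s by (simp add: f_def e algebra_simps)
    qed
    finally show "(F has_real_derivative f r) (at r)" .
    show "0 \<le> f r" using r by (simp add: f_def)
  next
    have "((\<lambda>r. r powr (-s-1)) \<longlongrightarrow> 0) at_top" "((\<lambda>r. r powr (-s)) \<longlongrightarrow> 0) at_top"
      using s by (intro tendsto_neg_powr filterlim_ident; simp)+
    then have "(F \<longlongrightarrow> d * 0 / (1+s) - 0 / s) at_top"
      unfolding F_def[abs_def] using s by (intro tendsto_intros) auto
    then show "(F \<longlongrightarrow> 0) at_top" by simp
  qed
  also have "0 - F d = d powr (-s) / (s * (1+s))"
  proof -
    have "d * d powr (-s-1) = d powr (-s)" using d by (simp add: powr_mult_base)
    then have "F d = d powr (-s) / (1+s) - d powr (-s) / s" by (simp add: F_def)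
    then show ?thesis using s by (simp add: field_simps)
  qed
  finally show ?thesis .
qed

text \<open>The pair holds the right endpoint and the length. The interval is open on the left and
  closed on the right, so that its mass is a difference of two cdf values.\<close>

definition window :: "real \<times> real \<Rightarrow> real \<Rightarrow> ennreal" where
  "window p x = (if fst p - snd p < x \<and> x \<le> fst p then 1 else 0)"

definition window_weight :: "real \<Rightarrow> real \<times> real \<Rightarrow> ennreal" where
  "window_weight s p = (if 0 < snd p then ennreal (s * (1+s) * snd p powr (-s-2)) else 0)"

text \<open>Slicing the Riesz kernel into products of interval indicators makes positive definiteness evident.\<close>

lemma riesz_kernel_eq_windows:
  fixes s x y :: real
  assumes s: "0 < s"
  shows "riesz_kernel s x y = (\<integral>\<^sup>+p. window_weight s p * (window p x * window p y) \<partial>(lborel \<Otimes>\<^sub>M lborel))"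
proof -
  have "(\<integral>\<^sup>+p. window_weight s p * (window p x * window p y) \<partial>(lborel \<Otimes>\<^sub>M lborel))
     = (\<integral>\<^sup>+r. (\<integral>\<^sup>+z. window_weight s (z, r) * (window (z, r) x * window (z, r) y) \<partial>lborel) \<partial>lborel)"
    by (rule lborel_pair.nn_integral_snd[symmetric]) (unfold window_weight_def window_def, measurable)
  also have "\<dots> = (\<integral>\<^sup>+r. ennreal (s * (1+s)) * ((ennreal (r powr (-s-2)) * ennreal (r - \<bar>x - y\<bar>)) * indicator {0<..} r) \<partial>lborel)"
  proof (intro nn_integral_cong)
    fix r :: real
    show "(\<integral>\<^sup>+z. window_weight s (z, r) * (window (z, r) x * window (z, r) y) \<partial>lborel)
       = ennreal (s * (1+s)) * ((ennreal (r powr (-s-2)) * ennreal (r - \<bar>x - y\<bar>)) * indicator {0<..} r)"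
    proof (cases "0 < r")
      case True
      \<comment> \<open>The window with right endpoint \<open>z\<close> contains both points exactly
        when \<open>max x y <= z < min x y + r\<close>.\<close>
      have "(\<integral>\<^sup>+z. window_weight s (z, r) * (window (z, r) x * window (z, r) y) \<partial>lborel)
        = (\<integral>\<^sup>+z. ennreal (s * (1+s) * r powr (-s-2)) * indicator {max x y ..< min x y + r} z \<partial>lborel)"
        using True by (intro nn_integral_cong) (auto simp: window_weight_def window_def indicator_def)
      also have "\<dots> = ennreal (s * (1+s) * r powr (-s-2)) * emeasure lborel {max x y ..< min x y + r}"
        by (subst nn_integral_cmult) auto
      also have "emeasure lborel {max x y ..< min x y + r} = ennreal (r - \<bar>x - y\<bar>)"
      proof (cases "max x y \<le> min x y + r")
        case True
        have "min x y + r - max x y = r - \<bar>x - y\<bar>" by (simp add: min_def max_def)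
        moreover have "emeasure lborel {max x y ..< min x y + r} = ennreal (min x y + r - max x y)"
          using True by (rule emeasure_lborel_Ico)
        ultimately show ?thesis by (simp only:)
      next
        case False
        then have "r - \<bar>x - y\<bar> \<le> 0" "{max x y ..< min x y + r} = {}" by auto
        then show ?thesis by (simp add: ennreal_neg)
      qed
      finally show ?thesis using True s by (simp add: ennreal_mult mult.assoc)
    qed (simp add: window_weight_def)
  qed
  also have "\<dots> = ennreal (s * (1+s)) * (\<integral>\<^sup>+r\<in>{0<..}. ennreal (r powr (-s-2)) * ennreal (r - \<bar>x - y\<bar>) \<partial>lborel)"
    by (rule nn_integral_cmult) auto
  also have "\<dots> = riesz_kernel s x y"
  proof (cases "x = y")
    case False
    then have "\<bar>x - y\<bar> > 0" by simp
    from nn_integral_window_weight[OF s this] show ?thesis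
      using False s by (simp add: riesz_kernel_def flip: ennreal_mult)
  next
    case True
    let ?I = "\<lambda>d. \<integral>\<^sup>+r\<in>{0<..}. ennreal (r powr (-s-2)) * ennreal (r - d) \<partial>lborel"
    \<comment> \<open>On the diagonal the kernel is infinite. Truncating at \<open>d > 0\<close>
      only lowers the integral, and for \<open>d powr (-s) = B\<close> the truncated value is
      already \<open>B\<close>; so no finite number bounds it.\<close>
    have *: "ennreal B \<le> ennreal (s * (1+s)) * ?I 0" if B: "B > 0" for B
    proof -
      define d where "d = B powr (-1/s)"
      have d: "d > 0" using B by (simp add: d_def)
      have "d powr (-s) = B" unfolding d_def powr_powr using s B by simp
      then have "ennreal B = ennreal (s * (1+s) * (d powr (-s) / (s * (1+s))))" using s by simp
      also have "\<dots> = ennreal (s * (1+s)) * ?I d"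
        unfolding nn_integral_window_weight[OF s d] using s by (intro ennreal_mult) auto
      also have "\<dots> \<le> ennreal (s * (1+s)) * ?I 0"
        using d by (intro mult_left_mono nn_integral_mono mult_right_mono ennreal_leI) auto
      finally show ?thesis .
    qed
    have "ennreal (s * (1+s)) * ?I 0 = \<infinity>"
    proof (rule ccontr)
      assume "ennreal (s * (1+s)) * ?I 0 \<noteq> \<infinity>"
      then obtain r where r: "0 \<le> r" "ennreal (s * (1+s)) * ?I 0 = ennreal r"
        by (cases "ennreal (s * (1+s)) * ?I 0") auto
      then show False using * [of "r + 1"] by (simp add: ennreal_le_iff del: ennreal_plus)
    qed
    then show ?thesis using True by (simp add: riesz_kernel_def)
  qed
  finally show ?thesis by simp
qed

lemma window_measurable [measurable]:
  assumes [measurable]: "f \<in> M \<rightarrow>\<^sub>M (borel \<Otimes>\<^sub>M borel)" "g \<in> borel_measurable M"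
  shows "(\<lambda>z. window (f z) (g z)) \<in> borel_measurable M"
  unfolding window_def by measurable

lemma window_measurable_snd [measurable]: "window p \<in> borel_measurable borel"
  unfolding window_def[abs_def] by measurable

lemma window_weight_measurable [measurable]: "window_weight s \<in> borel_measurable (borel \<Otimes>\<^sub>M borel)"
  unfolding window_weight_def[abs_def] by measurable

lemma nn_integral_window:
  assumes "sets M = sets borel"
  shows "(\<integral>\<^sup>+x. window p x \<partial>M) = emeasure M {fst p - snd p<..fst p}"
proof -
  have "(\<integral>\<^sup>+x. window p x \<partial>M) = (\<integral>\<^sup>+x. indicator {fst p - snd p<..fst p} x \<partial>M)"
    by (intro nn_integral_cong) (auto simp: window_def)
  also have "\<dots> = emeasure M {fst p - snd p<..fst p}" using assms by simp
  finally show ?thesis .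
qed

text \<open>Tonelli after slicing: the mutual energy is a weighted L2 pairing of window masses, so
  positivity reduces to that of squares.\<close>

lemma mutual_energy_eq_windows:
  fixes M N :: "real measure"
  assumes s: "0 < s" and "borel_prob M" "borel_prob N"
  shows "(\<integral>\<^sup>+x. (\<integral>\<^sup>+y. riesz_kernel s x y \<partial>N) \<partial>M) =
    (\<integral>\<^sup>+p. window_weight s p * (emeasure M {fst p - snd p<..fst p} * emeasure N {fst p - snd p<..fst p}) \<partial>(lborel \<Otimes>\<^sub>M lborel))"
proof -
  interpret M: prob_space M using assms by (simp add: borel_prob_def)
  interpret N: prob_space N using assms by (simp add: borel_prob_def)
  have sM [measurable_cong]: "sets M = sets borel" and sN [measurable_cong]: "sets N = sets borel" using assms by (simp_all add: borel_prob_def)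
  interpret P: sigma_finite_measure "lborel \<Otimes>\<^sub>M lborel :: (real \<times> real) measure"
    by (simp add: lborel_prod sigma_finite_lborel)
  interpret NP: pair_sigma_finite N "lborel \<Otimes>\<^sub>M lborel :: (real \<times> real) measure" ..
  interpret MP: pair_sigma_finite M "lborel \<Otimes>\<^sub>M lborel :: (real \<times> real) measure" ..
  have "(\<integral>\<^sup>+x. (\<integral>\<^sup>+y. riesz_kernel s x y \<partial>N) \<partial>M)
    = (\<integral>\<^sup>+x. (\<integral>\<^sup>+y. (\<integral>\<^sup>+p. window_weight s p * (window p x * window p y) \<partial>(lborel \<Otimes>\<^sub>M lborel)) \<partial>N) \<partial>M)"
    by (simp only: riesz_kernel_eq_windows[OF s])
  also have "\<dots> = (\<integral>\<^sup>+x. (\<integral>\<^sup>+p. (\<integral>\<^sup>+y. window_weight s p * (window p x * window p y) \<partial>N) \<partial>(lborel \<Otimes>\<^sub>M lborel)) \<partial>M)"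
    by (intro nn_integral_cong NP.Fubini'[symmetric]) measurable
  also have "\<dots> = (\<integral>\<^sup>+x. (\<integral>\<^sup>+p. (window_weight s p * emeasure N {fst p - snd p<..fst p}) * window p x \<partial>(lborel \<Otimes>\<^sub>M lborel)) \<partial>M)"
  proof (intro nn_integral_cong)
    fix x p
    have "(\<integral>\<^sup>+y. window_weight s p * (window p x * window p y) \<partial>N) = (\<integral>\<^sup>+y. (window_weight s p * window p x) * window p y \<partial>N)"
      by (simp add: mult.assoc)
    also have "\<dots> = (window_weight s p * window p x) * emeasure N {fst p - snd p<..fst p}"
      by (subst nn_integral_cmult, measurable) (simp add: nn_integral_window[OF sN])
    finally show "(\<integral>\<^sup>+y. window_weight s p * (window p x * window p y) \<partial>N) = (window_weight s p * emeasure N {fst p - snd p<..fst p}) * window p x"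
      by (simp add: mult_ac)
  qed
  also have "\<dots> = (\<integral>\<^sup>+p. (\<integral>\<^sup>+x. (window_weight s p * emeasure N {fst p - snd p<..fst p}) * window p x \<partial>M) \<partial>(lborel \<Otimes>\<^sub>M lborel))"
  proof (intro MP.Fubini'[symmetric])
    have "(\<lambda>p. \<integral>\<^sup>+y. window p y \<partial>N) \<in> borel_measurable (borel \<Otimes>\<^sub>M borel)" by measurable
    then have [measurable]: "(\<lambda>p. emeasure N {fst p - snd p<..fst p}) \<in> borel_measurable (borel \<Otimes>\<^sub>M borel)"
      by (simp add: nn_integral_window[OF sN])
    show "(\<lambda>(x, p). window_weight s p * emeasure N {fst p - snd p<..fst p} * window p x) \<in> borel_measurable (M \<Otimes>\<^sub>M (lborel \<Otimes>\<^sub>M lborel))"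
      by measurable
  qed
  also have "\<dots> = (\<integral>\<^sup>+p. window_weight s p * (emeasure M {fst p - snd p<..fst p} * emeasure N {fst p - snd p<..fst p}) \<partial>(lborel \<Otimes>\<^sub>M lborel))"
  proof (intro nn_integral_cong)
    fix p
    show "(\<integral>\<^sup>+x. (window_weight s p * emeasure N {fst p - snd p<..fst p}) * window p x \<partial>M) =
      window_weight s p * (emeasure M {fst p - snd p<..fst p} * emeasure N {fst p - snd p<..fst p})"
      by (subst nn_integral_cmult, measurable) (simp add: nn_integral_window[OF sM] mult_ac)
  qed
  finally show ?thesis .
qed

text \<open>The two self-energies exceed twice the mutual energy by the weighted integral of squared
  differences of window masses, and the hypothesis forces this excess to vanish. Almost all windows
  then have equal mass; letting their length grow gives equal cdfs almost everywhere, and right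
  continuity extends this to every point.\<close>

lemma mutual_energy_strict:
  fixes M N :: "real measure"
  assumes s: "0 < s" and M: "borel_prob M" and N: "borel_prob N"
    and finM: "(\<integral>\<^sup>+x. (\<integral>\<^sup>+y. riesz_kernel s x y \<partial>M) \<partial>M) < \<infinity>"
    and finN: "(\<integral>\<^sup>+x. (\<integral>\<^sup>+y. riesz_kernel s x y \<partial>N) \<partial>N) < \<infinity>"
    and le: "(\<integral>\<^sup>+x. (\<integral>\<^sup>+y. riesz_kernel s x y \<partial>M) \<partial>M) + (\<integral>\<^sup>+x. (\<integral>\<^sup>+y. riesz_kernel s x y \<partial>N) \<partial>N)
      \<le> 2 * (\<integral>\<^sup>+x. (\<integral>\<^sup>+y. riesz_kernel s x y \<partial>N) \<partial>M)"
  shows "M = N"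
proof -
  interpret M: prob_space M using assms by (simp add: borel_prob_def)
  interpret N: prob_space N using assms by (simp add: borel_prob_def)
  have sM [measurable_cong]: "sets M = sets borel" and sN [measurable_cong]: "sets N = sets borel" using assms by (simp_all add: borel_prob_def)
  interpret RM: real_distribution M by standard (rule sM)
  interpret RN: real_distribution N by standard (rule sN)
  define u where "u p = measure M {fst p - snd p<..fst p}" for p :: "real \<times> real"
  define v where "v p = measure N {fst p - snd p<..fst p}" for p :: "real \<times> real"
  have uv: "0 \<le> u p" "0 \<le> v p" for p by (simp_all add: u_def v_def)
  have emu: "emeasure M {fst p - snd p<..fst p} = ennreal (u p)" "emeasure N {fst p - snd p<..fst p} = ennreal (v p)" for p
    by (simp_all add: u_def v_def M.emeasure_eq_measure N.emeasure_eq_measure)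
  \<comment> \<open>Measurability in the window parameters comes from writing the window mass as an
    integral of a jointly measurable indicator.\<close>
  have "(\<lambda>p. enn2real (\<integral>\<^sup>+y. window p y \<partial>N)) \<in> borel_measurable (borel \<Otimes>\<^sub>M borel)"
    "(\<lambda>p. enn2real (\<integral>\<^sup>+y. window p y \<partial>M)) \<in> borel_measurable (borel \<Otimes>\<^sub>M borel)" by measurable
  then have [measurable]: "u \<in> borel_measurable (borel \<Otimes>\<^sub>M borel)" "v \<in> borel_measurable (borel \<Otimes>\<^sub>M borel)"
    by (simp_all add: nn_integral_window[OF sN] nn_integral_window[OF sM] emu uv)
  let ?P = "lborel \<Otimes>\<^sub>M lborel :: (real \<times> real) measure"
  let ?w = "window_weight s"
  define D where "D = (\<integral>\<^sup>+p. ?w p * ennreal ((u p - v p)\<^sup>2) \<partial>?P)"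
  define A where "A = (\<integral>\<^sup>+x. (\<integral>\<^sup>+y. riesz_kernel s x y \<partial>N) \<partial>M)"
  define EM where "EM = (\<integral>\<^sup>+x. (\<integral>\<^sup>+y. riesz_kernel s x y \<partial>M) \<partial>M)"
  define EN where "EN = (\<integral>\<^sup>+x. (\<integral>\<^sup>+y. riesz_kernel s x y \<partial>N) \<partial>N)"
  have "EM + EN = (\<integral>\<^sup>+p. ?w p * (ennreal (u p) * ennreal (u p)) + ?w p * (ennreal (v p) * ennreal (v p)) \<partial>?P)"
    unfolding EM_def EN_def mutual_energy_eq_windows[OF s M M] mutual_energy_eq_windows[OF s N N] emu
    by (rule nn_integral_add[symmetric]) measurable
  also have "\<dots> = (\<integral>\<^sup>+p. 2 * (?w p * (ennreal (u p) * ennreal (v p))) + ?w p * ennreal ((u p - v p)\<^sup>2) \<partial>?P)"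
  proof (intro nn_integral_cong)
    fix p
    have "ennreal (u p) * ennreal (u p) + ennreal (v p) * ennreal (v p) = ennreal (u p * u p + v p * v p)"
      using uv by (simp add: ennreal_mult)
    also have "u p * u p + v p * v p = 2 * (u p * v p) + (u p - v p)\<^sup>2" by (simp add: power2_eq_square algebra_simps)
    also have "ennreal \<dots> = 2 * (ennreal (u p) * ennreal (v p)) + ennreal ((u p - v p)\<^sup>2)"
      using uv by (simp add: ennreal_mult ennreal_plus)
    finally show "?w p * (ennreal (u p) * ennreal (u p)) + ?w p * (ennreal (v p) * ennreal (v p)) = 2 * (?w p * (ennreal (u p) * ennreal (v p))) + ?w p * ennreal ((u p - v p)\<^sup>2)"
      by (simp only: distrib_left[symmetric]) (simp add: distrib_left mult.left_commute)
  qed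
  also have "\<dots> = (\<integral>\<^sup>+p. 2 * (?w p * (ennreal (u p) * ennreal (v p))) \<partial>?P) + D"
    unfolding D_def by (rule nn_integral_add) measurable
  also have "(\<integral>\<^sup>+p. 2 * (?w p * (ennreal (u p) * ennreal (v p))) \<partial>?P) = 2 * A"
    unfolding A_def mutual_energy_eq_windows[OF s M N] emu by (rule nn_integral_cmult) measurable
  finally have eq: "EM + EN = 2 * A + D" .
  have fin: "EM + EN < \<infinity>" using finM finN by (simp add: EM_def EN_def)
  then have "2 * A < \<infinity>" "D < \<infinity>" unfolding eq by (auto simp: ennreal_add_eq_top less_top)
  moreover have "2 * A + D \<le> 2 * A" using le eq by (simp add: A_def EM_def EN_def)
  \<comment> \<open>Cancelling \<open>2 * A\<close> in \<open>ennreal\<close> relies on its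
    finiteness.\<close>
  ultimately have "D = 0"
    by (metis add.right_neutral antisym ennreal_add_left_cancel infinity_ennreal_def less_irrefl le_iff_add add_left_mono zero_le)
  then have "AE p in ?P. ?w p * ennreal ((u p - v p)\<^sup>2) = 0"
    unfolding D_def by (subst (asm) nn_integral_0_iff_AE) measurable
  then have "AE p in ?P. 0 < snd p \<longrightarrow> u p = v p"
  proof (rule eventually_mono)
    fix p assume p: "?w p * ennreal ((u p - v p)\<^sup>2) = 0"
    show "0 < snd p \<longrightarrow> u p = v p"
    proof
      assume "0 < snd p"
      then have "?w p \<noteq> 0" using s by (simp add: window_weight_def)
      then have "ennreal ((u p - v p)\<^sup>2) = 0" using p by simp
      then show "u p = v p" by simp
    qed
  qed
  from lborel_pair.AE_pair[OF this]
  have ae: "AE z in lborel. AE r in lborel. 0 < r \<longrightarrow> u (z, r) = v (z, r)" by simp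
  have "AE z in lborel. cdf M z = cdf N z"
    using ae
  proof (rule eventually_mono)
    fix z assume z: "AE r in lborel. 0 < r \<longrightarrow> u (z, r) = v (z, r)"
    \<comment> \<open>Agreement holds for almost every length, so lengths tending to infinity are
      picked from the intervals between \<open>n\<close> and \<open>n + 1\<close>.\<close>
    have "\<exists>r. real n < r \<and> u (z, r) = v (z, r)" for n
      using AE_lborel_ex_between[OF z, of "real n" "real n + 1"] by force
    then obtain r where r: "\<And>n. real n < r n" "\<And>n. u (z, r n) = v (z, r n)" by metis
    have "filterlim r at_top sequentially"
      by (rule filterlim_at_top_mono[OF filterlim_real_sequentially]) (auto intro!: always_eventually less_imp_le r)
    then have lim: "filterlim (\<lambda>n. z - r n) at_bot sequentially"
      unfolding filterlim_uminus_at_bot using filterlim_tendsto_add_at_top[OF tendsto_const[of "-z"]]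
      by simp
    have "cdf M z - cdf M (z - r n) = cdf N z - cdf N (z - r n)" for n
    proof -
      have "z - r n < z" using r(1)[of n] by (smt (verit) of_nat_0_le_iff)
      then show ?thesis using r(2)[of n] by (simp add: RM.cdf_diff_eq RN.cdf_diff_eq u_def v_def)
    qed
    moreover have "(\<lambda>n. cdf M z - cdf M (z - r n)) \<longlonglongrightarrow> cdf M z - 0"
      by (intro tendsto_intros filterlim_compose[OF RM.cdf_lim_at_bot lim])
    moreover have "(\<lambda>n. cdf N z - cdf N (z - r n)) \<longlonglongrightarrow> cdf N z - 0"
      by (intro tendsto_intros filterlim_compose[OF RN.cdf_lim_at_bot lim])
    ultimately show "cdf M z = cdf N z" using LIMSEQ_unique by fastforce
  qed
  note dense = AE_lborel_ex_between[OF this]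
  have "cdf M z = cdf N z" for z
  proof -
    \<comment> \<open>Points of agreement are dense, so a sequence of them tends to \<open>z\<close>
      from the right, the side on which cdfs are continuous.\<close>
    have "\<exists>y. z < y \<and> y < z + 1 / real (Suc n) \<and> cdf M y = cdf N y" for n
      by (rule dense) simp
    then obtain y where y: "\<And>n. z < y n" "\<And>n. y n < z + 1 / real (Suc n)" "\<And>n. cdf M (y n) = cdf N (y n)" by metis
    have "(\<lambda>n. z + 1 / real (Suc n)) \<longlonglongrightarrow> z + 0"
      by (intro tendsto_intros LIMSEQ_inverse_real_of_nat[unfolded inverse_eq_divide])
    then have "y \<longlonglongrightarrow> z"
      using y by (intro tendsto_sandwich[of "\<lambda>_. z" y sequentially "\<lambda>n. z + 1 / real (Suc n)"])
        (auto intro!: always_eventually less_imp_le)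
    then have lim: "filterlim y (at_right z) sequentially"
      using y by (auto simp: filterlim_at intro!: always_eventually)
    have "(\<lambda>n. cdf M (y n)) \<longlonglongrightarrow> cdf M z" "(\<lambda>n. cdf N (y n)) \<longlonglongrightarrow> cdf N z"
      using RM.cdf_is_right_cont[of z] RN.cdf_is_right_cont[of z] unfolding continuous_within
      by (auto intro: filterlim_compose[OF _ lim])
    then show ?thesis using y(3) LIMSEQ_unique by fastforce
  qed
  then show ?thesis by (intro cdf_unique) (unfold_locales, auto)
qed

section \<open>Critical points of the Mhaskar--Saff functional\<close>

lemma pochhammer_series_sums:
  fixes \<beta> z :: real
  assumes "\<bar>z\<bar> < 1"
  shows "(\<lambda>n. pochhammer \<beta> n / fact n * z ^ n) sums (1 - z) powr (-\<beta>)"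
proof -
  have "(\<lambda>n. ((-\<beta>) gchoose n) * (-z) ^ n) sums (1 + (-z)) powr (-\<beta>)"
    using assms by (intro gen_binomial_real) simp
  moreover have "((-\<beta>) gchoose n) * (-z) ^ n = pochhammer \<beta> n / fact n * z ^ n" for n
    by (simp add: gbinomial_pochhammer flip: power_mult_distrib mult.assoc)
  ultimately show ?thesis by simp
qed

text \<open>Because \<open>pochhammer c n / pochhammer (c+1) n = c / (c + n)\<close>, the operator
  \<open>z * d/dz + c\<close> multiplies the n-th coefficient by \<open>c + n\<close> and leaves
  \<open>c\<close> times a binomial series.\<close>

lemma hyp2F1_has_derivative:
  fixes c \<beta> z :: real
  assumes c: "0 < c" and \<beta>: "0 < \<beta>" and z: "\<bar>z\<bar> < 1"
  obtains d where "(hyp2F1 c \<beta> (c+1) has_real_derivative d) (at z)"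
    and "z * d + c * hyp2F1 c \<beta> (c+1) z = c * (1 - z) powr (-\<beta>)"
proof -
  define a where "a n = pochhammer c n * pochhammer \<beta> n / (pochhammer (c+1) n * fact n)" for n
  have hyp: "hyp2F1 c \<beta> (c+1) = (\<lambda>z. \<Sum>n. a n * z ^ n)"
    by (simp add: hyp2F1_def[abs_def] a_def)
  have ca: "(c + real n) * a n = c * (pochhammer \<beta> n / fact n)" for n
  proof -
    have "pochhammer c n * (c + real n) = c * pochhammer (c+1) n"
      using pochhammer_rec[of c n] by (simp add: pochhammer_Suc)
    moreover have "pochhammer (c+1) n > 0" using c by (intro pochhammer_pos) simp
    ultimately show ?thesis by (simp add: a_def field_simps)
  qed
  have a_le: "norm (a n) \<le> pochhammer \<beta> n / fact n" for n
  proof -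
    have p: "pochhammer \<beta> n / fact n \<ge> 0" using \<beta> by (simp add: pochhammer_nonneg)
    have "a n = c / (c + real n) * (pochhammer \<beta> n / fact n)"
    proof -
      have "c + real n > 0" using c by simp
      then have "a n = (c + real n) * a n / (c + real n)" by simp
      then show ?thesis unfolding ca by simp
    qed
    then have "norm (a n) = c / (c + real n) * (pochhammer \<beta> n / fact n)"
      using c p by (simp only: real_norm_def abs_mult abs_of_nonneg) simp
    also have "\<dots> \<le> pochhammer \<beta> n / fact n"
      using p c by (intro mult_left_le_one_le) auto
    finally show ?thesis .
  qed
  have summ: "summable (\<lambda>n. a n * x ^ n)" if "norm x < 1" for x
  proof (rule summable_comparison_test')
    show "summable (\<lambda>n. pochhammer \<beta> n / fact n * \<bar>x\<bar> ^ n)"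
      using pochhammer_series_sums[of "\<bar>x\<bar>" \<beta>] that by (auto intro: sums_summable)
    show "norm (a n * x ^ n) \<le> pochhammer \<beta> n / fact n * \<bar>x\<bar> ^ n" for n
      using mult_right_mono[OF a_le[of n], of "\<bar>x\<bar> ^ n"] by (simp add: abs_mult power_abs)
  qed
  define d where "d = (\<Sum>n. diffs a n * z ^ n)"
  have "(hyp2F1 c \<beta> (c+1) has_real_derivative d) (at z)"
    unfolding hyp d_def by (rule termdiffs_strong'[of 1]) (use summ z in auto)
  moreover have "z * d + c * hyp2F1 c \<beta> (c+1) z = c * (1 - z) powr (-\<beta>)"
  proof -
    have "summable (\<lambda>n. diffs a n * z ^ n)"
      by (rule termdiff_converges[of z 1]) (use summ z in auto)
    from diffs_equiv[OF this] have "(\<lambda>n. real n * a n * z ^ (n - Suc 0)) sums d" by (simp add: d_def)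
    from sums_mult[OF this, of z] have "(\<lambda>n. z * (real n * a n * z ^ (n - Suc 0))) sums (z * d)" .
    moreover have "z * (real n * a n * z ^ (n - Suc 0)) = real n * a n * z ^ n" for n
      by (cases n) simp_all
    ultimately have 1: "(\<lambda>n. real n * a n * z ^ n) sums (z * d)" by simp
    have 2: "(\<lambda>n. c * (a n * z ^ n)) sums (c * hyp2F1 c \<beta> (c+1) z)"
      unfolding hyp using summ z by (intro sums_mult summable_sums) auto
    have "real n * a n * z ^ n + c * (a n * z ^ n) = c * (pochhammer \<beta> n / fact n * z ^ n)" for n
    proof -
      have "real n * a n * z ^ n + c * (a n * z ^ n) = (c + real n) * a n * z ^ n" by (simp add: algebra_simps)
      then show ?thesis unfolding ca by simp
    qed
    then have "(\<lambda>n. c * (pochhammer \<beta> n / fact n * z ^ n)) sums (z * d + c * hyp2F1 c \<beta> (c+1) z)"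
      using sums_add[OF 1 2] by simp
    moreover have "(\<lambda>n. c * (pochhammer \<beta> n / fact n * z ^ n)) sums (c * (1 - z) powr (-\<beta>))"
      using z by (intro sums_mult pochhammer_series_sums)
    ultimately show ?thesis by (rule sums_unique2)
  qed
  ultimately show ?thesis by (rule that)
qed

definition hyp_part :: "real \<Rightarrow> real \<Rightarrow> real \<Rightarrow> real" where
  "hyp_part s b a = (a / sqrt (a\<^sup>2 + b\<^sup>2)) powr s
     * hyp2F1 (s / 2) ((1 + s) / 2) (1 + s / 2) (a\<^sup>2 / (a\<^sup>2 + b\<^sup>2))"

text \<open>A primitive of the mass rate, up to the factor \<open>b powr (1 - s)\<close>; it is the combination
  \<open>g - a g' / s\<close> (\<open>g\<close> the hypergeometric part of \<open>F_s\<close>) that appears in the derivative of \<open>F_s\<close>.\<close>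

definition mass_primitive :: "real \<Rightarrow> real \<Rightarrow> real \<Rightarrow> real" where
  "mass_primitive s b a = hyp_part s b a - a powr s * b powr (1-s) * (a\<^sup>2 + b\<^sup>2) powr (-1/2)"

text \<open>With \<open>z = a^2 / (a^2 + b^2)\<close> and \<open>H\<close> the series, the function
  is \<open>z powr (s/2) * H z\<close>, and its derivative in \<open>z\<close> is
  \<open>z powr (s/2-1) * (z * H' + s/2 * H)\<close>. This is the combination in which the series
  collapses to a multiple of \<open>(1-z) powr (-((1+s)/2))\<close>, so the result is
  elementary.\<close>

lemma hyp_part_deriv:
  assumes s: "0 < s" "s < 1" and b: "0 < b" and a: "0 < a"
  shows "(hyp_part s b has_real_derivative s * a powr (s-1) * b powr (1-s) * (a\<^sup>2 + b\<^sup>2) powr (-1/2)) (at a)"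
proof -
  define N where "N = a\<^sup>2 + b\<^sup>2"
  have N: "N > 0" using a b by (simp add: N_def add_pos_pos)
  define z where "z = a\<^sup>2 / N"
  have z: "0 < z" "z < 1" using a b N by (auto simp: z_def N_def)
  have z1: "1 - z = b\<^sup>2 / N"
  proof -
    have "1 - z = (N - a\<^sup>2) / N" using N by (simp add: z_def diff_divide_distrib)
    then show ?thesis by (simp add: N_def)
  qed
  let ?H = "hyp2F1 (s/2) ((1+s)/2) (s/2+1)"
  obtain d where d: "(?H has_real_derivative d) (at z)"
      "z * d + s/2 * ?H z = s/2 * (1 - z) powr (-((1+s)/2))"
    using hyp2F1_has_derivative[of "s/2" "(1+s)/2" z] s z by auto
  have "((\<lambda>z. z powr (s/2) * ?H z) has_real_derivative (s/2 * z powr (s/2-1)) * ?H z + d * z powr (s/2)) (at z)"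
    using z d(1) by (auto intro!: derivative_eq_intros)
  also have "(s/2 * z powr (s/2-1)) * ?H z + d * z powr (s/2) = z powr (s/2-1) * (z * d + s/2 * ?H z)"
  proof -
    have "z powr (s/2) = z * z powr (s/2-1)" using z by (simp add: powr_mult_base)
    then show ?thesis by (simp add: algebra_simps)
  qed
  finally have G: "((\<lambda>z. z powr (s/2) * ?H z) has_real_derivative z powr (s/2-1) * (s/2 * (1 - z) powr (-((1+s)/2)))) (at z)"
    unfolding d(2) .
  have Z: "((\<lambda>a. a\<^sup>2 / (a\<^sup>2 + b\<^sup>2)) has_real_derivative 2 * a * b\<^sup>2 / N\<^sup>2) (at a)"
    using N unfolding N_def by (auto intro!: derivative_eq_intros simp: power2_eq_square field_simps)
  have "((\<lambda>a. (a\<^sup>2 / (a\<^sup>2 + b\<^sup>2)) powr (s/2) * ?H (a\<^sup>2 / (a\<^sup>2 + b\<^sup>2))) has_real_derivative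
      z powr (s/2-1) * (s/2 * (1 - z) powr (-((1+s)/2))) * (2 * a * b\<^sup>2 / N\<^sup>2)) (at a)"
    using DERIV_chain2[OF G[unfolded z_def N_def] Z[unfolded N_def]] by (simp only: z_def N_def)
  also have "z powr (s/2-1) * (s/2 * (1 - z) powr (-((1+s)/2))) * (2 * a * b\<^sup>2 / N\<^sup>2) = s * a powr (s-1) * b powr (1-s) * N powr (-1/2)"
  proof -
    have e1: "z powr (s/2-1) = a powr (s-2) / N powr (s/2-1)"
      using power2_powr_half[of a "s-2"] a N by (simp add: z_def powr_divide diff_divide_distrib)
    have e2: "(1-z) powr (-((1+s)/2)) = b powr (-1-s) / N powr (-((1+s)/2))"
      using power2_powr_half[of b "-1-s"] b N unfolding z1 by (simp add: powr_divide minus_divide_left)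
    have "z powr (s/2-1) * (s/2 * (1 - z) powr (-((1+s)/2))) * (2 * a * b\<^sup>2 / N\<^sup>2)
       = s * (a * a powr (s-2)) * (b\<^sup>2 * b powr (-1-s)) / (N powr (s/2-1) * N powr (-((1+s)/2)) * N\<^sup>2)"
      unfolding e1 e2 by (simp add: mult_ac)
    also have "a * a powr (s-2) = a powr (s-1)" using a by (simp add: powr_mult_base)
    also have "b\<^sup>2 * b powr (-1-s) = b powr (1-s)" using b by (simp flip: powr_numeral powr_add)
    also have "N powr (s/2-1) * N powr (-((1+s)/2)) * N\<^sup>2 = N powr (1/2)"
    proof -
      have "N powr (s/2-1) * N powr (-((1+s)/2)) * N\<^sup>2 = N powr (s/2-1 + -((1+s)/2) + 2)"
        unfolding powr_add using N by simp
      also have "s/2-1 + -((1+s)/2) + 2 = 1/2" by (simp add: field_simps)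
      finally show ?thesis .
    qed
    finally show ?thesis by (simp add: powr_minus_divide)
  qed
  finally have main: "((\<lambda>a. (a\<^sup>2 / (a\<^sup>2 + b\<^sup>2)) powr (s/2) * ?H (a\<^sup>2 / (a\<^sup>2 + b\<^sup>2))) has_real_derivative
      s * a powr (s-1) * b powr (1-s) * N powr (-1/2)) (at a)" .
  \<comment> \<open>Replacing the square by the base inside \<open>powr\<close> uses a nonnegative
    base, so agreement is stated on the open half-line; this suffices for the derivative at
    \<open>a > 0\<close>.\<close>
  have eq: "(y\<^sup>2 / (y\<^sup>2 + b\<^sup>2)) powr (s/2) * ?H (y\<^sup>2 / (y\<^sup>2 + b\<^sup>2)) = hyp_part s b y" if "y \<in> {0<..}" for y
  proof -
    have "y\<^sup>2 + b\<^sup>2 > 0" using b by (simp add: add_nonneg_pos)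
    then have "y\<^sup>2 / (y\<^sup>2 + b\<^sup>2) = (y / sqrt (y\<^sup>2 + b\<^sup>2))\<^sup>2" by (simp add: power_divide)
    moreover have "((y / sqrt (y\<^sup>2 + b\<^sup>2))\<^sup>2) powr (s/2) = (y / sqrt (y\<^sup>2 + b\<^sup>2)) powr s"
      using that by (simp only: power2_powr_half) simp
    ultimately show ?thesis unfolding hyp_part_def by (simp add: add.commute)
  qed
  show ?thesis
    using has_field_derivative_transform_within_open[OF main, of "{0<..}" "hyp_part s b"] a eq
    by (simp add: N_def)
qed

text \<open>Differentiating \<open>a powr s\<close> in the subtracted term reproduces the derivative
  of \<open>hyp_part\<close>. Only the derivative of \<open>(a^2 + b^2) powr (-1/2)\<close>
  survives, and there the exponent \<open>-3/2\<close> appears.\<close>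

lemma mass_primitive_deriv:
  assumes s: "0 < s" "s < 1" and b: "0 < b" and a: "0 < a"
  shows "(mass_primitive s b has_real_derivative b powr (1-s) * mass_rate s b a) (at a)"
proof -
  define N where "N = a\<^sup>2 + b\<^sup>2"
  have N: "N > 0" using a b by (simp add: N_def add_pos_pos)
  have "((\<lambda>a. a powr s * b powr (1-s) * (a\<^sup>2 + b\<^sup>2) powr (-1/2)) has_real_derivative
      (s * a powr (s-1)) * b powr (1-s) * N powr (-1/2) + a powr s * b powr (1-s) * ((-1/2) * N powr (-1/2-1) * (2 * a))) (at a)"
    using a N unfolding N_def by (auto intro!: derivative_eq_intros)
  from DERIV_diff[OF hyp_part_deriv[OF s b a] this]
  have "(mass_primitive s b has_real_derivative - (a powr s * b powr (1-s) * ((-1/2) * N powr (-1/2-1) * (2 * a)))) (at a)"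
    unfolding mass_primitive_def[abs_def] by (simp add: N_def)
  also have "- (a powr s * b powr (1-s) * ((-1/2) * N powr (-1/2-1) * (2 * a))) = b powr (1-s) * mass_rate s b a"
  proof -
    have "a powr s * a = a powr (1+s)" using a by (simp add: powr_add)
    then show ?thesis by (simp add: mass_rate_def N_def)
  qed
  finally show ?thesis .
qed

text \<open>Fixes the constant of integration: the primitive counts mass starting from radius
  0.\<close>

lemma mass_primitive_tendsto_0:
  assumes s: "0 < s" "s < 1" and b: "0 < b"
  shows "(mass_primitive s b \<longlongrightarrow> 0) (at_right 0)"
proof -
  let ?H = "hyp2F1 (s/2) ((1+s)/2) (1+s/2)"
  have "isCont ?H 0"
    using hyp2F1_has_derivative[of "s/2" "(1+s)/2" 0] s by (metis DERIV_isCont abs_zero add.commute half_gt_zero zero_less_one add_pos_pos)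
  moreover have "((\<lambda>a. a\<^sup>2 / (a\<^sup>2 + b\<^sup>2)) \<longlongrightarrow> 0\<^sup>2 / (0\<^sup>2 + b\<^sup>2)) (at_right 0)"
    using b by (intro tendsto_intros) auto
  ultimately have H: "((\<lambda>a. ?H (a\<^sup>2 / (a\<^sup>2 + b\<^sup>2))) \<longlongrightarrow> ?H 0) (at_right 0)"
    by (intro isCont_tendsto_compose[of 0 ?H]) auto
  have q: "((\<lambda>a. a / sqrt (a\<^sup>2 + b\<^sup>2)) \<longlongrightarrow> 0 / sqrt (0\<^sup>2 + b\<^sup>2)) (at_right 0)"
    using b by (intro tendsto_intros) auto
  have pos: "\<forall>\<^sub>F a in at_right 0. (0::real) < a" by (simp add: eventually_at_right_less)
  have P: "((\<lambda>a. (a / sqrt (a\<^sup>2 + b\<^sup>2)) powr s) \<longlongrightarrow> 0) (at_right 0)"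
    using q s by (intro tendsto_zero_powrI[where b=s]) (auto intro: eventually_mono[OF pos])
  have A: "((\<lambda>a::real. a powr s) \<longlongrightarrow> 0) (at_right 0)"
    using s by (intro tendsto_zero_powrI[where b=s]) (auto intro: eventually_mono[OF pos])
  have B: "((\<lambda>a::real. (a\<^sup>2 + b\<^sup>2) powr (-1/2)) \<longlongrightarrow> (0\<^sup>2 + b\<^sup>2) powr (-1/2)) (at_right 0)"
    using b by (intro tendsto_intros) auto
  have "(mass_primitive s b \<longlongrightarrow> 0 * ?H 0 - 0 * b powr (1-s) * (0\<^sup>2 + b\<^sup>2) powr (-1/2)) (at_right 0)"
    unfolding mass_primitive_def[abs_def] hyp_part_def by (intro tendsto_intros P H A B)
  then show ?thesis by simp
qed

lemma F_s_deriv: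
  assumes s: "0 < s" "s < 1" and b: "0 < b" and a: "0 < a"
  shows "(F_s s q b has_real_derivative
     - s * (Gamma (1 + s) / (2 powr s * Gamma ((1 + s) / 2))) * a powr (-s-1) *
     (Gamma ((1 - s) / 2) - q * (sqrt pi / Gamma (1 + s / 2)) * mass_primitive s b a)) (at a)"
proof -
  define A where "A = Gamma (1 + s) / (2 powr s * Gamma ((1 + s) / 2))"
  define k where "k = q * (sqrt pi / Gamma (1 + s / 2))"
  define X where "X = b powr (1-s) * (a\<^sup>2 + b\<^sup>2) powr (-1/2)"
  have F: "F_s s q b = (\<lambda>a. A * a powr (-s) * (Gamma ((1 - s) / 2) - k * hyp_part s b a))"
    by (simp add: fun_eq_iff F_s_def A_def k_def hyp_part_def)
  have h: "(hyp_part s b has_real_derivative s * a powr (s-1) * X) (at a)"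
    using hyp_part_deriv[OF s b a] by (simp add: X_def mult.assoc)
  have "((\<lambda>a. A * a powr (-s) * (Gamma ((1 - s) / 2) - k * hyp_part s b a)) has_real_derivative
     A * ((-s) * a powr (-s-1)) * (Gamma ((1 - s) / 2) - k * hyp_part s b a) - A * a powr (-s) * (k * (s * a powr (s-1) * X))) (at a)"
    using a by (auto intro!: derivative_eq_intros h)
  also have "A * ((-s) * a powr (-s-1)) * (Gamma ((1 - s) / 2) - k * hyp_part s b a) - A * a powr (-s) * (k * (s * a powr (s-1) * X))
     = - s * A * a powr (-s-1) * (Gamma ((1 - s) / 2) - k * mass_primitive s b a)"
  proof -
    have "a powr (-s) * a powr (s-1) = a powr (-s-1) * a powr s"
      by (simp flip: powr_add)
    moreover have "mass_primitive s b a = hyp_part s b a - a powr s * X" by (simp add: mass_primitive_def X_def)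
    ultimately show ?thesis by algebra
  qed
  finally show ?thesis unfolding F A_def k_def .
qed


section \<open>The mass inside radius \<open>a\<close> and the critical radius\<close>

lemma mass_primitive_strict_mono:
  assumes s: "0 < s" "s < 1" and b: "0 < b" and a: "0 < a" "a < a'"
  shows "mass_primitive s b a < mass_primitive s b a'"
proof (rule DERIV_pos_imp_increasing[OF a(2)])
  fix y assume "a \<le> y" "y \<le> a'"
  then have y: "0 < y" using a by simp
  then have "y\<^sup>2 + b\<^sup>2 > 0" by (simp add: add_pos_nonneg)
  then have "b powr (1-s) * mass_rate s b y > 0" using b y by (simp add: mass_rate_def)
  then show "\<exists>d. (mass_primitive s b has_real_derivative d) (at y) \<and> 0 < d"
    using mass_primitive_deriv[OF s b y] by blast
qed

text \<open>At 0 a one-sided limit of the primitive is available, so the fundamental theorem is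
  applied on the open interval with limits at both ends.\<close>

lemma nn_integral_mass_rate:
  assumes s: "0 < s" "s < 1" and b: "0 < b" and a: "0 < a"
  shows "0 \<le> mass_primitive s b a"
    and "(\<integral>\<^sup>+t\<in>{0<..a}. ennreal (mass_rate s b t) \<partial>lborel) = ennreal (mass_primitive s b a / b powr (1-s))"
proof -
  let ?f = "\<lambda>t. b powr (1-s) * mass_rate s b t"
  have cont: "isCont ?f t" if "0 < t" for t
  proof -
    have "t\<^sup>2 + b\<^sup>2 > 0" using that by (simp add: add_pos_nonneg)
    then show ?thesis unfolding mass_rate_def using that by (intro continuous_intros) auto
  qed
  have lim: "((mass_primitive s b \<circ> real_of_ereal) \<longlongrightarrow> 0) (at_right (ereal 0))"
      "((mass_primitive s b \<circ> real_of_ereal) \<longlongrightarrow> mass_primitive s b a) (at_left (ereal a))"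
    unfolding ereal_tendsto_simps1
    using mass_primitive_tendsto_0[OF s b] DERIV_isCont[OF mass_primitive_deriv[OF s b a]]
    by (auto simp: isCont_def intro: tendsto_within_subset)
  have "set_integrable lborel (einterval (ereal 0) (ereal a)) ?f"
    and int: "(LBINT t=ereal 0..ereal a. ?f t) = mass_primitive s b a - 0"
    by (rule interval_integral_FTC_nonneg[OF _ _ _ _ lim]; use a cont mass_primitive_deriv[OF s b] in auto)+
  then have si: "integrable lborel (\<lambda>t. indicator {0<..<a} t * ?f t)"
    by (simp add: set_integrable_def)
  have "(\<integral>t. indicator {0<..<a} t * ?f t \<partial>lborel) = mass_primitive s b a"
    using int less_imp_le[OF a]
    by (simp only: interval_lebesgue_integral_def set_lebesgue_integral_def ereal_less_eq if_True einterval_eq real_scaleR_def diff_0_right)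
  moreover have "(\<integral>\<^sup>+t. ennreal (indicator {0<..<a} t * ?f t) \<partial>lborel) = ennreal (\<integral>t. indicator {0<..<a} t * ?f t \<partial>lborel)"
    by (rule nn_integral_eq_integral[OF si]) auto
  moreover have "0 \<le> (\<integral>t. indicator {0<..<a} t * ?f t \<partial>lborel)"
    by (rule Bochner_Integration.integral_nonneg) auto
  ultimately have 1: "(\<integral>\<^sup>+t. ennreal (indicator {0<..<a} t * ?f t) \<partial>lborel) = ennreal (mass_primitive s b a)"
    and nn: "0 \<le> mass_primitive s b a" by auto
  show "0 \<le> mass_primitive s b a" by (rule nn)
  have "(\<integral>\<^sup>+t\<in>{0<..a}. ennreal (mass_rate s b t) \<partial>lborel)
    = (\<integral>\<^sup>+t. ennreal (1 / b powr (1-s)) * ennreal (indicator {0<..<a} t * ?f t) \<partial>lborel)"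
  proof (rule nn_integral_cong_AE, rule AE_mp[OF AE_lborel_singleton[of a]], rule AE_I2, rule impI)
    fix t :: real assume "t \<noteq> a"
    have "ennreal (1 / b powr (1-s)) * ennreal (?f t) = ennreal (mass_rate s b t)"
      using b by (simp flip: ennreal_mult')
    then show "ennreal (mass_rate s b t) * indicator {0<..a} t = ennreal (1 / b powr (1-s)) * ennreal (indicator {0<..<a} t * ?f t)"
      using \<open>t \<noteq> a\<close> by (auto simp: indicator_def)
  qed
  also have "\<dots> = ennreal (1 / b powr (1-s)) * ennreal (mass_primitive s b a)"
    unfolding 1[symmetric] by (rule nn_integral_cmult) auto
  also have "\<dots> = ennreal (mass_primitive s b a / b powr (1-s))"
    using nn by (simp flip: ennreal_mult'')
  finally show "(\<integral>\<^sup>+t\<in>{0<..a}. ennreal (mass_rate s b t) \<partial>lborel) = ennreal (mass_primitive s b a / b powr (1-s))" .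
qed

text \<open>Substituting \<open>v = t^2\<close> gives a half-line Beta integral. It stands in for
  the limit of \<open>mass_primitive\<close> at infinity, where the hypergeometric argument tends to
  the singular point 1.\<close>

lemma nn_integral_mass_rate_total:
  assumes s: "0 < s" "s < 1" and b: "0 < b"
  shows "(\<integral>\<^sup>+t\<in>{0<..}. ennreal (mass_rate s b t) \<partial>lborel) = ennreal (Beta (1+s/2) ((1-s)/2) / 2 / b powr (1-s))"
proof -
  define f where "f v = v powr (s/2) * (b\<^sup>2 + 1 * v) powr (-3/2) / 2" for v
  have [measurable]: "f \<in> borel_measurable borel" unfolding f_def by measurable
  have "(\<integral>\<^sup>+t\<in>{0<..}. ennreal (mass_rate s b t) \<partial>lborel) = (\<integral>\<^sup>+t\<in>{0<..}. ennreal (2 * t * f (t\<^sup>2)) \<partial>lborel)"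
  proof (intro nn_integral_cong)
    fix t :: real
    have "mass_rate s b t = 2 * t * f (t\<^sup>2)" if "0 < t"
    proof -
      have "t * (t\<^sup>2) powr (s/2) = t powr (1+s)" using that by (simp add: power2_powr_half powr_add)
      then show ?thesis by (simp add: mass_rate_def f_def add.commute)
    qed
    then show "ennreal (mass_rate s b t) * indicator {0<..} t = ennreal (2 * t * f (t\<^sup>2)) * indicator {0<..} t"
      by (auto simp: indicator_def)
  qed
  also have "\<dots> = (\<integral>\<^sup>+v\<in>{0<..}. ennreal (f v) \<partial>lborel)"
    by (rule nn_integral_square_halfline) (auto simp: f_def)
  also have "\<dots> = (\<integral>\<^sup>+v. ennreal (1/2) * (ennreal (v powr (1+s/2-1) * (b\<^sup>2 + 1 * v) powr (-(1+s/2+(1-s)/2))) * indicator {0<..} v) \<partial>lborel)"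
  proof (intro nn_integral_cong)
    fix v :: real
    have e: "1+s/2-1 = s/2" "-(1+s/2+(1-s)/2) = -3/2" by (simp_all add: field_simps)
    have "ennreal (f v) = ennreal (1/2) * ennreal (v powr (1+s/2-1) * (b\<^sup>2 + 1 * v) powr (-(1+s/2+(1-s)/2)))"
      unfolding e f_def by (subst ennreal_mult'[symmetric]) simp_all
    then show "ennreal (f v) * indicator {0<..} v = ennreal (1/2) * (ennreal (v powr (1+s/2-1) * (b\<^sup>2 + 1 * v) powr (-(1+s/2+(1-s)/2))) * indicator {0<..} v)"
      by (simp only: mult.assoc)
  qed
  also have "\<dots> = ennreal (1/2) * (\<integral>\<^sup>+v\<in>{0<..}. ennreal (v powr (1+s/2-1) * (b\<^sup>2 + 1 * v) powr (-(1+s/2+(1-s)/2))) \<partial>lborel)"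
    by (rule nn_integral_cmult) auto
  also have "\<dots> = ennreal (1/2) * ennreal ((b\<^sup>2) powr (-((1-s)/2)) * 1 powr (-(1+s/2)) * Beta (1+s/2) ((1-s)/2))"
    using s b by (subst nn_integral_Beta_halfline) auto
  also have "(b\<^sup>2) powr (-((1-s)/2)) = 1 / b powr (1-s)"
    using power2_powr_half[of b "-(1-s)"] b powr_minus_divide[of b "1-s"] by (simp add: minus_divide_left)
  also have "ennreal (1/2) * ennreal (1 / b powr (1-s) * 1 powr (-(1+s/2)) * Beta (1+s/2) ((1-s)/2)) = ennreal (Beta (1+s/2) ((1-s)/2) / 2 / b powr (1-s))"
    by (subst ennreal_mult'[symmetric]) (simp_all add: mult.commute)
  finally show ?thesis .
qed

text \<open>The prefactor of the derivative is nonzero, and \<open>Gamma (3/2) = sqrt pi / 2\<close>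
  collects the remaining Gamma values into a Beta value. As the primitive tends to half of that Beta
  value, criticality says that radius \<open>a\<close> encloses the fraction \<open>1/q\<close> of
  the total mass.\<close>

lemma F_s_critical_iff:
  assumes s: "0 < s" "s < 1" and q: "0 < q" and b: "0 < b" and a: "0 < a"
  shows "(F_s s q b has_real_derivative 0) (at a) \<longleftrightarrow> mass_primitive s b a = Beta (1+s/2) ((1-s)/2) / (2 * q)"
proof -
  define d where "d = - s * (Gamma (1 + s) / (2 powr s * Gamma ((1 + s) / 2))) * a powr (-s-1) *
     (Gamma ((1 - s) / 2) - q * (sqrt pi / Gamma (1 + s / 2)) * mass_primitive s b a)"
  have "(F_s s q b has_real_derivative d) (at a)" unfolding d_def by (rule F_s_deriv[OF s b a])
  then have "(F_s s q b has_real_derivative 0) (at a) \<longleftrightarrow> d = 0" by (metis DERIV_unique)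
  have G: "Gamma (1+s) > 0" "Gamma ((1+s)/2) > 0" "Gamma (1+s/2) > 0" "Gamma ((1-s)/2) > 0"
    using s by (auto intro!: Gamma_real_pos)
  have "Gamma (3/2 :: real) = sqrt pi / 2"
  proof -
    have "(1/2::real) \<notin> \<int>\<^sub>\<le>\<^sub>0" by (auto dest: nonpos_Ints_nonpos)
    from Gamma_plus1[OF this] show ?thesis by (simp add: Gamma_one_half_real)
  qed
  then have B: "Beta (1+s/2) ((1-s)/2) = 2 * (Gamma (1+s/2) * Gamma ((1-s)/2) / sqrt pi)"
  proof -
    have e: "1+s/2+(1-s)/2 = 3/2" by (simp add: field_simps)
    show ?thesis unfolding Beta_def e \<open>Gamma (3/2 :: real) = sqrt pi / 2\<close> by simp
  qed
  have Gn: "Gamma (1+s) \<noteq> 0" "Gamma ((1+s)/2) \<noteq> 0" "Gamma (1+s/2) \<noteq> 0"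
    using G by (metis less_irrefl)+
  have "d = 0 \<longleftrightarrow> Gamma ((1 - s) / 2) = q * (sqrt pi / Gamma (1 + s / 2)) * mass_primitive s b a"
    unfolding d_def using Gn s a by simp
  also have "\<dots> \<longleftrightarrow> mass_primitive s b a = Beta (1+s/2) ((1-s)/2) / (2 * q)"
    unfolding B using Gn q by (auto simp: field_simps)
  finally show ?thesis using \<open>_ \<longleftrightarrow> d = 0\<close> by simp
qed

text \<open>The level to be attained is \<open>1/q\<close> times the supremum of the primitive,
  hence strictly between 0 and the supremum for \<open>q > 1\<close>. The intermediate value theorem
  gives a solution and strict monotonicity its uniqueness.\<close>

lemma F_s_critical_ex1:
  assumes s: "0 < s" "s < 1" and q: "1 < q" and b: "0 < b"
  shows "\<exists>!a. 0 < a \<and> (F_s s q b has_real_derivative 0) (at a)"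
proof -
  define B where "B = Beta (1+s/2) ((1-s)/2) / 2"
  have B: "B > 0" using s by (auto simp: B_def intro!: Beta_real_pos)
  define m where "m = B / q"
  have m: "0 < m" "m < B" using B q by (simp_all add: m_def field_simps)
  have crit: "(F_s s q b has_real_derivative 0) (at a) \<longleftrightarrow> mass_primitive s b a = m" if "0 < a" for a
    using F_s_critical_iff[OF s _ b that, of q] q by (simp add: m_def B_def)
  have "\<forall>\<^sub>F a in at_right 0. mass_primitive s b a < m"
    using mass_primitive_tendsto_0[OF s b] m(1) by (rule order_tendstoD)
  then obtain e where e: "e > 0" "\<And>a. 0 < a \<Longrightarrow> a < e \<Longrightarrow> mass_primitive s b a < m"
    unfolding eventually_at_right[OF zero_less_one] by auto
  \<comment> \<open>If the primitive never exceeded \<open>m\<close>, continuity from below of the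
    measure with density \<open>mass_rate\<close> would bound the total mass by \<open>m\<close>, up
    to the common factor \<open>b powr (1-s)\<close>, against \<open>m < B\<close>.\<close>
  have "\<exists>n. mass_primitive s b (real (Suc n)) > m"
  proof (rule ccontr)
    assume "\<not> ?thesis"
    then have le: "mass_primitive s b (real (Suc n)) \<le> m" for n by (auto simp: not_less)
    define \<mu> where "\<mu> = density lborel (\<lambda>t. ennreal (mass_rate s b t))"
    have em: "emeasure \<mu> A = (\<integral>\<^sup>+t\<in>A. ennreal (mass_rate s b t) \<partial>lborel)" if "A \<in> sets borel" for A
      unfolding \<mu>_def using that by (subst emeasure_density) auto
    have U: "(\<Union>n. {0<..real (Suc n)}) = {0<..}"
    proof (intro set_eqI iffI)
      fix x :: real assume "x \<in> {0<..}"
      moreover obtain n where "x \<le> real n" using real_arch_simple by blast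
      ultimately show "x \<in> (\<Union>n. {0<..real (Suc n)})" by (intro UN_I[of n]) auto
    qed auto
    have "ennreal (B / b powr (1-s)) = emeasure \<mu> (\<Union>n. {0<..real (Suc n)})"
      unfolding U using em[of "{0<..}"] nn_integral_mass_rate_total[OF s b] by (simp add: B_def)
    also have "\<dots> = (SUP n. emeasure \<mu> {0<..real (Suc n)})"
      by (rule SUP_emeasure_incseq[symmetric]) (auto simp: \<mu>_def incseq_def)
    also have "\<dots> \<le> ennreal (m / b powr (1-s))"
    proof (rule SUP_least)
      fix n
      have "emeasure \<mu> {0<..real (Suc n)} = ennreal (mass_primitive s b (real (Suc n)) / b powr (1-s))"
        using em nn_integral_mass_rate(2)[OF s b, of "real (Suc n)"] by simp
      also have "\<dots> \<le> ennreal (m / b powr (1-s))" using le[of n] by (intro ennreal_leI divide_right_mono) auto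
      finally show "emeasure \<mu> {0<..real (Suc n)} \<le> ennreal (m / b powr (1-s))" .
    qed
    finally have "B / b powr (1-s) \<le> m / b powr (1-s)" using m b by (simp add: ennreal_le_iff)
    then show False using m b by (simp add: divide_le_cancel)
  qed
  then obtain n where n: "mass_primitive s b (real (Suc n)) > m" by auto
  define l where "l = min (e/2) 1"
  have l: "0 < l" "l \<le> real (Suc n)" "mass_primitive s b l < m" using e by (auto simp: l_def)
  have "\<exists>x. l \<le> x \<and> x \<le> real (Suc n) \<and> mass_primitive s b x = m"
  proof (rule IVT')
    show "continuous_on {l..real (Suc n)} (mass_primitive s b)"
      by (rule DERIV_continuous_on, rule has_field_derivative_at_within[OF mass_primitive_deriv[OF s b]]) (use l in auto)
  qed (use l n in auto)
  then obtain x where x: "l \<le> x" "mass_primitive s b x = m" by auto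
  show ?thesis
  proof (rule ex1I[of _ x])
    show "0 < x \<and> (F_s s q b has_real_derivative 0) (at x)" using x l crit[of x] by auto
    fix y assume y: "0 < y \<and> (F_s s q b has_real_derivative 0) (at y)"
    then have "mass_primitive s b y = m" using crit by auto
    then show "y = x" using x l y mass_primitive_strict_mono[OF s b, of x y] mass_primitive_strict_mono[OF s b, of y x]
      by (cases x y rule: linorder_cases) auto
  qed
qed

section \<open>The equilibrium measure\<close>

text \<open>\<open>T\<close> is the defect of the potential of \<open>\<nu>\<close> from minus the field, so \<open>pot\<close>, \<open>T_le\<close>, \<open>T_eq\<close> are the
  Frostman conditions.\<close>

lemma equilibrium_measure_unique:
  fixes \<mu> \<nu> :: "real measure" and P :: "real \<Rightarrow> real" and T :: "real \<Rightarrow> ennreal"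
  assumes s: "0 < s" and eq: "is_equilibrium_measure s (\<lambda>x. - P x) \<mu>" and \<nu>: "borel_prob \<nu>"
    and [measurable]: "P \<in> borel_measurable borel" "T \<in> borel_measurable borel"
    and P: "\<And>x. 0 \<le> P x" "\<And>x. P x \<le> K"
    and pot: "\<And>x. (\<integral>\<^sup>+y. riesz_kernel s x y \<partial>\<nu>) + T x = ennreal (P x)"
    and T_le: "\<And>x. T x \<le> L" and T_eq: "AE x in \<nu>. T x = L"
  shows "\<mu> = \<nu>"
proof -
  have \<mu>: "borel_prob \<mu>" and min: "weighted_energy s (\<lambda>x. - P x) \<mu> \<le> weighted_energy s (\<lambda>x. - P x) \<nu>"
    using eq \<nu> by (auto simp: is_equilibrium_measure_def)
  interpret \<mu>: prob_space \<mu> using \<mu> by (simp add: borel_prob_def)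
  interpret \<nu>: prob_space \<nu> using \<nu> by (simp add: borel_prob_def)
  have s\<mu> [measurable_cong]: "sets \<mu> = sets borel" and s\<nu> [measurable_cong]: "sets \<nu> = sets borel"
    using \<mu> \<nu> by (simp_all add: borel_prob_def)
  define U where "U x = (\<integral>\<^sup>+y. riesz_kernel s x y \<partial>\<nu>)" for x
  have [measurable]: "(\<lambda>(x, y). riesz_kernel s x y) \<in> borel_measurable (borel \<Otimes>\<^sub>M borel)"
    unfolding riesz_kernel_def by measurable
  have [measurable]: "U \<in> borel_measurable borel"
    unfolding U_def[abs_def] by measurable
  have UT: "U x + T x = ennreal (P x)" for x using pot by (simp add: U_def)
  have int: "integrable M P" and ennP: "(\<integral>\<^sup>+x. ennreal (P x) \<partial>M) = ennreal (\<integral>x. P x \<partial>M)"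
    if "borel_prob M" for M
  proof -
    interpret M: prob_space M using that by (simp add: borel_prob_def)
    have [measurable_cong]: "sets M = sets borel" using that by (simp add: borel_prob_def)
    show "integrable M P" by (rule M.integrable_const_bound[of _ K]) (use P in auto)
    then show "(\<integral>\<^sup>+x. ennreal (P x) \<partial>M) = ennreal (\<integral>x. P x \<partial>M)"
      by (rule nn_integral_eq_integral) (use P in auto)
  qed
  define p\<mu> where "p\<mu> = (\<integral>x. P x \<partial>\<mu>)"
  define p\<nu> where "p\<nu> = (\<integral>x. P x \<partial>\<nu>)"
  have p0: "0 \<le> p\<mu>" "0 \<le> p\<nu>" using P by (auto simp: p\<mu>_def p\<nu>_def)
  have sum\<mu>: "ennreal p\<mu> = (\<integral>\<^sup>+x. U x \<partial>\<mu>) + (\<integral>\<^sup>+x. T x \<partial>\<mu>)"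
    unfolding p\<mu>_def ennP[OF \<mu>, symmetric] UT[symmetric] by (rule nn_integral_add) measurable
  have sum\<nu>: "ennreal p\<nu> = (\<integral>\<^sup>+x. U x \<partial>\<nu>) + (\<integral>\<^sup>+x. T x \<partial>\<nu>)"
    unfolding p\<nu>_def ennP[OF \<nu>, symmetric] UT[symmetric] by (rule nn_integral_add) measurable
  have "(\<integral>\<^sup>+x. T x \<partial>\<mu>) \<le> (\<integral>\<^sup>+x. L \<partial>\<mu>)" using T_le by (intro nn_integral_mono)
  also have "\<dots> = L" by (simp add: \<mu>.emeasure_space_1)
  finally have T\<mu>: "(\<integral>\<^sup>+x. T x \<partial>\<mu>) \<le> L" .
  have "(\<integral>\<^sup>+x. T x \<partial>\<nu>) = (\<integral>\<^sup>+x. L \<partial>\<nu>)" using T_eq by (rule nn_integral_cong_AE)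
  also have "\<dots> = L" by (simp add: \<nu>.emeasure_space_1)
  finally have T\<nu>: "(\<integral>\<^sup>+x. T x \<partial>\<nu>) = L" .
  define E\<mu> where "E\<mu> = (\<integral>\<^sup>+x. (\<integral>\<^sup>+y. riesz_kernel s x y \<partial>\<mu>) \<partial>\<mu>)"
  have E\<nu>: "(\<integral>\<^sup>+x. (\<integral>\<^sup>+y. riesz_kernel s x y \<partial>\<nu>) \<partial>\<nu>) = (\<integral>\<^sup>+x. U x \<partial>\<nu>)"
    and E\<mu>\<nu>: "(\<integral>\<^sup>+x. (\<integral>\<^sup>+y. riesz_kernel s x y \<partial>\<nu>) \<partial>\<mu>) = (\<integral>\<^sup>+x. U x \<partial>\<mu>)"
    by (simp_all add: U_def)
  \<comment> \<open>The integrals of the bounded function \<open>P\<close> are finite, so the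
    quantities below them may be compared as real numbers.\<close>
  have real: "\<exists>r\<ge>0. X = ennreal r" if "X \<le> ennreal p" for X p
    using that by (cases X) (auto simp: top_unique)
  have "\<exists>r\<ge>0. (\<integral>\<^sup>+x. U x \<partial>\<nu>) = ennreal r" "\<exists>r\<ge>0. L = ennreal r"
    by (rule real[of _ p\<nu>], simp add: sum\<nu> T\<nu>)+
  moreover have "\<exists>r\<ge>0. (\<integral>\<^sup>+x. U x \<partial>\<mu>) = ennreal r"
    by (rule real[of _ p\<mu>], simp add: sum\<mu>)
  ultimately obtain e\<nu> l e where fin: "0 \<le> e\<nu>" "(\<integral>\<^sup>+x. U x \<partial>\<nu>) = ennreal e\<nu>" "0 \<le> l" "L = ennreal l"
      "0 \<le> e" "(\<integral>\<^sup>+x. U x \<partial>\<mu>) = ennreal e"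
    by blast
  have "enn2ereal E\<mu> + ereal (- 2 * p\<mu>) \<le> enn2ereal (ennreal e\<nu>) + ereal (- 2 * p\<nu>)"
    using min unfolding weighted_energy_def E\<nu> E\<mu>_def[symmetric] fin
    by (simp add: p\<mu>_def p\<nu>_def)
  then have E\<mu>_le: "enn2ereal E\<mu> + ereal (- 2 * p\<mu>) \<le> ereal (e\<nu> - 2 * p\<nu>)"
    using fin by (simp add: enn2ereal_ennreal)
  \<comment> \<open>Minimality itself yields finite energy of \<mu>, as the right-hand side is a
    real number.\<close>
  have "E\<mu> \<noteq> \<infinity>" using E\<mu>_le by (auto simp: enn2ereal_top)
  then obtain e\<mu> where e\<mu>: "0 \<le> e\<mu>" "E\<mu> = ennreal e\<mu>" by (cases E\<mu>) auto
  have 1: "e\<mu> - 2 * p\<mu> \<le> e\<nu> - 2 * p\<nu>" using E\<mu>_le e\<mu> by (simp add: enn2ereal_ennreal)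
  have "ennreal p\<nu> = ennreal (e\<nu> + l)" unfolding sum\<nu> T\<nu> using fin by simp
  then have 2: "p\<nu> = e\<nu> + l" using fin p0 by (simp del: ennreal_plus)
  have "ennreal p\<mu> \<le> ennreal (e + l)" unfolding sum\<mu> using T\<mu> fin by (simp add: add_left_mono)
  then have 3: "p\<mu> \<le> e + l" using fin p0 by (simp del: ennreal_plus)
  \<comment> \<open>Elimination of the field: \<open>e\<mu> <= e\<nu> + 2 * (p\<mu> - p\<nu>) <=
    e\<nu> + 2 * (e - e\<nu>)\<close>, where the constant \<open>l\<close> cancels. This is the
    reverse of the inequality expressing positive definiteness.\<close>
  have "e\<mu> + e\<nu> \<le> 2 * e" using 1 2 3 by simp
  then have "ennreal (e\<mu> + e\<nu>) \<le> ennreal (2 * e)" by (rule ennreal_leI)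
  then have le: "ennreal e\<mu> + ennreal e\<nu> \<le> 2 * ennreal e"
    using e\<mu> fin by (simp add: ennreal_mult)
  show ?thesis
    by (rule mutual_energy_strict[OF s \<mu> \<nu>]; unfold E\<mu>_def[symmetric] E\<nu> E\<mu>\<nu> e\<mu> fin)
       (use le in simp_all)
qed

section \<open>Mass, potential and support of the mixtures\<close>

lemma nn_integral_riesz_kernel_density:
  fixes f :: "real \<Rightarrow> ennreal"
  assumes [measurable]: "f \<in> borel_measurable borel"
  shows "(\<integral>\<^sup>+y. riesz_kernel s x y \<partial>(density lborel f)) = (\<integral>\<^sup>+y. ennreal (\<bar>x - y\<bar> powr (-s)) * f y \<partial>lborel)"
proof -
  have [measurable]: "riesz_kernel s x \<in> borel_measurable borel" unfolding riesz_kernel_def[abs_def] by measurable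
  have "(\<integral>\<^sup>+y. riesz_kernel s x y \<partial>(density lborel f)) = (\<integral>\<^sup>+y. f y * riesz_kernel s x y \<partial>lborel)"
    by (rule nn_integral_density) auto
  also have "\<dots> = (\<integral>\<^sup>+y. ennreal (\<bar>x - y\<bar> powr (-s)) * f y \<partial>lborel)"
    by (rule nn_integral_cong_AE, rule AE_mp[OF AE_lborel_singleton[of x]])
       (auto simp: riesz_kernel_def mult.commute)
  finally show ?thesis .
qed

definition mixture :: "real \<Rightarrow> real \<Rightarrow> real set \<Rightarrow> real \<Rightarrow> ennreal" where
  "mixture s b A x = (\<integral>\<^sup>+t\<in>A. ennreal (riesz_arcsine s t x * mass_rate s b t) \<partial>lborel)"

lemma mixture_measurable [measurable]:
  assumes [measurable]: "A \<in> sets borel"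
  shows "mixture s b A \<in> borel_measurable borel"
  unfolding mixture_def[abs_def] by measurable

text \<open>Tonelli with a test function: \<open>g = 1\<close> yields the mass and the Riesz kernel
  the potential, each reduced to the corresponding fact about a single interval.\<close>

lemma nn_integral_mixture:
  assumes [measurable]: "A \<in> sets borel" "g \<in> borel_measurable borel"
  shows "(\<integral>\<^sup>+x. g x * mixture s b A x \<partial>lborel) =
    (\<integral>\<^sup>+t\<in>A. ennreal (mass_rate s b t) * (\<integral>\<^sup>+x. g x * ennreal (riesz_arcsine s t x) \<partial>lborel) \<partial>lborel)"
proof -
  have "(\<integral>\<^sup>+x. g x * mixture s b A x \<partial>lborel) =
     (\<integral>\<^sup>+x. (\<integral>\<^sup>+t. g x * (ennreal (riesz_arcsine s t x * mass_rate s b t) * indicator A t) \<partial>lborel) \<partial>lborel)"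
    unfolding mixture_def by (intro nn_integral_cong nn_integral_cmult[symmetric]) measurable
  also have "\<dots> = (\<integral>\<^sup>+t. (\<integral>\<^sup>+x. g x * (ennreal (riesz_arcsine s t x * mass_rate s b t) * indicator A t) \<partial>lborel) \<partial>lborel)"
    by (rule lborel_pair.Fubini') measurable
  also have "\<dots> = (\<integral>\<^sup>+t. (\<integral>\<^sup>+x. (ennreal (mass_rate s b t) * indicator A t) * (g x * ennreal (riesz_arcsine s t x)) \<partial>lborel) \<partial>lborel)"
    by (intro nn_integral_cong) (simp add: ennreal_mult mult_ac)
  also have "\<dots> = (\<integral>\<^sup>+t. (ennreal (mass_rate s b t) * indicator A t) * (\<integral>\<^sup>+x. g x * ennreal (riesz_arcsine s t x) \<partial>lborel) \<partial>lborel)"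
    by (intro nn_integral_cong nn_integral_cmult) measurable
  finally show ?thesis by (simp add: mult_ac)
qed

lemma mixture_potential:
  assumes "A \<in> sets borel"
  shows "(\<integral>\<^sup>+y. ennreal (\<bar>x - y\<bar> powr (-s)) * mixture s b A y \<partial>lborel) =
    (\<integral>\<^sup>+t\<in>A. ennreal (mass_rate s b t) * (\<integral>\<^sup>+y. ennreal (\<bar>x - y\<bar> powr (-s) * riesz_arcsine s t y) \<partial>lborel) \<partial>lborel)"
  by (subst nn_integral_mixture[OF assms]) (auto simp: ennreal_mult)

text \<open>Every radius strictly between the modulus of \<open>x\<close> and \<open>a\<close>
  contributes a positive amount, and these radii form a set of positive measure. Through this the
  support fills the whole interval.\<close>

lemma mixture_pos:
  assumes b: "0 < b" and x: "\<bar>x\<bar> < a"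
  shows "0 < mixture s b {0<..a} x"
proof (rule ccontr)
  assume "\<not> ?thesis"
  then have "mixture s b {0<..a} x = 0" by simp
  then have "AE t in lborel. ennreal (riesz_arcsine s t x * mass_rate s b t) * indicator {0<..a} t = 0"
    unfolding mixture_def by (subst (asm) nn_integral_0_iff_AE) measurable
  from AE_lborel_ex_between[OF this x] obtain t where t: "\<bar>x\<bar> < t" "t < a"
    "ennreal (riesz_arcsine s t x * mass_rate s b t) * indicator {0<..a} t = 0" by auto
  have t0: "0 < t" using t by linarith
  have "x\<^sup>2 < t\<^sup>2" using t by (metis abs_ge_zero power2_abs power_strict_mono zero_less_numeral)
  then have "0 < riesz_arcsine s t x" using t t0 by (simp add: riesz_arcsine_def)
  moreover have "t\<^sup>2 + b\<^sup>2 > 0" using b by (simp add: add_nonneg_pos)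
  then have "0 < mass_rate s b t" using t0 by (simp add: mass_rate_def)
  ultimately have "0 < riesz_arcsine s t x * mass_rate s b t" by simp
  then show False using t t0 by auto
qed

lemma measure_support_interval_density:
  fixes f :: "real \<Rightarrow> ennreal"
  assumes [measurable]: "f \<in> borel_measurable borel" and a: "0 < a"
    and pos: "\<And>x. \<bar>x\<bar> < a \<Longrightarrow> 0 < f x" and zero: "\<And>x. a \<le> \<bar>x\<bar> \<Longrightarrow> f x = 0"
  shows "measure_support (density lborel f) = {-a..a}"
proof (intro set_eqI iffI)
  fix x assume x: "x \<in> measure_support (density lborel f)"
  show "x \<in> {-a..a}"
  proof (rule ccontr)
    assume "x \<notin> {-a..a}"
    then have e: "\<bar>x\<bar> - a > 0" by auto
    have "emeasure (density lborel f) {x - (\<bar>x\<bar> - a)<..<x + (\<bar>x\<bar> - a)} = (\<integral>\<^sup>+y. f y * indicator {x - (\<bar>x\<bar> - a)<..<x + (\<bar>x\<bar> - a)} y \<partial>lborel)"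
      by (subst emeasure_density) auto
    also have "\<dots> = (\<integral>\<^sup>+y. 0 \<partial>(lborel :: real measure))"
    proof (intro nn_integral_cong)
      fix y
      have "a \<le> \<bar>y\<bar>" if "y \<in> {x - (\<bar>x\<bar> - a)<..<x + (\<bar>x\<bar> - a)}" using that by auto
      then show "f y * indicator {x - (\<bar>x\<bar> - a)<..<x + (\<bar>x\<bar> - a)} y = 0"
        using zero by (auto simp: indicator_def)
    qed
    finally have "emeasure (density lborel f) {x - (\<bar>x\<bar> - a)<..<x + (\<bar>x\<bar> - a)} = 0" by simp
    moreover have "emeasure (density lborel f) {x - (\<bar>x\<bar> - a)<..<x + (\<bar>x\<bar> - a)} > 0"
      using x e unfolding measure_support_def by blast
    ultimately show False by simp
  qed
next
  fix x assume x: "x \<in> {-a..a}"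
  show "x \<in> measure_support (density lborel f)"
    unfolding measure_support_def
  proof (intro CollectI allI impI, rule ccontr)
    fix e :: real assume e: "0 < e" and n: "\<not> 0 < emeasure (density lborel f) {x - e<..<x + e}"
    have "(\<integral>\<^sup>+y. f y * indicator {x - e<..<x + e} y \<partial>lborel) = 0"
      using n by (subst (asm) emeasure_density) auto
    then have "AE y in lborel. f y * indicator {x - e<..<x + e} y = 0"
      by (subst (asm) nn_integral_0_iff_AE) auto
    moreover have "max (x - e) (-a) < min (x + e) a" using x e a by auto
    ultimately obtain y where "max (x - e) (-a) < y" "y < min (x + e) a" "f y * indicator {x - e<..<x + e} y = 0"
      using AE_lborel_ex_between by blast
    then show False using pos[of y] by (auto simp: indicator_def abs_less_iff)
  qed
qed

theorem theorem2p2: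
  fixes s q b :: real and \<mu> :: "real measure"
  assumes "0 < s" "s < 1" "1 < q" "0 < b"
    and "is_equilibrium_measure s (extQ s q b) \<mu>"
  shows "(\<exists>!a. 0 < a \<and> (F_s s q b has_real_derivative 0) (at a))
       \<and> (\<forall>a. 0 < a \<and> (F_s s q b has_real_derivative 0) (at a) \<longrightarrow>
           measure_support \<mu> = {-a..a}
         \<and> (\<forall>x. \<bar>x\<bar> < a \<longrightarrow> 0 \<le> eq_density s q b a x)
         \<and> \<mu> = density lborel (\<lambda>x. if \<bar>x\<bar> < a then ennreal (eq_density s q b a x) else 0))"
proof (intro conjI allI impI)
  note s = assms(1,2) and q = assms(3) and b = assms(4)
  show "\<exists>!a. 0 < a \<and> (F_s s q b has_real_derivative 0) (at a)"
    by (rule F_s_critical_ex1[OF s q b])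
  fix a assume "0 < a \<and> (F_s s q b has_real_derivative 0) (at a)"
  then have a: "0 < a" and crit: "(F_s s q b has_real_derivative 0) (at a)" by auto
  define R where "R = rate_const s q b"
  let ?B0 = "Beta (1/2) ((1+s)/2)" and ?B2 = "Beta ((1-s)/2) ((1+s)/2)" and ?B3 = "Beta (1/2) ((1-s)/2)"
  have Bpos: "?B0 > 0" "?B2 > 0" "?B3 > 0" "Beta (1+s/2) ((1-s)/2) > 0" using s by (auto intro!: Beta_real_pos)
  have R: "R > 0" unfolding R_def rate_const_def using Bpos q b by simp
  \<comment> \<open>The candidate density: the mixture cut at \<open>a\<close>, with the constant
    under which all radii together would carry mass \<open>q\<close>.\<close>
  define f where "f x = ennreal R * mixture s b {0<..a} x" for x
  have [measurable]: "f \<in> borel_measurable borel" unfolding f_def[abs_def] by measurable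
  define \<nu> where "\<nu> = density lborel f"
  have f0: "f x = 0" if "a \<le> \<bar>x\<bar>" for x
  proof -
    have "mixture s b {0<..a} x = (\<integral>\<^sup>+t. 0 \<partial>(lborel :: real measure))"
      unfolding mixture_def using that by (intro nn_integral_cong) (auto simp: riesz_arcsine_def indicator_def)
    then show ?thesis by (simp add: f_def)
  qed
  have f_pos: "0 < f x" if "\<bar>x\<bar> < a" for x
    using mixture_pos[OF b that] R by (simp add: f_def ennreal_zero_less_mult_iff)
  have dens: "0 \<le> eq_density s q b a x" "f x = ennreal (eq_density s q b a x)" if "\<bar>x\<bar> < a" for x
    using eq_density_eq_mixture[OF s _ b that] q by (auto simp: f_def R_def mixture_def)

  have mass: "(\<integral>\<^sup>+x. f x \<partial>lborel) = 1"
  proof -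
    have "(\<integral>\<^sup>+x. f x \<partial>lborel) = ennreal R * (\<integral>\<^sup>+x. 1 * mixture s b {0<..a} x \<partial>lborel)"
      unfolding f_def by (simp add: nn_integral_cmult)
    also have "(\<integral>\<^sup>+x. 1 * mixture s b {0<..a} x \<partial>lborel) = (\<integral>\<^sup>+t\<in>{0<..a}. ennreal (mass_rate s b t) * ennreal ?B0 \<partial>lborel)"
      by (subst nn_integral_mixture) (auto intro!: nn_integral_cong simp: riesz_arcsine_mass[OF s] indicator_def)
    also have "\<dots> = (\<integral>\<^sup>+t. ennreal (mass_rate s b t) * indicator {0<..a} t * ennreal ?B0 \<partial>lborel)"
      by (simp add: mult_ac)
    also have "\<dots> = ennreal (mass_primitive s b a / b powr (1-s)) * ennreal ?B0"
      by (subst nn_integral_multc) (auto simp: nn_integral_mass_rate[OF s b a])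
    also have "ennreal R * \<dots> = ennreal (R * (mass_primitive s b a / b powr (1-s) * ?B0))"
      using R Bpos nn_integral_mass_rate(1)[OF s b a] by (simp flip: ennreal_mult)
    also have "R * (mass_primitive s b a / b powr (1-s) * ?B0) = 1"
    proof -
      \<comment> \<open>The critical equation enters here, as the normalization to mass 1.\<close>
      have "mass_primitive s b a = Beta (1+s/2) ((1-s)/2) / (2 * q)"
        using F_s_critical_iff[OF s _ b a, of q] crit q by simp
      then show ?thesis using Bpos q b by (simp add: R_def rate_const_def)
    qed
    finally show ?thesis by simp
  qed
  have \<nu>: "borel_prob \<nu>"
    unfolding borel_prob_def \<nu>_def using mass by (auto intro!: prob_spaceI simp: emeasure_density)

  define P where "P x = q * (x\<^sup>2 + b\<^sup>2) powr (-s/2)" for x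
  define pot where "pot t x = (\<integral>\<^sup>+y. ennreal (\<bar>x - y\<bar> powr (-s) * riesz_arcsine s t y) \<partial>lborel)" for t x
  have [measurable]: "(\<lambda>(x, t). pot t x) \<in> borel_measurable (borel \<Otimes>\<^sub>M borel)"
    unfolding pot_def by measurable
  \<comment> \<open>\<open>T\<close> is the potential of the removed tail; \<open>L\<close> is the
    same integral with each interval potential replaced by the constant that it takes on its own
    interval.\<close>
  define T where "T x = ennreal R * (\<integral>\<^sup>+t\<in>{a<..}. ennreal (mass_rate s b t) * pot t x \<partial>lborel)" for x
  define L where "L = ennreal R * (\<integral>\<^sup>+t\<in>{a<..}. ennreal (mass_rate s b t) * ennreal (t powr (-s) * ?B2) \<partial>lborel)"
  have [measurable]: "T \<in> borel_measurable borel" unfolding T_def[abs_def] by measurable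
  have U: "(\<integral>\<^sup>+y. riesz_kernel s x y \<partial>\<nu>) = ennreal R * (\<integral>\<^sup>+t\<in>{0<..a}. ennreal (mass_rate s b t) * pot t x \<partial>lborel)" for x
  proof -
    have "(\<integral>\<^sup>+y. riesz_kernel s x y \<partial>\<nu>) = (\<integral>\<^sup>+y. ennreal R * (ennreal (\<bar>x - y\<bar> powr (-s)) * mixture s b {0<..a} y) \<partial>lborel)"
      unfolding \<nu>_def by (subst nn_integral_riesz_kernel_density) (auto simp: f_def mult_ac)
    also have "\<dots> = ennreal R * (\<integral>\<^sup>+y. ennreal (\<bar>x - y\<bar> powr (-s)) * mixture s b {0<..a} y \<partial>lborel)"
      by (rule nn_integral_cmult) measurable
    finally show ?thesis by (simp add: mixture_potential pot_def)
  qed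
  \<comment> \<open>Adding the tail restores the full mixture. Its density is a multiple of the
    balayage density, whose potential is known, and \<open>rate_const\<close> adjusts the constant
    to that of the field.\<close>
  have sum: "(\<integral>\<^sup>+y. riesz_kernel s x y \<partial>\<nu>) + T x = ennreal (P x)" for x
  proof -
    have "(\<integral>\<^sup>+y. riesz_kernel s x y \<partial>\<nu>) + T x = ennreal R * (\<integral>\<^sup>+t\<in>{0<..}. ennreal (mass_rate s b t) * pot t x \<partial>lborel)"
    proof -
      have "(\<integral>\<^sup>+t\<in>{0<..}. ennreal (mass_rate s b t) * pot t x \<partial>lborel) =
        (\<integral>\<^sup>+t. ennreal (mass_rate s b t) * pot t x * indicator {0<..a} t + ennreal (mass_rate s b t) * pot t x * indicator {a<..} t \<partial>lborel)"
        using a by (intro nn_integral_cong) (auto simp: indicator_def)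
      also have "\<dots> = (\<integral>\<^sup>+t\<in>{0<..a}. ennreal (mass_rate s b t) * pot t x \<partial>lborel) + (\<integral>\<^sup>+t\<in>{a<..}. ennreal (mass_rate s b t) * pot t x \<partial>lborel)"
        by (rule nn_integral_add) measurable
      finally show ?thesis unfolding U T_def by (simp add: distrib_left)
    qed
    also have "(\<integral>\<^sup>+t\<in>{0<..}. ennreal (mass_rate s b t) * pot t x \<partial>lborel) = (\<integral>\<^sup>+y. ennreal (\<bar>x - y\<bar> powr (-s)) * mixture s b {0<..} y \<partial>lborel)"
      by (simp add: mixture_potential pot_def)
    also have "\<dots> = (\<integral>\<^sup>+y. ennreal (Beta ((1+s)/2) (1-s/2) / 2) * ennreal (\<bar>x - y\<bar> powr (-s) * (y\<^sup>2 + b\<^sup>2) powr (s/2-1)) \<partial>lborel)"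
    proof (intro nn_integral_cong)
      fix y
      have "mixture s b {0<..} y = ennreal (Beta ((1+s)/2) (1-s/2) * (y\<^sup>2 + b\<^sup>2) powr (s/2-1) / 2)"
        unfolding mixture_def by (rule nn_integral_arcsine_mixture[OF s b])
      then show "ennreal (\<bar>x - y\<bar> powr (-s)) * mixture s b {0<..} y = ennreal (Beta ((1+s)/2) (1-s/2) / 2) * ennreal (\<bar>x - y\<bar> powr (-s) * (y\<^sup>2 + b\<^sup>2) powr (s/2-1))"
        by (subst ennreal_mult''[symmetric]) (simp_all add: mult_ac flip: ennreal_mult')
    qed
    also have "\<dots> = ennreal (Beta ((1+s)/2) (1-s/2) / 2) * ennreal (b powr (s-1) * (x\<^sup>2 + b\<^sup>2) powr (-s/2) * ?B3)"
      unfolding balayage_potential[OF s b, symmetric] by (rule nn_integral_cmult) measurable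
    also have "ennreal R * \<dots> = ennreal (R * (Beta ((1+s)/2) (1-s/2) / 2) * (b powr (s-1) * (x\<^sup>2 + b\<^sup>2) powr (-s/2) * ?B3))"
      using R Bpos by (subst ennreal_mult''[symmetric], simp, subst ennreal_mult'[symmetric], simp, simp only: mult.assoc)
    also have "R * (Beta ((1+s)/2) (1-s/2) / 2) * (b powr (s-1) * (x\<^sup>2 + b\<^sup>2) powr (-s/2) * ?B3) = P x"
    proof -
      have "b powr (1-s) * b powr (s-1) = 1" using b by (simp flip: powr_add)
      then show ?thesis unfolding R_def rate_const_Beta[OF s] P_def using Bpos by (simp add: field_simps)
    qed
    finally show ?thesis .
  qed
  have T_le: "T x \<le> L" for x
    unfolding T_def L_def
  proof (intro mult_left_mono nn_integral_mono)
    fix t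
    show "ennreal (mass_rate s b t) * pot t x * indicator {a<..} t \<le> ennreal (mass_rate s b t) * ennreal (t powr (-s) * ?B2) * indicator {a<..} t"
      using riesz_arcsine_potential_le[OF s, of t x] a
      by (auto simp: indicator_def pot_def intro!: mult_left_mono)
  qed simp
  \<comment> \<open>For \<open>t > a\<close> the point \<open>x\<close> lies strictly inside the
    interval of radius \<open>t\<close>, where the potential is constant.\<close>
  have T_eq: "T x = L" if "\<bar>x\<bar> < a" for x
    unfolding T_def L_def
  proof (rule arg_cong[where f="(*) (ennreal R)"], rule nn_integral_cong)
    fix t
    show "ennreal (mass_rate s b t) * pot t x * indicator {a<..} t = ennreal (mass_rate s b t) * ennreal (t powr (-s) * ?B2) * indicator {a<..} t"
      using riesz_arcsine_potential[OF s, of t x] a that by (auto simp: indicator_def pot_def)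
  qed
  have "\<mu> = \<nu>"
  proof (rule equilibrium_measure_unique[OF s(1) _ \<nu>, where P=P and T=T and L=L and K="q * b powr (-s)"])
    have "extQ s q b = (\<lambda>x. - P x)" by (simp add: fun_eq_iff extQ_def P_def)
    then show "is_equilibrium_measure s (\<lambda>x. - P x) \<mu>" using assms(5) by simp
    show "P \<in> borel_measurable borel" unfolding P_def[abs_def] by measurable
    show "0 \<le> P x" for x using q by (simp add: P_def)
    show "P x \<le> q * b powr (-s)" for x
    proof -
      have "(x\<^sup>2 + b\<^sup>2) powr (-s/2) \<le> (b\<^sup>2) powr (-s/2)" using s b by (intro powr_mono2') auto
      also have "(b\<^sup>2) powr (-s/2) = b powr (-s)" using b by (simp only: power2_powr_half abs_of_pos)
      finally show ?thesis using q by (simp add: P_def)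
    qed
    \<comment> \<open>The density vanishes once the modulus of \<open>x\<close> reaches
      \<open>a\<close>, so the points outside the open interval are null for \<nu>.\<close>
    have "AE x in lborel. 0 < f x \<longrightarrow> T x = L"
      using f0 T_eq by (intro AE_I2) (metis less_irrefl not_le)
    then show "AE x in \<nu>. T x = L" unfolding \<nu>_def by (subst AE_density) auto
  qed (use sum T_le in auto)
  moreover have "f = (\<lambda>x. if \<bar>x\<bar> < a then ennreal (eq_density s q b a x) else 0)"
    using dens f0 by (auto simp: fun_eq_iff)
  ultimately show "\<mu> = density lborel (\<lambda>x. if \<bar>x\<bar> < a then ennreal (eq_density s q b a x) else 0)"
    by (simp add: \<nu>_def)
  show "measure_support \<mu> = {-a..a}"
    unfolding \<open>\<mu> = \<nu>\<close> \<nu>_def by (rule measure_support_interval_density) (use a f_pos f0 in auto)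
  show "0 \<le> eq_density s q b a x" if "\<bar>x\<bar> < a" for x using dens that by simp
qed

end
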